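(* The equivalence relation $\equiv^i_c$ on the Polish space $\mathcal{S}_g$ is analytic, and the map $\mathcal{G}:\mathbb{M}\to\mathcal{S}_g$ Borel reduces $FCO$ to $\equiv^i_c$; that is, $\mathcal{G}$ is Borel and, for all $f,g\in\mathbb{M}$, $f$ and $g$ are flip-conjugate if and only if $\mathcal{G}(f)\equiv^i_c\mathcal{G}(g)$. Moreover, the vertices of the graph $\mathcal{G}(f)$ have degree at most one, for each $f\in\mathbb{M}$.
   Context: $\mathcal{H}(2^\omega)$ is the group of homeomorphisms of $2^\omega$, with the Polish topology whose basic open sets are $\{f\mid\forall 1\leq i\leq n\ f[U_i]=V_i\}$ with $n\in\omega$ and $U_i,V_i$ clopen subsets of $2^\omega$. $\mathbb{M}\subseteq\mathcal{H}(2^\omega)$ is the Polish space of minimal homeomorphisms ($\{f^i(x)\mid i\in\mathbb{Z}\}$ dense for each $x$). $f,g\in\mathbb{M}$ are flip-conjugate (relation $FCO$) if there is $\varphi\in\mathcal{H}(2^\omega)$ with $\varphi\circ f=g\circ\varphi$ or $\varphi\circ f=g^{-1}\circ\varphi$. The continuous chromatic number $\chi_c(X,R)$ is the least cardinal $\kappa\leq\aleph_0$ for which there is a continuous map $c:X\to\kappa$ ($\kappa$ discrete) with $c(x)\neq c(y)$ whenever $(x,y)\in R$, if it exists, and $2^{\aleph_0}$ otherwise. $s(R)=R\cup R^{-1}$, $\mathrm{proj}[R]$ is the projection of $R$ on the first coordinate, and $\Delta(K)$ is the diagonal of $K$. The degree of a vertex is the number of its neighbours. Let $c,a,\overline{a}$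 be distinct letters not in $\omega$, $\mathcal{K}_{2^\infty}=\{0,1,c,a,\overline{a}\}^\omega$ (product topology), and fix a homeomorphism $\iota:\mathcal{K}_{2^\infty}\to 2^\omega$. Let $\mathbb{Q}=\{x\in\mathcal{K}_{2^\infty}\mid\exists l\in\omega\ \exists\varepsilon\in\{a,\overline{a}\}\ \forall k\geq l\ x(k)=\varepsilon\}$ and $Q=\iota[\mathbb{Q}]$ (countable). $\mathcal{K}(2^\omega)$ is the space of compact subsets of $2^\omega$ with the Vietoris topology, $2^{Q^2}$ is identified with the power set of $Q^2$ and has the product topology, and $$\mathcal{S}_g=\{(K,R)\in\mathcal{K}(2^\omega)\times 2^{Q^2}\mid R\subseteq K^2\setminus\Delta(K)\ \wedge\ \chi_c(K,R)\geq 3\}$$ with the subspace topology. On $\mathcal{S}_g$, $(K,R)\preceq^i_c(K',R')$ means that there is an injective continuous $\varphi:K\to K'$ with $R\subseteq(\varphi\times\varphi)^{-1}(R')$, and $\equiv^i_c$ is the associated equivalence relation $\preceq^i_c\cap(\preceq^i_c)^{-1}$. Fix a map $\zeta:\omega\to\mathbb{Z}$ taking each integer value infinitely many times, and define sequences of integers $(L_l)_{l\in\omega},(R_l)_{l\in\omega}$ by $L_{2m}=R_{2m+1}=\zeta(m)$ for $m\in\omega$ and $R_l-L_l=2l+1$ for $l\in\omega$. For $f\in\mathbb{M}$, $l\in\omega$ and $L_l\leq i\leq R_l$, let $f_{l,i}=f^i(0^\infty)|(l+1)\in\{0,1\}^{l+1}$ (the first $l+1$ coordinates), and $$\mathbb{O}_f=\{(c^{l+1}a\overline{a}^\infty,\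 f_{l,L_l}\overline{a}a^\infty)\mid l\in\omega\}\cup\{(f_{l,L_l+i}a^{i+1}\overline{a}^\infty,\ f_{l,L_l+i+1}\overline{a}^{i+2}a^\infty)\mid l\in\omega,\ i\leq 2l\}\cup\{(f_{l,R_l}a^{2l+2}\overline{a}^\infty,\ c^{l+1}\overline{a}a^\infty)\mid l\in\omega\},$$ $\mathbb{G}_f=s(\mathbb{O}_f)$ (a countable graph on $\mathcal{K}_{2^\infty}$, words being concatenated). Finally $\mathcal{G}(f)=\Big(\overline{\mathrm{proj}\big[(\iota\times\iota)[\mathbb{G}_f]\big]},\ (\iota\times\iota)[\mathbb{G}_f]\Big)$, the closure being taken in $2^\omega$. *)

theory Defs
  imports
    "HOL-Analysis.Analysis"
    "HOL-Library.Extended"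
    "HOL-Library.Extended_Nat"
    "HOL-Library.Omega_Words_Fun"
begin

definition polish_space :: "'a topology \<Rightarrow> bool" where
  "polish_space X \<longleftrightarrow> completely_metrizable_space X \<and> second_countable X"

text \<open>
  Analytic: continuous image of a Polish space. A Polish space has at most continuum many
  points, so up to homeomorphism every Polish space is a topology on a set of elements of
  \<^typ>\<open>nat \<Rightarrow> nat\<close>; fixing this carrier type loses no generality. The empty set is analytic.
\<close>
definition analytic_in :: "'a topology \<Rightarrow> 'a set \<Rightarrow> bool" where
  "analytic_in X A \<longleftrightarrow>
     (\<exists>(Y :: (nat \<Rightarrow> nat) topology) h.
        polish_space Y \<and> continuous_map Y X h \<and> h ` topspace Y = A)"

definition borel_of :: "'a topology \<Rightarrow> 'a measure" where
  "borel_of X = sigma (topspace X) {U. openin X U}"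

definition borel_reduces ::
  "'a topology \<Rightarrow> ('a \<times> 'a) set \<Rightarrow> 'b topology \<Rightarrow> ('b \<times> 'b) set \<Rightarrow> ('a \<Rightarrow> 'b) \<Rightarrow> bool" where
  "borel_reduces X E Y F h \<longleftrightarrow>
     h \<in> measurable (borel_of X) (borel_of Y) \<and>
     (\<forall>x \<in> topspace X. \<forall>y \<in> topspace X. (x, y) \<in> E \<longleftrightarrow> (h x, h y) \<in> F)"

text \<open>The space of all compact subsets, the empty set included.\<close>
definition vietoris :: "'a topology \<Rightarrow> 'a set topology" where
  "vietoris X = topology_generated_by
     ({{K. compactin X K \<and> K \<subseteq> U} | U. openin X U} \<union>
      {{K. compactin X K \<and> K \<inter> U \<noteq> {}} | U. openin X U})"

text \<open>The power set of a set, identified with a power of the discrete two-point space.\<close>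
definition powerset_topology :: "'a set \<Rightarrow> 'a set topology" where
  "powerset_topology A =
     pullback_topology (Pow A) (\<lambda>R. restrict (\<lambda>p. p \<in> R) A)
       (product_topology (\<lambda>_. discrete_topology (UNIV :: bool set)) A)"

definition seq_space :: "(nat \<Rightarrow> 'a) topology" where
  "seq_space = product_topology (\<lambda>_. discrete_topology UNIV) UNIV"

type_synonym cantor = "nat \<Rightarrow> bool"

abbreviation cantor_space :: "cantor topology" where
  "cantor_space \<equiv> seq_space"

definition homeos :: "(cantor \<Rightarrow> cantor) set" where
  "homeos = {f. homeomorphic_map cantor_space cantor_space f}"

definition clopen :: "cantor set \<Rightarrow> bool" where
  "clopen U \<longleftrightarrow> openin cantor_space U \<and> closedin cantor_space U"

definition homeo_space :: "(cantor \<Rightarrow> cantor) topology" where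
  "homeo_space = topology_generated_by
     {{f \<in> homeos. \<forall>(U, V) \<in> P. f ` U = V} | P.
        finite P \<and> (\<forall>(U, V) \<in> P. clopen U \<and> clopen V)}"

definition iterate :: "('a \<Rightarrow> 'a) \<Rightarrow> int \<Rightarrow> 'a \<Rightarrow> 'a" where
  "iterate f i = (if 0 \<le> i then f ^^ nat i else inv f ^^ nat (- i))"

definition minimal_homeos :: "(cantor \<Rightarrow> cantor) set" where
  "minimal_homeos =
     {f \<in> homeos. \<forall>x. cantor_space closure_of range (\<lambda>i. iterate f i x) = UNIV}"

definition minimal_space :: "(cantor \<Rightarrow> cantor) topology" where
  "minimal_space = subtopology homeo_space minimal_homeos"

definition FCO :: "((cantor \<Rightarrow> cantor) \<times> (cantor \<Rightarrow> cantor)) set" where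
  "FCO = {(f, g). f \<in> minimal_homeos \<and> g \<in> minimal_homeos \<and>
            (\<exists>\<phi> \<in> homeos. \<phi> \<circ> f = g \<circ> \<phi> \<or> \<phi> \<circ> f = inv g \<circ> \<phi>)}"

text \<open>
  A cardinal \<open>\<le> \<aleph>\<^sub>0\<close> is represented by a \<^typ>\<open>enat\<close> \<open>k\<close> (where the infinite
  value stands for \<open>\<aleph>\<^sub>0\<close>) and, as a set of colours, by \<open>{i. enat i < k}\<close>.
\<close>
definition cont_colourable :: "'a topology \<Rightarrow> ('a \<times> 'a) set \<Rightarrow> enat \<Rightarrow> bool" where
  "cont_colourable X R k \<longleftrightarrow>
     (\<exists>c. continuous_map X (discrete_topology {i. enat i < k}) c \<and>
          (\<forall>(x, y) \<in> R. c x \<noteq> c y))"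

text \<open>
  \<open>Pinf\<close>, which lies above all \<open>Fin k\<close> including \<open>k = \<aleph>\<^sub>0\<close>, stands for the continuum.
\<close>
definition cont_chromatic :: "'a topology \<Rightarrow> ('a \<times> 'a) set \<Rightarrow> enat extended" where
  "cont_chromatic X R =
     (if \<exists>k. cont_colourable X R k then Fin (LEAST k. cont_colourable X R k) else Pinf)"

definition neighbours :: "('a \<times> 'a) set \<Rightarrow> 'a \<Rightarrow> 'a set" where
  "neighbours R x = {y. (x, y) \<in> R}"

datatype letter = L0 | L1 | Lc | La | Lb  \<comment> \<open>\<open>Lb\<close> is the letter a-bar\<close>

abbreviation K_space :: "(nat \<Rightarrow> letter) topology" where
  "K_space \<equiv> seq_space"

definition QK :: "(nat \<Rightarrow> letter) set" where
  "QK = {x. \<exists>l. \<exists>e \<in> {La, Lb}. \<forall>k \<ge> l. x k = e}"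

type_synonym cgraph = "cantor set \<times> (cantor \<times> cantor) set"

context
  fixes \<iota> :: "(nat \<Rightarrow> letter) \<Rightarrow> cantor"
begin

definition Q_iota :: "cantor set" where
  "Q_iota = \<iota> ` QK"

definition Sg :: "cgraph set" where
  "Sg = {(K, R). compactin cantor_space K \<and> R \<subseteq> Q_iota \<times> Q_iota \<and> R \<subseteq> K \<times> K - Id_on K \<and>
           cont_chromatic (subtopology cantor_space K) R \<ge> Fin 3}"

definition Sg_space :: "cgraph topology" where
  "Sg_space =
     subtopology (prod_topology (vietoris cantor_space) (powerset_topology (Q_iota \<times> Q_iota))) Sg"

end

definition inj_cont_le :: "cgraph \<Rightarrow> cgraph \<Rightarrow> bool" where
  "inj_cont_le G G' \<longleftrightarrow>
     (\<exists>\<phi>. continuous_map (subtopology cantor_space (fst G)) (subtopology cantor_space (fst G')) \<phi> \<and>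
          inj_on \<phi> (fst G) \<and>
          snd G \<subseteq> {(x, y) \<in> fst G \<times> fst G. (\<phi> x, \<phi> y) \<in> snd G'})"

definition inj_cont_equiv :: "((nat \<Rightarrow> letter) \<Rightarrow> cantor) \<Rightarrow> (cgraph \<times> cgraph) set" where
  "inj_cont_equiv \<iota> =
     {(G, G'). G \<in> Sg \<iota> \<and> G' \<in> Sg \<iota> \<and> inj_cont_le G G' \<and> inj_cont_le G' G}"

definition digit :: "bool \<Rightarrow> letter" where
  "digit b = (if b then L1 else L0)"

text \<open>The word \<open>f\<^sub>l\<^sub>,\<^sub>i\<close>: the first \<open>l + 1\<close> coordinates of the \<open>i\<close>-th iterate of \<open>0\<^sup>\<infinity>\<close>.\<close>
definition orbit_word :: "(cantor \<Rightarrow> cantor) \<Rightarrow> nat \<Rightarrow> int \<Rightarrow> letter list" where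
  "orbit_word f l i = map (\<lambda>k. digit (iterate f i (\<lambda>_. False) k)) [0..<l + 1]"

context
  fixes Ls Rs :: "nat \<Rightarrow> int" and f :: "cantor \<Rightarrow> cantor"
begin

definition OO_graph :: "((nat \<Rightarrow> letter) \<times> (nat \<Rightarrow> letter)) set" where
  "OO_graph =
     {((replicate (l + 1) Lc @ [La]) \<frown> [Lb]\<^sup>\<omega>,
       (orbit_word f l (Ls l) @ [Lb]) \<frown> [La]\<^sup>\<omega>) | l. True} \<union>
     {((orbit_word f l (Ls l + int i) @ replicate (i + 1) La) \<frown> [Lb]\<^sup>\<omega>,
       (orbit_word f l (Ls l + int i + 1) @ replicate (i + 2) Lb) \<frown> [La]\<^sup>\<omega>) | l i. i \<le> 2 * l} \<union>
     {((orbit_word f l (Rs l) @ replicate (2 * l + 2) La) \<frown> [Lb]\<^sup>\<omega>,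
       (replicate (l + 1) Lc @ [Lb]) \<frown> [La]\<^sup>\<omega>) | l. True}"

definition GG_graph :: "((nat \<Rightarrow> letter) \<times> (nat \<Rightarrow> letter)) set" where
  "GG_graph = OO_graph \<union> OO_graph\<inverse>"

end

definition graph_of ::
  "((nat \<Rightarrow> letter) \<Rightarrow> cantor) \<Rightarrow> (nat \<Rightarrow> int) \<Rightarrow> (nat \<Rightarrow> int) \<Rightarrow> (cantor \<Rightarrow> cantor) \<Rightarrow> cgraph" where
  "graph_of \<iota> Ls Rs f =
     (let E = map_prod \<iota> \<iota> ` GG_graph Ls Rs f in (cantor_space closure_of fst ` E, E))"

end

theory Submission
  imports Defs
begin

text \<open>
  Polishness and analyticity are a matter of coding. A compact subset of Cantor space is
  determined by the tree of binary words whose cylinders it meets, which makes the hyperspace Polish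
  (\<open>polish_space_vietoris_cantor\<close>). There are only countably many clopen sets, and a continuous
  map on a compact set is determined by a sequence of them, one for each coordinate of the value. Hence
  the absence of a continuous two-colouring is a countable conjunction of open conditions
  (\<open>Sg_iff\<close>), so the graphs form a \<open>G\<^sub>\<delta>\<close> set; and the triples consisting of two graphs and a code of
  an injective continuous homomorphism between them form a \<open>G\<^sub>\<delta>\<close> set (\<open>gdelta_in_codes\<close>), so
  comparability is a projection of a Polish space.

  For the reduction, consider how the graph of \<open>f\<close> accumulates. Its vertices are isolated, each lies
  on exactly one edge, and they accumulate at a copy of Cantor space and at the point
  \<open>c\<^sup>\<infinity>\<close>. The edges of level \<open>l\<close> follow a segment of the orbit of \<open>0\<^sup>\<infinity>\<close> that starts
  and ends near \<open>c\<^sup>\<infinity>\<close>. If nearby vertices are identified they form an odd cycle, which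
  excludes continuous two-colourings (\<open>no_two_colouring\<close>). The limits of edges between points of
  Cantor space are exactly the pairs \<open>(x, f x)\<close> and their inverses, and \<open>c\<^sup>\<infinity>\<close> is joined by limit
  edges to all of Cantor space, because the segments start at every point of the orbit, infinitely often
  (\<open>limit_edge_orbit\<close>, \<open>limit_edge_emb\<close>, \<open>limit_edge_cinf\<close>).

  A continuous injective homomorphism preserves limit points and limit edges. It therefore fixes
  \<open>c\<^sup>\<infinity>\<close>, the only limit point with infinitely many limit neighbours, and maps Cantor space to
  itself sending consecutive points \<open>x\<close>, \<open>f x\<close> to points that are consecutive for \<open>g\<close> in one of the two
  orders. The points at which a given order occurs form a closed invariant set, so by minimality
  the order is constant, and the map is a conjugacy of \<open>f\<close> with \<open>g\<close> or with the inverse of \<open>g\<close>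
  (\<open>conjugate_if_homomorphism\<close>). Conversely, a conjugacy maps limit edges to limit edges. As each limit edge is
  approximated by infinitely many edges and every vertex lies on one edge only, edges can be sent,
  one by one and injectively, to edges close to the image of their position
  (\<open>homomorphism_if_conjugate\<close>).

  Finally the reduction is even continuous (\<open>continuous_map_graph_of\<close>): a vertex depends on finitely many
  coordinates of an iterate of \<open>f\<close>, and the limit points do not depend on \<open>f\<close> at all.
\<close>

section \<open>Sequences over a discrete alphabet\<close>

definition agree :: "nat \<Rightarrow> (nat \<Rightarrow> 'a) \<Rightarrow> (nat \<Rightarrow> 'a) \<Rightarrow> bool" where
  "agree n x y \<longleftrightarrow> (\<forall>k<n. x k = y k)"

lemma agree_refl [simp]: "agree n x x"
  by (simp add: agree_def)

lemma agree_sym: "agree n x y \<Longrightarrow> agree n y x"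
  by (simp add: agree_def)

lemma agree_trans: "agree n x y \<Longrightarrow> agree n y z \<Longrightarrow> agree n x z"
  by (simp add: agree_def)

lemma agree_mono: "agree n x y \<Longrightarrow> m \<le> n \<Longrightarrow> agree m x y"
  by (simp add: agree_def)

lemma agree_0 [simp]: "agree 0 x y"
  by (simp add: agree_def)

lemma eq_if_agree: "(\<And>n. agree n x y) \<Longrightarrow> x = y"
  by (auto simp: agree_def)

lemma topspace_seq_space [simp]: "topspace seq_space = UNIV"
  by (simp add: seq_space_def)

lemma continuous_map_into_seq_space:
  "continuous_map X seq_space f \<longleftrightarrow> (\<forall>k. continuous_map X (discrete_topology UNIV) (\<lambda>x. f x k))"
  by (simp add: seq_space_def continuous_map_componentwise_UNIV)

lemma continuous_map_coordinate:
  "continuous_map seq_space (discrete_topology UNIV) (\<lambda>x. x k)"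
  unfolding seq_space_def by (rule continuous_map_product_projection) simp

lemma openin_cylinder: "openin seq_space {y. agree n x y}"
proof (induction n)
  case (Suc n)
  have "openin seq_space {y \<in> topspace seq_space. y n \<in> {x n}}"
    by (rule openin_continuous_map_preimage[OF continuous_map_coordinate]) simp
  then have "openin seq_space ({y. agree n x y} \<inter> {y. y n = x n})"
    using Suc by (intro openin_Int) auto
  moreover have "{y. agree n x y} \<inter> {y. y n = x n} = {y. agree (Suc n) x y}"
    by (auto simp: agree_def less_Suc_eq)
  ultimately show ?case by simp
qed (use openin_topspace[of seq_space] in simp)

lemma openin_seq_space:
  "openin seq_space U \<longleftrightarrow> (\<forall>x\<in>U. \<exists>n. \<forall>y. agree n x y \<longrightarrow> y \<in> U)" (is "?L \<longleftrightarrow> ?R")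
proof
  assume ?L
  show ?R
  proof
    fix x assume "x \<in> U"
    then obtain V where V: "finite {i. V i \<noteq> UNIV}" "x \<in> Pi\<^sub>E UNIV V" "Pi\<^sub>E UNIV V \<subseteq> U"
      using \<open>?L\<close> unfolding seq_space_def openin_product_topology_alt by (auto simp: PiE_UNIV_domain)
    obtain n where n: "\<And>i. V i \<noteq> UNIV \<Longrightarrow> i < n"
      using V(1) finite_nat_bounded[of "{i. V i \<noteq> UNIV}"] by auto
    have "y \<in> U" if "agree n x y" for y
    proof -
      have "y i \<in> V i" for i
      proof (cases "V i = UNIV")
        case False
        then have "y i = x i" using that n[of i] by (simp add: agree_def)
        then show ?thesis using V(2) by auto
      qed simp
      then show ?thesis using V(3) by (auto simp: PiE_UNIV_domain)
    qed
    then show "\<exists>n. \<forall>y. agree n x y \<longrightarrow> y \<in> U" by blast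
  qed
next
  assume ?R
  have "\<exists>T. openin seq_space T \<and> x \<in> T \<and> T \<subseteq> U" if x: "x \<in> U" for x
  proof -
    obtain n where "\<forall>y. agree n x y \<longrightarrow> y \<in> U" using \<open>?R\<close> x by blast
    then show ?thesis
      by (intro exI[of _ "{y. agree n x y}"]) (auto simp: openin_cylinder)
  qed
  then show ?L by (subst openin_subopen) blast
qed

lemma closedin_seq_space:
  "closedin seq_space S \<longleftrightarrow> (\<forall>x. (\<forall>n. \<exists>y\<in>S. agree n x y) \<longrightarrow> x \<in> S)"
proof -
  have "closedin seq_space S \<longleftrightarrow> openin seq_space (- S)"
    by (simp add: closedin_def Compl_eq_Diff_UNIV)
  also have "\<dots> \<longleftrightarrow> (\<forall>x. x \<notin> S \<longrightarrow> (\<exists>n. \<forall>y. agree n x y \<longrightarrow> y \<notin> S))"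
    by (simp add: openin_seq_space Ball_def)
  finally show ?thesis by blast
qed

lemma in_closure_of_seq_space:
  "x \<in> seq_space closure_of S \<longleftrightarrow> (\<forall>n. \<exists>y\<in>S. agree n x y)"
proof
  assume x: "x \<in> seq_space closure_of S"
  have "\<exists>y\<in>S. y \<in> {y. agree n x y}" for n
    using x openin_cylinder[of n x] unfolding in_closure_of by (metis agree_refl mem_Collect_eq)
  then show "\<forall>n. \<exists>y\<in>S. agree n x y" by simp
next
  assume R: "\<forall>n. \<exists>y\<in>S. agree n x y"
  then show "x \<in> seq_space closure_of S"
    unfolding in_closure_of openin_seq_space by (metis UNIV_I topspace_seq_space)
qed

lemma continuous_map_seq_space:
  "continuous_map (subtopology seq_space K) (subtopology seq_space L) f \<longleftrightarrow>
     f ` K \<subseteq> L \<and> (\<forall>x\<in>K. \<forall>n. \<exists>m. \<forall>y\<in>K. agree m x y \<longrightarrow> agree n (f x) (f y))"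
  (is "?lhs \<longleftrightarrow> ?rhs")
proof
  assume l: ?lhs
  then have im: "f ` K \<subseteq> L" and c: "continuous_map (subtopology seq_space K) seq_space f"
    by (auto simp: continuous_map_in_subtopology)
  have "\<exists>m. \<forall>y\<in>K. agree m x y \<longrightarrow> agree n (f x) (f y)" if "x \<in> K" for x n
  proof -
    have "openin (subtopology seq_space K) {y \<in> K. f y \<in> {z. agree n (f x) z}}"
      using openin_continuous_map_preimage[OF c openin_cylinder[of n "f x"]] by simp
    then obtain T where T: "openin seq_space T" "{y \<in> K. agree n (f x) (f y)} = T \<inter> K"
      by (auto simp: openin_subtopology)
    have "x \<in> T \<inter> K" unfolding T(2)[symmetric] using that by simp
    then have "x \<in> T" by simp
    then obtain m where "\<forall>y. agree m x y \<longrightarrow> y \<in> T"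
      using T(1) by (auto simp: openin_seq_space)
    then have "\<forall>y\<in>K. agree m x y \<longrightarrow> y \<in> {y \<in> K. agree n (f x) (f y)}"
      unfolding T(2) by simp
    then show ?thesis by auto
  qed
  with im show ?rhs by blast
next
  assume r: ?rhs
  have "continuous_map (subtopology seq_space K) seq_space f"
    unfolding continuous_map_def
  proof (intro conjI allI impI)
    fix U :: "(nat \<Rightarrow> 'b) set" assume U: "openin seq_space U"
    let ?S = "{x \<in> K. f x \<in> U}"
    have "\<exists>T. openin (subtopology seq_space K) T \<and> x \<in> T \<and> T \<subseteq> ?S" if x: "x \<in> ?S" for x
    proof -
      have xK: "x \<in> K" and fx: "f x \<in> U" using x by auto
      obtain n where n: "\<And>y. agree n (f x) y \<Longrightarrow> y \<in> U"
        using U fx unfolding openin_seq_space by meson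
      obtain m where m: "\<And>y. y \<in> K \<Longrightarrow> agree m x y \<Longrightarrow> agree n (f x) (f y)"
        using r xK by meson
      let ?T = "K \<inter> {y. agree m x y}"
      have "openin (subtopology seq_space K) ?T"
        using openin_subtopology_Int2[OF openin_cylinder] by blast
      moreover have "?T \<subseteq> ?S" using m n by auto
      ultimately show ?thesis using x by (intro exI[of _ ?T]) simp
    qed
    then have "openin (subtopology seq_space K) ?S"
      by (subst openin_subopen) simp
    then show "openin (subtopology seq_space K) {x \<in> topspace (subtopology seq_space K). f x \<in> U}"
      by simp
  qed auto
  with r show ?lhs by (auto simp: continuous_map_in_subtopology)
qed

lemma continuous_agree:
  assumes "continuous_map seq_space seq_space h"
  shows "\<exists>m. \<forall>y. agree m x y \<longrightarrow> agree n (h x) (h y)"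
proof -
  have "continuous_map (subtopology seq_space UNIV) (subtopology seq_space UNIV) h" using assms by simp
  then have "\<forall>x\<in>UNIV. \<forall>n. \<exists>m. \<forall>y\<in>UNIV. agree m x y \<longrightarrow> agree n (h x) (h y)"
    unfolding continuous_map_seq_space by (rule conjunct2)
  then show ?thesis by simp
qed

lemma Hausdorff_seq_space: "Hausdorff_space seq_space"
  by (simp add: seq_space_def Hausdorff_space_product_topology)

lemma compact_seq_space: "compact_space (seq_space :: (nat \<Rightarrow> 'a) topology)" if "finite (UNIV :: 'a set)"
  using that by (simp add: seq_space_def compact_space_product_topology compact_space_discrete_topology)

lemma compactin_finite_cylinders:
  assumes K: "compactin seq_space K"
  obtains G where "finite G" "G \<subseteq> K" "\<And>x. x \<in> K \<Longrightarrow> \<exists>z\<in>G. agree (N z) z x"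
proof -
  let ?C = "\<lambda>x. {y. agree (N x) x y}"
  have "\<exists>F. finite F \<and> F \<subseteq> ?C ` K \<and> K \<subseteq> \<Union>F"
    using agree_refl by (intro compactinD[OF K]) (auto simp: openin_cylinder)
  then obtain F where F: "finite F" "F \<subseteq> ?C ` K" "K \<subseteq> \<Union>F" by blast
  then obtain G where G: "finite G" "G \<subseteq> K" "F = ?C ` G" by (meson finite_subset_image)
  have "\<exists>z\<in>G. agree (N z) z x" if "x \<in> K" for x
    using that F(3) G(3) by auto
  then show ?thesis using that G(1,2) by blast
qed

text \<open>
  The Lebesgue number of an open cover, in the form used throughout: a neighbourhood of a compact
  set contains all sequences that agree up to a fixed length with a member of the set.
\<close>
lemma compactin_uniform_neighbourhood:
  assumes K: "compactin seq_space K" and U: "openin seq_space U" "K \<subseteq> U"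
  obtains n where "\<And>x y. x \<in> K \<Longrightarrow> agree n x y \<Longrightarrow> y \<in> U"
proof -
  have "\<forall>x\<in>K. \<exists>n. \<forall>y. agree n x y \<longrightarrow> y \<in> U"
    using U by (auto simp: openin_seq_space)
  then obtain N where N: "\<And>x y. x \<in> K \<Longrightarrow> agree (N x) x y \<Longrightarrow> y \<in> U" by metis
  obtain G where G: "finite G" "G \<subseteq> K" "\<And>x. x \<in> K \<Longrightarrow> \<exists>z\<in>G. agree (N z) z x"
    using compactin_finite_cylinders[OF K] by blast
  have "y \<in> U" if x: "x \<in> K" and xy: "agree (\<Sum>z\<in>G. N z) x y" for x y
  proof -
    obtain z where z: "z \<in> G" "agree (N z) z x" using x G(3) by blast
    moreover have "N z \<le> (\<Sum>z\<in>G. N z)" using z G(1) by (simp add: member_le_sum)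
    ultimately show ?thesis using N G(2) xy by (meson agree_mono agree_trans subsetD)
  qed
  then show ?thesis by (rule that)
qed

lemma uniformly_locally_constant:
  fixes K :: "(nat \<Rightarrow> 'a) set"
  assumes K: "compactin seq_space K"
    and c: "continuous_map (subtopology seq_space K) (discrete_topology D) c"
  obtains n where "\<And>x y. x \<in> K \<Longrightarrow> y \<in> K \<Longrightarrow> agree n x y \<Longrightarrow> c x = c y"
proof -
  have "\<exists>n. \<forall>y\<in>K. agree n x y \<longrightarrow> c y = c x" if x: "x \<in> K" for x
  proof -
    have cx: "c x \<in> D" using c x by (auto simp: continuous_map_def)
    then have "openin (subtopology seq_space K) {y \<in> topspace (subtopology seq_space K). c y \<in> {c x}}"
      using c by (intro openin_continuous_map_preimage) auto
    then obtain T where T: "openin seq_space T" "{y \<in> K. c y = c x} = T \<inter> K"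
      by (auto simp: openin_subtopology)
    have "x \<in> T \<inter> K" unfolding T(2)[symmetric] using x by simp
    then have "x \<in> T" by simp
    then obtain m where "\<And>y. agree m x y \<Longrightarrow> y \<in> T"
      using T(1) unfolding openin_seq_space by blast
    then have "\<forall>y\<in>K. agree m x y \<longrightarrow> y \<in> {y \<in> K. c y = c x}"
      unfolding T(2) by simp
    then show ?thesis by auto
  qed
  then obtain N where N: "\<And>x y. x \<in> K \<Longrightarrow> y \<in> K \<Longrightarrow> agree (N x) x y \<Longrightarrow> c y = c x" by metis
  obtain G where G: "finite G" "G \<subseteq> K" "\<And>x. x \<in> K \<Longrightarrow> \<exists>z\<in>G. agree (N z) z x"
    using compactin_finite_cylinders[OF K] by blast
  have "c x = c y" if x: "x \<in> K" and y: "y \<in> K" and xy: "agree (\<Sum>z\<in>G. N z) x y" for x y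
  proof -
    obtain z where z: "z \<in> G" "agree (N z) z x" using x G(3) by blast
    moreover have "N z \<le> (\<Sum>z\<in>G. N z)" using z G(1) by (simp add: member_le_sum)
    ultimately have "agree (N z) z y" using xy by (meson agree_mono agree_trans)
    then show ?thesis using N[of z x] N[of z y] z G(2) x y by auto
  qed
  then show ?thesis by (rule that)
qed

section \<open>Locally constant maps and G-delta conditions\<close>

text \<open>
  The spaces below are built from discrete spaces by products, subspaces and the Vietoris
  construction. Conditions that depend on finitely many coordinates are locally constant predicates,
  that is, clopen; they are closed under all Boolean operations, and only the last, infinite,
  quantifiers of a condition have to be treated as unions or countable intersections.
\<close>
abbreviation locally_constant :: "'a topology \<Rightarrow> ('a \<Rightarrow> 'b) \<Rightarrow> bool" where
  "locally_constant X f \<equiv> continuous_map X (discrete_topology UNIV) f"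

lemma locally_constant_iff:
  "locally_constant X f \<longleftrightarrow> (\<forall>v. openin X {x \<in> topspace X. f x = v})"
proof
  assume "locally_constant X f"
  then show "\<forall>v. openin X {x \<in> topspace X. f x = v}"
    using openin_continuous_map_preimage[of X "discrete_topology UNIV" f "{v}" for v] by simp
next
  assume *: "\<forall>v. openin X {x \<in> topspace X. f x = v}"
  have "openin X {x \<in> topspace X. f x \<in> U}" for U
  proof -
    have "{x \<in> topspace X. f x \<in> U} = (\<Union>v\<in>U. {x \<in> topspace X. f x = v})" by auto
    then show ?thesis using * by auto
  qed
  then show "locally_constant X f" by (simp add: continuous_map_def)
qed

lemma locally_constant_open:
  "locally_constant X p \<Longrightarrow> openin X {x \<in> topspace X. p x}"
  using locally_constant_iff[THEN iffD1, rule_format, of X p True] by simp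

lemma locally_constant_bool:
  "locally_constant X p \<longleftrightarrow>
     openin X {x \<in> topspace X. p x} \<and> openin X {x \<in> topspace X. \<not> p x}"
  unfolding locally_constant_iff by (auto simp: all_bool_eq)

lemma locally_constant_const: "locally_constant X (\<lambda>x. c)"
  by simp

lemma locally_constant_comp:
  assumes "locally_constant X f" shows "locally_constant X (\<lambda>x. h (f x))"
  using continuous_map_compose[OF assms, of "discrete_topology UNIV" h] by (simp add: o_def)

lemma locally_constant_pullback:
  assumes "continuous_map X Y f" "locally_constant Y p" shows "locally_constant X (\<lambda>x. p (f x))"
  using continuous_map_compose[OF assms] by (simp add: o_def)

lemma locally_constant_pair:
  assumes "locally_constant X f" "locally_constant X g"
  shows "locally_constant X (\<lambda>x. (f x, g x))"
  unfolding locally_constant_iff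
proof
  fix v :: "'b \<times> 'c"
  have "openin X ({x \<in> topspace X. f x = fst v} \<inter> {x \<in> topspace X. g x = snd v})"
    using assms by (intro openin_Int) (simp_all add: locally_constant_iff)
  moreover have "{x \<in> topspace X. f x = fst v} \<inter> {x \<in> topspace X. g x = snd v} =
      {x \<in> topspace X. (f x, g x) = v}" by auto
  ultimately show "openin X {x \<in> topspace X. (f x, g x) = v}" by simp
qed

lemma locally_constant_comp2:
  assumes "locally_constant X f" "locally_constant X g"
  shows "locally_constant X (\<lambda>x. h (f x) (g x))"
  using locally_constant_comp[OF locally_constant_pair[OF assms], of "\<lambda>(a, b). h a b"] by simp

lemma locally_constant_list:
  assumes "\<And>i. locally_constant X (f i)"
  shows "locally_constant X (\<lambda>x. map (\<lambda>i. f i x) is)"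
  by (induction "is") (auto intro: locally_constant_comp2 assms)

lemma locally_constant_Ball:
  assumes "finite F" "\<And>i. i \<in> F \<Longrightarrow> locally_constant X (p i)"
  shows "locally_constant X (\<lambda>x. \<forall>i\<in>F. p i x)"
  using assms by (induction F rule: finite_induct) (auto intro: locally_constant_comp2)

text \<open>
  A condition on \<open>x\<close> that refers to finitely much information about \<open>x\<close>, read off by a locally
  constant \<open>f\<close>, may be checked with that information frozen.
\<close>
lemma locally_constant_family:
  assumes "locally_constant X f" "\<And>v. locally_constant X (P v)"
  shows "locally_constant X (\<lambda>x. P (f x) x)"
  unfolding locally_constant_iff
proof
  fix b
  have "openin X (\<Union>v. {x \<in> topspace X. f x = v} \<inter> {x \<in> topspace X. P v x = b})"
    using assms by (intro openin_Union ballI openin_Int) (auto simp: locally_constant_iff)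
  moreover have "(\<Union>v. {x \<in> topspace X. f x = v} \<inter> {x \<in> topspace X. P v x = b}) = {x \<in> topspace X. P (f x) x = b}"
    by auto
  ultimately show "openin X {x \<in> topspace X. P (f x) x = b}" by simp
qed

lemma continuous_map_discrete_superset:
  assumes "continuous_map X (discrete_topology D) c" "D \<subseteq> E"
  shows "continuous_map X (discrete_topology E) c"
  using continuous_map_compose[OF assms(1), of "discrete_topology E" id] assms(2)
  by (auto simp: Pi_def)

lemma gdelta_in_countable_Ball:
  assumes "countable I" "\<And>i. i \<in> I \<Longrightarrow> gdelta_in X {x \<in> topspace X. P i x}"
  shows "gdelta_in X {x \<in> topspace X. \<forall>i\<in>I. P i x}"
proof (cases "I = {}")
  case False
  have "gdelta_in X (\<Inter>i\<in>I. {x \<in> topspace X. P i x})"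
    using assms False by (intro gdelta_in_Inter) auto
  moreover have "(\<Inter>i\<in>I. {x \<in> topspace X. P i x}) = {x \<in> topspace X. \<forall>i\<in>I. P i x}"
    using False by auto
  ultimately show ?thesis by simp
qed simp

lemma gdelta_in_countable_All:
  assumes "\<And>i::'i::countable. gdelta_in X {x \<in> topspace X. P i x}"
  shows "gdelta_in X {x \<in> topspace X. \<forall>i. P i x}"
  using gdelta_in_countable_Ball[of UNIV X P] assms by simp

lemma gdelta_in_conj:
  assumes "gdelta_in X {x \<in> topspace X. P x}" "gdelta_in X {x \<in> topspace X. Q x}"
  shows "gdelta_in X {x \<in> topspace X. P x \<and> Q x}"
proof -
  have "{x \<in> topspace X. P x \<and> Q x} = {x \<in> topspace X. P x} \<inter> {x \<in> topspace X. Q x}" by auto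
  then show ?thesis using gdelta_in_Int[OF assms] by simp
qed

lemma gdelta_in_imp:
  assumes "locally_constant X P" "gdelta_in X {x \<in> topspace X. Q x}"
  shows "gdelta_in X {x \<in> topspace X. P x \<longrightarrow> Q x}"
proof -
  have "{x \<in> topspace X. P x \<longrightarrow> Q x} = {x \<in> topspace X. \<not> P x} \<union> {x \<in> topspace X. Q x}" by auto
  moreover have "openin X {x \<in> topspace X. \<not> P x}" using assms(1) by (simp add: locally_constant_bool)
  ultimately show ?thesis using gdelta_in_Un[OF open_imp_gdelta_in assms(2)] by simp
qed

lemma openin_Ex:
  assumes "\<And>i. openin X {x \<in> topspace X. P i x}"
  shows "openin X {x \<in> topspace X. \<exists>i. P i x}"
proof -
  have "{x \<in> topspace X. \<exists>i. P i x} = (\<Union>i. {x \<in> topspace X. P i x})" by auto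
  then show ?thesis using assms by auto
qed

section \<open>Polish spaces\<close>

lemma polish_space_homeomorphic:
  assumes "X homeomorphic_space Y" "polish_space X" shows "polish_space Y"
  using assms homeomorphic_completely_metrizable_space homeomorphic_space_second_countability
  unfolding polish_space_def by blast

lemma polish_space_gdelta:
  assumes "polish_space X" "gdelta_in X S" shows "polish_space (subtopology X S)"
  using assms by (simp add: polish_space_def completely_metrizable_space_gdelta_in second_countable_subtopology)

lemma second_countable_prod_topology:
  assumes "second_countable X" "second_countable Y"
  shows "second_countable (prod_topology X Y)"
proof -
  obtain A where A: "countable A" "\<And>V. V \<in> A \<Longrightarrow> openin X V"
    "\<And>U x. openin X U \<Longrightarrow> x \<in> U \<Longrightarrow> \<exists>V\<in>A. x \<in> V \<and> V \<subseteq> U"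
    using assms(1) unfolding second_countable_def by metis
  obtain B where B: "countable B" "\<And>V. V \<in> B \<Longrightarrow> openin Y V"
    "\<And>U x. openin Y U \<Longrightarrow> x \<in> U \<Longrightarrow> \<exists>V\<in>B. x \<in> V \<and> V \<subseteq> U"
    using assms(2) unfolding second_countable_def by metis
  let ?C = "(\<lambda>(U, V). U \<times> V) ` (A \<times> B)"
  have "\<exists>W\<in>?C. z \<in> W \<and> W \<subseteq> S" if S: "openin (prod_topology X Y) S" "z \<in> S" for S z
  proof -
    obtain x y where z: "z = (x, y)" by (cases z)
    obtain U V where UV: "openin X U" "openin Y V" "x \<in> U" "y \<in> V" "U \<times> V \<subseteq> S"
      using S unfolding openin_prod_topology_alt z by meson
    obtain U' where U': "U' \<in> A" "x \<in> U'" "U' \<subseteq> U" using A(3) UV by meson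
    obtain V' where V': "V' \<in> B" "y \<in> V'" "V' \<subseteq> V" using B(3) UV by meson
    have "U' \<times> V' \<in> ?C" using U' V' by auto
    moreover have "z \<in> U' \<times> V'" "U' \<times> V' \<subseteq> S" using U' V' UV z by auto
    ultimately show ?thesis by blast
  qed
  moreover have "\<forall>W\<in>?C. openin (prod_topology X Y) W"
    using A(2) B(2) by (auto simp: openin_prod_Times_iff)
  moreover have "countable ?C" using A(1) B(1) by auto
  ultimately show ?thesis unfolding second_countable_def
    by (intro exI[of _ ?C]) simp
qed

lemma polish_space_prod:
  assumes "polish_space X" "polish_space Y" shows "polish_space (prod_topology X Y)"
  using assms by (simp add: polish_space_def completely_metrizable_space_prod_topology second_countable_prod_topology)

lemma second_countable_discrete_product:
  assumes I: "countable I" and B: "countable B"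
  shows "second_countable (product_topology (\<lambda>_. discrete_topology B) I)"
proof -
  let ?P = "product_topology (\<lambda>_. discrete_topology B) I"
  let ?W = "\<lambda>xs. {z \<in> topspace ?P. \<forall>p\<in>set xs. z (fst p) = snd p}"
  let ?C = "?W ` lists (I \<times> B)"
  have W: "openin ?P (?W xs)" if "xs \<in> lists (I \<times> B)" for xs
    using that
  proof (induction xs)
    case Nil
    show ?case using openin_topspace[of ?P] by simp
  next
    case (Cons p xs)
    have "openin ?P {z \<in> topspace ?P. z (fst p) \<in> {snd p}}"
    proof (rule openin_continuous_map_preimage)
      show "continuous_map ?P (discrete_topology B) (\<lambda>z. z (fst p))"
        by (rule continuous_map_product_projection) (use Cons in auto)
    qed (use Cons in auto)
    then have "openin ?P ({z \<in> topspace ?P. z (fst p) \<in> {snd p}} \<inter> ?W xs)"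
      using Cons by (intro openin_Int) simp_all
    moreover have "{z \<in> topspace ?P. z (fst p) \<in> {snd p}} \<inter> ?W xs = ?W (p # xs)" by auto
    ultimately show ?case by simp
  qed
  have base: "\<exists>W\<in>?C. z \<in> W \<and> W \<subseteq> U" if U: "openin ?P U" "z \<in> U" for U z
  proof -
    obtain V where V: "finite {i \<in> I. V i \<noteq> B}" "z \<in> Pi\<^sub>E I V" "Pi\<^sub>E I V \<subseteq> U"
      using U unfolding openin_product_topology_alt by auto
    obtain js where js: "set js = {i \<in> I. V i \<noteq> B}" using finite_list[OF V(1)] by blast
    let ?xs = "map (\<lambda>i. (i, z i)) js"
    have zP: "z \<in> topspace ?P" using U openin_subset by blast
    have sub: "?W ?xs \<subseteq> Pi\<^sub>E I V"
    proof
      fix y assume y: "y \<in> ?W ?xs"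
      have "y i \<in> V i" if i: "i \<in> I" for i
      proof (cases "V i = B")
        case True then show ?thesis using y i by auto
      next
        case False
        then have "y i = z i" using y i js by auto
        then show ?thesis using V(2) i by auto
      qed
      then show "y \<in> Pi\<^sub>E I V" using y by (auto simp: PiE_iff)
    qed
    have mem: "z \<in> ?W ?xs" using zP by simp
    have "?W ?xs \<in> ?C"
      by (rule imageI) (use zP js in \<open>auto simp: PiE_iff\<close>)
    then show ?thesis
      by (rule bexI[rotated]) (intro conjI mem subset_trans[OF sub V(3)])
  qed
  have "countable ?C" using I B by (intro countable_image countable_lists) auto
  moreover have "\<forall>W\<in>?C. openin ?P W" using W by simp
  moreover have "\<forall>U z. openin ?P U \<and> z \<in> U \<longrightarrow> (\<exists>W\<in>?C. z \<in> W \<and> W \<subseteq> U)"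
    using base by meson
  ultimately show ?thesis unfolding second_countable_def
    by (intro exI[of _ ?C] conjI)
qed

lemma polish_space_discrete_product:
  assumes "countable I" "countable B"
  shows "polish_space (product_topology (\<lambda>_. discrete_topology B) I)"
proof -
  have "countable {i \<in> I. \<not> (\<exists>a. topspace (discrete_topology B) \<subseteq> {a})}"
    by (rule countable_subset[OF _ assms(1)]) auto
  then have "completely_metrizable_space (product_topology (\<lambda>_. discrete_topology B) I)"
    unfolding completely_metrizable_space_product_topology
    using completely_metrizable_space_discrete_topology by blast
  then show ?thesis using second_countable_discrete_product[OF assms] by (simp add: polish_space_def)
qed

lemma homeomorphic_space_pullback_topology:
  assumes f: "bij_betw f A (topspace T)"
  shows "pullback_topology A f T homeomorphic_space T"
proof -
  let ?X = "pullback_topology A f T"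
  have top: "topspace ?X = A"
    using f by (auto simp: topspace_pullback_topology bij_betw_def)
  have "homeomorphic_map ?X T f"
  proof (rule bijective_open_imp_homeomorphic_map)
    show "continuous_map ?X T f"
      using continuous_map_pullback[of T T id A f] by simp
    show "open_map ?X T f"
      unfolding open_map_def openin_pullback_topology
    proof safe
      fix U assume U: "openin T U"
      then have "f ` (f -` U \<inter> A) = U"
        using f openin_subset[OF U] by (fastforce simp: bij_betw_def)
      then show "openin T (f ` (f -` U \<inter> A))" using U by simp
    qed
  qed (use f in \<open>auto simp: top bij_betw_def\<close>)
  then show ?thesis using homeomorphic_space by blast
qed

text \<open>
  The carrier type in the definition of analytic sets is no restriction: a second countable
  Hausdorff space injects into \<^typ>\<open>nat \<Rightarrow> nat\<close> by recording which basic open sets contain a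
  given point, and its topology can be transported along this injection.
\<close>
lemma analytic_in_continuous_image:
  assumes Z: "polish_space Z" and h: "continuous_map Z X h"
  shows "analytic_in X (h ` topspace Z)"
proof -
  obtain \<B> where \<B>: "countable \<B>" "\<And>V. V \<in> \<B> \<Longrightarrow> openin Z V"
    "\<And>U x. openin Z U \<Longrightarrow> x \<in> U \<Longrightarrow> \<exists>V\<in>\<B>. x \<in> V \<and> V \<subseteq> U"
    using Z unfolding polish_space_def second_countable_def by metis
  have Haus: "Hausdorff_space Z"
    using Z unfolding polish_space_def
    by (simp add: completely_metrizable_imp_metrizable_space metrizable_imp_Hausdorff_space)
  define code :: "'a \<Rightarrow> nat \<Rightarrow> nat" where
    "code x n = (if x \<in> from_nat_into \<B> n then 1 else 0)" for x n
  have inj: "inj_on code (topspace Z)"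
  proof (rule inj_onI, rule ccontr)
    fix x y assume x: "x \<in> topspace Z" and y: "y \<in> topspace Z" and eq: "code x = code y" and "x \<noteq> y"
    obtain U V where UV: "openin Z U" "openin Z V" "x \<in> U" "y \<in> V" "disjnt U V"
      using Haus x y \<open>x \<noteq> y\<close> unfolding Hausdorff_space_def by meson
    obtain W where W: "W \<in> \<B>" "x \<in> W" "W \<subseteq> U" using \<B>(3) UV by meson
    obtain n where "from_nat_into \<B> n = W" using from_nat_into_surj[OF \<B>(1) W(1)] by blast
    then have "y \<in> W" using fun_cong[OF eq, of n] W(2) by (simp add: code_def split: if_splits)
    then show False using W UV by (auto simp: disjnt_def)
  qed
  let ?A = "code ` topspace Z" and ?g = "inv_into (topspace Z) code"
  let ?Y = "pullback_topology ?A ?g Z"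
  have g: "bij_betw ?g ?A (topspace Z)"
    using inj by (simp add: bij_betw_inv_into inj_on_imp_bij_betw)
  have top: "topspace ?Y = ?A"
    using g by (auto simp: topspace_pullback_topology bij_betw_def)
  have "polish_space ?Y"
    using polish_space_homeomorphic[OF _ Z] homeomorphic_space_pullback_topology[OF g] homeomorphic_space_sym
    by blast
  moreover have "continuous_map ?Y X (h \<circ> ?g)"
    using continuous_map_pullback[OF h] .
  moreover have "(h \<circ> ?g) ` topspace ?Y = h ` topspace Z"
    using g unfolding top by (simp only: image_comp[symmetric] bij_betw_def)
  ultimately show ?thesis unfolding analytic_in_def by blast
qed

section \<open>The hyperspace of Cantor space and power sets of countable sets\<close>

definition cyl :: "'a list \<Rightarrow> (nat \<Rightarrow> 'a) set" where
  "cyl s = {x. prefix (length s) x = s}"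

lemma prefix_eq_iff_agree: "prefix n x = prefix n y \<longleftrightarrow> agree n x y"
  by (auto simp: subsequence_def agree_def)

lemma in_cyl_prefix [simp]: "x \<in> cyl (prefix n x)"
  by (simp add: cyl_def)

lemma in_cyl_prefix_iff: "y \<in> cyl (prefix n x) \<longleftrightarrow> agree n x y"
  by (auto simp: cyl_def prefix_eq_iff_agree agree_def)

lemma cyl_Nil [simp]: "cyl [] = UNIV"
  by (auto simp: cyl_def)

lemma cyl_snoc: "x \<in> cyl (s @ [b]) \<longleftrightarrow> x \<in> cyl s \<and> x (length s) = b"
  by (simp add: cyl_def)

lemma locally_constant_prefix: "locally_constant seq_space (prefix n)"
  unfolding subsequence_def by (intro locally_constant_list continuous_map_coordinate)

lemma locally_constant_cyl: "locally_constant seq_space (\<lambda>x. x \<in> cyl s)"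
  using locally_constant_comp[OF locally_constant_prefix[of "length s"], of "\<lambda>t. t = s"] by (simp add: cyl_def)

lemma openin_cyl: "openin seq_space (cyl s)"
  using locally_constant_open[OF locally_constant_cyl] by simp

lemma closedin_cyl: "closedin seq_space (cyl s)"
  using locally_constant_cyl[unfolded locally_constant_bool]
  by (auto simp: closedin_def Collect_neg_eq Compl_eq_Diff_UNIV)

lemma compact_cantor_space: "compact_space cantor_space"
  by (rule compact_seq_space) simp

lemma compactin_cantor_iff: "compactin cantor_space K \<longleftrightarrow> closedin cantor_space K"
  using closedin_compact_space[OF compact_cantor_space] compactin_imp_closedin[OF Hausdorff_seq_space] by blast

lemma finite_words: "finite {s :: bool list. length s = n}"
  using finite_lists_length_eq[of "UNIV :: bool set" n] by simp

lemma topspace_vietoris [simp]: "topspace (vietoris X) = {K. compactin X K}"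
proof -
  have "{K. compactin X K} = {K. compactin X K \<and> K \<subseteq> topspace X}"
    using compactin_subset_topspace by auto
  then have "{K. compactin X K} \<in> {{K. compactin X K \<and> K \<subseteq> U} | U. openin X U}"
    by (simp only: mem_Collect_eq) (intro exI[of _ "topspace X"], simp)
  then have "{K. compactin X K} \<subseteq> topspace (vietoris X)"
    unfolding vietoris_def topology_generated_by_topspace by (intro Union_upper UnI1)
  moreover have "topspace (vietoris X) \<subseteq> {K. compactin X K}"
    unfolding vietoris_def topology_generated_by_topspace by (rule Union_least) auto
  ultimately show ?thesis by (intro subset_antisym)
qed

lemma openin_vietoris_subset: "openin X U \<Longrightarrow> openin (vietoris X) {K. compactin X K \<and> K \<subseteq> U}"
  unfolding vietoris_def by (rule topology_generated_by_Basis) blast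

lemma openin_vietoris_meets: "openin X U \<Longrightarrow> openin (vietoris X) {K. compactin X K \<and> K \<inter> U \<noteq> {}}"
  unfolding vietoris_def by (rule topology_generated_by_Basis) blast

lemma continuous_map_into_vietoris:
  assumes "\<And>x. x \<in> topspace Z \<Longrightarrow> compactin X (f x)"
    and "\<And>U. openin X U \<Longrightarrow> openin Z {x \<in> topspace Z. f x \<subseteq> U}"
    and "\<And>U. openin X U \<Longrightarrow> openin Z {x \<in> topspace Z. f x \<inter> U \<noteq> {}}"
  shows "continuous_map Z (vietoris X) f"
  unfolding vietoris_def
proof (rule continuous_on_generated_topo)
  let ?A = "{{K. compactin X K \<and> K \<subseteq> U} | U. openin X U}" and ?B = "{{K. compactin X K \<and> K \<inter> U \<noteq> {}} | U. openin X U}"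
  show "openin Z (f -` W \<inter> topspace Z)" if "W \<in> ?A \<union> ?B" for W
  proof -
    from that consider U where "openin X U" "W = {K. compactin X K \<and> K \<subseteq> U}"
      | U where "openin X U" "W = {K. compactin X K \<and> K \<inter> U \<noteq> {}}" by blast
    then show ?thesis
    proof cases
      case 1
      then have "f -` W \<inter> topspace Z = {x \<in> topspace Z. f x \<subseteq> U}" using assms(1) by auto
      then show ?thesis using assms(2) 1 by simp
    next
      case 2
      then have "f -` W \<inter> topspace Z = {x \<in> topspace Z. f x \<inter> U \<noteq> {}}" using assms(1) by auto
      then show ?thesis using assms(3) 2 by simp
    qed
  qed
  show "f ` topspace Z \<subseteq> \<Union> (?A \<union> ?B)"
    using topspace_vietoris[of X] assms(1) unfolding vietoris_def topology_generated_by_topspace by blast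
qed

text \<open>Missing a clopen set means lying in its complement, which is open as well.\<close>
lemma locally_constant_vietoris_meets:
  assumes "openin X C" "closedin X C"
  shows "locally_constant (vietoris X) (\<lambda>K. K \<inter> C \<noteq> {})"
proof -
  have "openin (vietoris X) {K. compactin X K \<and> K \<subseteq> topspace X - C}"
    using assms by (intro openin_vietoris_subset) blast
  moreover have "{K. compactin X K \<and> K \<subseteq> topspace X - C} = {K \<in> topspace (vietoris X). \<not> K \<inter> C \<noteq> {}}"
    using compactin_subset_topspace by fastforce
  ultimately show ?thesis
    using openin_vietoris_meets[OF assms(1)] by (simp add: locally_constant_bool)
qed

text \<open>
  Characteristic functions of the trees of binary words without terminal nodes; the empty tree is
  included, because the empty set belongs to the hyperspace.
\<close>
definition trees :: "(bool list \<Rightarrow> bool) set" where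
  "trees = {T. \<forall>s. T s \<longleftrightarrow> T (s @ [False]) \<or> T (s @ [True])}"

definition tree_of :: "cantor set \<Rightarrow> bool list \<Rightarrow> bool" where
  "tree_of K s \<longleftrightarrow> K \<inter> cyl s \<noteq> {}"

definition branches :: "(bool list \<Rightarrow> bool) \<Rightarrow> cantor set" where
  "branches T = {x. \<forall>n. T (prefix n x)}"

abbreviation word_space :: "(bool list \<Rightarrow> bool) topology" where
  "word_space \<equiv> product_topology (\<lambda>_. discrete_topology UNIV) UNIV"

lemma tree_of_in_trees: "tree_of K \<in> trees"
proof -
  have "cyl s = cyl (s @ [False]) \<union> cyl (s @ [True])" for s :: "bool list"
    by (auto simp: cyl_snoc)
  then show ?thesis unfolding trees_def tree_of_def by blast
qed

lemma tree_prefix_closed: "T \<in> trees \<Longrightarrow> T (s @ t) \<Longrightarrow> T s"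
proof (induction t rule: rev_induct)
  case (snoc b t)
  then have "T ((s @ t) @ [b])" by simp
  then have "T (s @ t)"
    using snoc.prems(1)[unfolded trees_def mem_Collect_eq, rule_format, of "s @ t"] by (cases b) simp_all
  then show ?case using snoc by blast
qed simp

text \<open>A node of a pruned tree extends to a branch: keep choosing a successor in the tree.\<close>
lemma branch_through_node:
  assumes T: "T \<in> trees" and s: "T s"
  shows "branches T \<inter> cyl s \<noteq> {}"
proof -
  have "\<exists>f. \<forall>n. (T (f n) \<and> length (f n) = length s + n) \<and> (\<exists>b. f (Suc n) = f n @ [b]) \<and> f 0 = s"
  proof -
    have "\<exists>f. \<forall>n. (T (f n) \<and> length (f n) = length s + n \<and> (n = 0 \<longrightarrow> f n = s)) \<and> (\<exists>b. f (Suc n) = f n @ [b])"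
    proof (rule dependent_nat_choice)
      show "\<exists>x. T x \<and> length x = length s + 0 \<and> (0 = (0::nat) \<longrightarrow> x = s)" using s by simp
      fix x :: "bool list" and n :: nat assume "T x \<and> length x = length s + n \<and> (n = 0 \<longrightarrow> x = s)"
      moreover from this obtain b where "T (x @ [b])" using T unfolding trees_def by blast
      ultimately show "\<exists>y. (T y \<and> length y = length s + Suc n \<and> (Suc n = 0 \<longrightarrow> y = s)) \<and> (\<exists>b. y = x @ [b])"
        by (intro exI[of _ "x @ [b]"]) simp
    qed
    then show ?thesis by blast
  qed
  then obtain f where f: "\<And>n. T (f n)" "\<And>n. length (f n) = length s + n"
    "\<And>n. \<exists>b. f (Suc n) = f n @ [b]" "f 0 = s" by blast
  have pre: "m \<le> n \<Longrightarrow> take (length (f m)) (f n) = f m" for m n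
  proof (induction n rule: dec_induct)
    case (step n)
    obtain b where "f (Suc n) = f n @ [b]" using f(3) by blast
    then show ?case using step f(2) by simp
  qed simp
  define x where "x k = f (Suc k) ! k" for k
  have x: "x k = f n ! k" if "k < length (f n)" for k n
  proof (cases "Suc k \<le> n")
    case True
    have "f (Suc k) ! k = take (length (f (Suc k))) (f n) ! k" by (simp add: pre[OF True])
    then show ?thesis using f(2) by (simp add: x_def)
  next
    case False
    have "f n ! k = take (length (f n)) (f (Suc k)) ! k" using False by (simp add: pre)
    then show ?thesis using that by (simp add: x_def)
  qed
  have px: "prefix (length (f n)) x = f n" for n
    by (rule nth_equalityI) (auto simp: subsequence_def x)
  have "T (prefix n x)" for n
  proof -
    have "prefix (n + length s) x = prefix n x @ subsequence x n (n + length s)"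
      by (rule subsequence_append)
    moreover have "T (prefix (n + length s) x)"
      using px[of n] f(1,2)[of n] by (simp add: add.commute)
    ultimately show ?thesis using tree_prefix_closed[OF T] by metis
  qed
  moreover have "x \<in> cyl s" using px[of 0] f(4) by (simp add: cyl_def)
  ultimately show ?thesis unfolding branches_def by blast
qed

lemma tree_of_branches: "T \<in> trees \<Longrightarrow> tree_of (branches T) = T"
proof
  fix s assume T: "T \<in> trees"
  show "tree_of (branches T) s = T s"
  proof
    assume "tree_of (branches T) s"
    then obtain x where "\<forall>n. T (prefix n x)" "prefix (length s) x = s"
      unfolding tree_of_def branches_def cyl_def by blast
    then show "T s" by metis
  qed (simp add: tree_of_def branch_through_node T)
qed

lemma branches_tree_of:
  assumes "closedin cantor_space K" shows "branches (tree_of K) = K"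
proof
  show "K \<subseteq> branches (tree_of K)"
    unfolding branches_def tree_of_def using in_cyl_prefix by fast
  show "branches (tree_of K) \<subseteq> K"
  proof
    fix x assume "x \<in> branches (tree_of K)"
    then have "\<forall>n. \<exists>y\<in>K. agree n x y"
      unfolding branches_def tree_of_def in_cyl_prefix_iff[symmetric] by blast
    then show "x \<in> K" using assms unfolding closedin_seq_space by blast
  qed
qed

lemma closedin_branches: "closedin cantor_space (branches T)"
  unfolding closedin_seq_space
proof (intro allI impI)
  fix x assume x: "\<forall>n. \<exists>y\<in>branches T. agree n x y"
  have "T (prefix n x)" for n
  proof -
    obtain y where "y \<in> branches T" "agree n x y" using x by blast
    then show ?thesis unfolding branches_def prefix_eq_iff_agree[symmetric] by simp
  qed
  then show "x \<in> branches T" by (simp add: branches_def)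
qed

lemma locally_constant_node: "locally_constant word_space (\<lambda>T. T s)"
  by (rule continuous_map_product_projection) simp

text \<open>
  A compact set is coded by the tree of words whose cylinders it meets. This identifies the
  hyperspace with the set of pruned trees, which is \<open>G\<^sub>\<delta>\<close> in a countable power of the
  two-point space. In the direction from trees to compact sets, compactness turns inclusion
  in an open set into a condition on a single level of the tree.
\<close>
lemma polish_space_vietoris_cantor: "polish_space (vietoris cantor_space)"
proof -
  let ?S = "subtopology word_space trees"
  have "gdelta_in word_space {T \<in> topspace word_space. \<forall>s. T s \<longleftrightarrow> T (s @ [False]) \<or> T (s @ [True])}"
    by (intro gdelta_in_countable_All open_imp_gdelta_in locally_constant_open
        locally_constant_comp2[where h = "(=)"] locally_constant_comp2[where h = "(\<or>)"] locally_constant_node)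
  then have "gdelta_in word_space trees" by (simp add: trees_def)
  then have pol: "polish_space ?S"
    by (intro polish_space_gdelta polish_space_discrete_product) auto
  have node: "locally_constant ?S (\<lambda>T. T s)" for s
    by (rule continuous_map_from_subtopology[OF locally_constant_node])
  have "homeomorphic_maps ?S (vietoris cantor_space) branches tree_of"
    unfolding homeomorphic_maps_def
  proof (intro conjI ballI)
    show "continuous_map ?S (vietoris cantor_space) branches"
    proof (rule continuous_map_into_vietoris)
      show "compactin cantor_space (branches T)" for T
        using closedin_branches compactin_cantor_iff by blast
    next
      fix U :: "cantor set" assume U: "openin cantor_space U"
      have "branches T \<subseteq> U \<longleftrightarrow> (\<exists>n. \<forall>s\<in>{s. length s = n}. T s \<longrightarrow> cyl s \<subseteq> U)" (is "?L \<longleftrightarrow> ?R")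
        if T: "T \<in> trees" for T
      proof
        assume sub: ?L
        obtain n where n: "\<And>x y. x \<in> branches T \<Longrightarrow> agree n x y \<Longrightarrow> y \<in> U"
          using compactin_uniform_neighbourhood[OF _ U sub] closedin_branches compactin_cantor_iff by metis
        have "cyl s \<subseteq> U" if s: "length s = n" "T s" for s
        proof
          fix y assume y: "y \<in> cyl s"
          obtain x where x: "x \<in> branches T" "x \<in> cyl s" using branch_through_node[OF T s(2)] by blast
          then have "prefix n x = prefix n y" using y s by (simp add: cyl_def)
          then show "y \<in> U" using n x by (simp add: prefix_eq_iff_agree)
        qed
        then show ?R by blast
      next
        assume ?R
        then obtain n where n: "\<And>s. length s = n \<Longrightarrow> T s \<Longrightarrow> cyl s \<subseteq> U" by blast
        show ?L
        proof
          fix x assume "x \<in> branches T"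
          then have "T (prefix n x)" by (simp add: branches_def)
          then have "cyl (prefix n x) \<subseteq> U" by (intro n) simp
          then show "x \<in> U" using in_cyl_prefix by blast
        qed
      qed
      then have eq: "{T \<in> topspace ?S. branches T \<subseteq> U} =
          {T \<in> topspace ?S. \<exists>n. \<forall>s\<in>{s. length s = n}. T s \<longrightarrow> cyl s \<subseteq> U}"
        by auto
      show "openin ?S {T \<in> topspace ?S. branches T \<subseteq> U}"
        unfolding eq
        by (intro openin_Ex locally_constant_open locally_constant_Ball finite_words locally_constant_comp[OF node])
    next
      fix U :: "cantor set" assume U: "openin cantor_space U"
      have "branches T \<inter> U \<noteq> {} \<longleftrightarrow> (\<exists>s. T s \<and> cyl s \<subseteq> U)" (is "?L \<longleftrightarrow> ?R")
        if T: "T \<in> trees" for T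
      proof
        assume ?L
        then obtain x where x: "x \<in> branches T" "x \<in> U" by blast
        then obtain n where n: "\<And>y. agree n x y \<Longrightarrow> y \<in> U" using U unfolding openin_seq_space by meson
        have "cyl (prefix n x) \<subseteq> U" using n in_cyl_prefix_iff by blast
        moreover have "T (prefix n x)" using x by (simp add: branches_def)
        ultimately show ?R by blast
      next
        assume ?R then show ?L using branch_through_node[OF T] by blast
      qed
      then have eq: "{T \<in> topspace ?S. branches T \<inter> U \<noteq> {}} =
          {T \<in> topspace ?S. \<exists>s. T s \<and> cyl s \<subseteq> U}"
        by auto
      show "openin ?S {T \<in> topspace ?S. branches T \<inter> U \<noteq> {}}"
        unfolding eq by (intro openin_Ex locally_constant_open locally_constant_comp[OF node])
    qed
    show "continuous_map (vietoris cantor_space) ?S tree_of"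
      unfolding continuous_map_in_subtopology
    proof
      show "continuous_map (vietoris cantor_space) word_space tree_of"
        unfolding continuous_map_componentwise_UNIV tree_of_def
        by (intro allI locally_constant_vietoris_meets openin_cyl closedin_cyl)
    qed (auto simp: tree_of_in_trees)
  qed (auto simp: tree_of_branches branches_tree_of compactin_cantor_iff)
  then show ?thesis
    using polish_space_homeomorphic pol unfolding homeomorphic_space_def by blast
qed

lemma indicator_bij:
  "bij_betw (\<lambda>R. restrict (\<lambda>p. p \<in> R) A) (Pow A)
     (topspace (product_topology (\<lambda>_. discrete_topology (UNIV :: bool set)) A))"
proof (rule bij_betw_byWitness[where f' = "\<lambda>z. {p \<in> A. z p}"])
  show "\<forall>R\<in>Pow A. {p \<in> A. restrict (\<lambda>p. p \<in> R) A p} = R" by auto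
  show "\<forall>z\<in>topspace (product_topology (\<lambda>_. discrete_topology (UNIV :: bool set)) A).
     (\<lambda>p\<in>A. p \<in> {p \<in> A. z p}) = z"
    by (auto simp: PiE_iff fun_eq_iff restrict_def extensional_def)
qed auto

lemma topspace_powerset_topology [simp]: "topspace (powerset_topology A) = Pow A"
  using indicator_bij[of A] unfolding bij_betw_def
  by (auto simp: powerset_topology_def topspace_pullback_topology)

lemma polish_space_powerset: "countable A \<Longrightarrow> polish_space (powerset_topology A)"
  unfolding powerset_topology_def
  using polish_space_homeomorphic homeomorphic_space_pullback_topology[OF indicator_bij] homeomorphic_space_sym
    polish_space_discrete_product[of A "UNIV :: bool set"] by fastforce

lemma locally_constant_powerset: 
  assumes "p \<in> A" shows "locally_constant (powerset_topology A) (\<lambda>R. p \<in> R)"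
proof -
  have "continuous_map (product_topology (\<lambda>_. discrete_topology (UNIV :: bool set)) A) (discrete_topology UNIV) (\<lambda>z. z p)"
    by (rule continuous_map_product_projection[OF assms])
  from continuous_map_pullback[OF this, of "Pow A" "\<lambda>R. restrict (\<lambda>p. p \<in> R) A"]
  show ?thesis using assms by (simp add: powerset_topology_def o_def)
qed

lemma continuous_map_into_powerset:
  assumes "\<And>x. x \<in> topspace X \<Longrightarrow> f x \<subseteq> A" "\<And>p. p \<in> A \<Longrightarrow> locally_constant X (\<lambda>x. p \<in> f x)"
  shows "continuous_map X (powerset_topology A) f"
  unfolding powerset_topology_def
proof (rule continuous_map_pullback')
  show "continuous_map X (product_topology (\<lambda>_. discrete_topology UNIV) A) ((\<lambda>R. restrict (\<lambda>p. p \<in> R) A) \<circ> f)"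
    unfolding continuous_map_componentwise using assms(2) by auto
  show "topspace X \<subseteq> f -` Pow A" using assms(1) by auto
qed

section \<open>Clopen subsets of Cantor space and two-colourings\<close>

text \<open>
  Every clopen set is a finite union of cylinders, so this parametrises the clopen sets by a
  countable type.
\<close>
definition clopen_of :: "bool list list \<Rightarrow> cantor set" where
  "clopen_of w = (\<Union>s\<in>set w. cyl s)"

lemma locally_constant_clopen_of: "locally_constant cantor_space (\<lambda>x. x \<in> clopen_of w)"
proof (induction w)
  case Nil show ?case by (simp add: clopen_of_def)
next
  case (Cons s w)
  have "locally_constant cantor_space (\<lambda>x. x \<in> cyl s \<or> x \<in> clopen_of w)"
    by (intro locally_constant_comp2[where h = "(\<or>)"] locally_constant_cyl Cons.IH)
  then show ?case by (simp add: clopen_of_def)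
qed

lemma clopen_locally_constant:
  assumes "locally_constant seq_space (\<lambda>x. x \<in> C)"
  shows "openin seq_space C" "closedin seq_space C"
  using assms unfolding locally_constant_bool
  by (auto simp: closedin_def Compl_eq_Diff_UNIV Collect_neg_eq)

lemma clopen_of_determined:
  assumes "\<And>x y. agree n x y \<Longrightarrow> x \<in> C \<Longrightarrow> y \<in> C"
  shows "\<exists>w. C = clopen_of w"
proof -
  have "finite (prefix n ` C)"
    by (rule finite_subset[OF _ finite_words[of n]]) auto
  then obtain w where w: "set w = prefix n ` C" using finite_list by blast
  have "C = clopen_of w"
  proof (intro equalityI subsetI)
    fix x assume "x \<in> C"
    then show "x \<in> clopen_of w" unfolding clopen_of_def w using in_cyl_prefix[of x n] by blast
  next
    fix y assume "y \<in> clopen_of w"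
    then obtain x where "x \<in> C" "y \<in> cyl (prefix n x)" unfolding clopen_of_def w by blast
    then show "y \<in> C" using assms in_cyl_prefix_iff by blast
  qed
  then show ?thesis by blast
qed

text \<open>
  On a compact set a continuous two-valued map is determined by a bounded number of
  coordinates, hence it is the trace of a clopen subset of the whole space. This makes continuous
  maps on varying compact domains range over one countable set.
\<close>
lemma clopen_extension:
  assumes K: "closedin cantor_space K" and p: "locally_constant (subtopology cantor_space K) p"
  shows "\<exists>w. \<forall>x\<in>K. x \<in> clopen_of w \<longleftrightarrow> p x"
proof -
  obtain n where n: "\<And>x y. x \<in> K \<Longrightarrow> y \<in> K \<Longrightarrow> agree n x y \<Longrightarrow> p x = p y"
    using uniformly_locally_constant[OF _ p] K compactin_cantor_iff by metis
  let ?C = "{y. \<exists>x\<in>K. p x \<and> agree n x y}"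
  have "\<exists>w. ?C = clopen_of w"
    by (rule clopen_of_determined[of n]) (auto intro: agree_trans)
  then obtain w where w: "?C = clopen_of w" ..
  have "x \<in> clopen_of w \<longleftrightarrow> p x" if "x \<in> K" for x
    unfolding w[symmetric] using that n agree_refl[of n x] by blast
  then show ?thesis by blast
qed

text \<open>Colourability is monotone in the number of colours.\<close>
lemma cont_chromatic_ge_3:
  "Fin 3 \<le> cont_chromatic X R \<longleftrightarrow> \<not> cont_colourable X R 2"
proof -
  have mono: "cont_colourable X R l" if k: "cont_colourable X R k" and kl: "k \<le> l" for k l
  proof -
    obtain c where c: "continuous_map X (discrete_topology {i. enat i < k}) c" "\<forall>(x, y) \<in> R. c x \<noteq> c y"
      using k unfolding cont_colourable_def by (elim exE conjE) (rule that)
    have "continuous_map X (discrete_topology {i. enat i < l}) c"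
      by (rule continuous_map_discrete_superset[OF c(1)]) (use kl in auto)
    then show ?thesis using c(2) unfolding cont_colourable_def by blast
  qed
  have lt: "k < 3 \<longleftrightarrow> k \<le> 2" for k :: enat
    by (cases k) (auto simp: numeral_eq_enat)
  show ?thesis
  proof (cases "\<exists>k. cont_colourable X R k")
    case True
    then have "cont_colourable X R (LEAST k. cont_colourable X R k)" by (rule LeastI_ex)
    moreover have "cont_colourable X R 2 \<Longrightarrow> (LEAST k. cont_colourable X R k) \<le> 2" by (rule Least_le)
    ultimately have "cont_colourable X R 2 \<longleftrightarrow> (LEAST k. cont_colourable X R k) \<le> 2" using mono by blast
    then have "cont_colourable X R 2 \<longleftrightarrow> (LEAST k. cont_colourable X R k) < 3" using lt by simp
    then show ?thesis using True by (simp add: cont_chromatic_def not_less[symmetric])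
  next
    case False then show ?thesis by (simp add: cont_chromatic_def)
  qed
qed

lemma cont_colourable_2:
  assumes "R \<subseteq> topspace X \<times> topspace X"
  shows "cont_colourable X R 2 \<longleftrightarrow> (\<exists>p. locally_constant X p \<and> (\<forall>(x, y) \<in> R. p x \<noteq> (p y :: bool)))"
proof
  assume "cont_colourable X R 2"
  then obtain c where c: "continuous_map X (discrete_topology {i. enat i < 2}) c" "\<forall>(x, y) \<in> R. c x \<noteq> c y"
    unfolding cont_colourable_def by blast
  have c01: "c x = 0 \<or> c x = 1" if "x \<in> topspace X" for x
  proof -
    have "c x \<in> {i. enat i < 2}" using c(1) that by (auto simp: continuous_map_def)
    then show ?thesis by (auto simp: numeral_eq_enat)
  qed
  have "(c x = 0) \<noteq> (c y = 0)" if "(x, y) \<in> R" for x y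
  proof -
    have "c x \<noteq> c y" "x \<in> topspace X" "y \<in> topspace X" using that c(2) assms by auto
    then show ?thesis using c01[of x] c01[of y] by auto
  qed
  then have "\<forall>(x, y) \<in> R. (c x = 0) \<noteq> (c y = 0)" by auto
  moreover have "locally_constant X (\<lambda>x. c x = 0)"
  proof (rule locally_constant_comp[of X c "\<lambda>i. i = 0"])
    show "locally_constant X c"
      by (rule continuous_map_discrete_superset[OF c(1)]) simp
  qed
  ultimately show "\<exists>p. locally_constant X p \<and> (\<forall>(x, y) \<in> R. p x \<noteq> (p y :: bool))"
    by (intro exI[of _ "\<lambda>x. c x = 0"] conjI)
next
  assume "\<exists>p. locally_constant X p \<and> (\<forall>(x, y) \<in> R. p x \<noteq> (p y :: bool))"
  then obtain p where p: "locally_constant X p" "\<forall>(x, y) \<in> R. p x \<noteq> (p y :: bool)"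
    by (elim exE conjE) (rule that)
  let ?c = "\<lambda>x. if p x then 0 else 1 :: nat"
  have "continuous_map (discrete_topology UNIV) (discrete_topology {i. enat i < 2}) (\<lambda>b. if b then 0 else 1)"
    by (auto simp: numeral_eq_enat)
  from continuous_map_compose[OF p(1) this]
  have "continuous_map X (discrete_topology {i. enat i < 2}) ?c" by (simp add: o_def)
  moreover have "\<forall>(x, y) \<in> R. ?c x \<noteq> ?c y" using p(2) by auto
  ultimately show "cont_colourable X R 2" unfolding cont_colourable_def by (intro exI conjI)
qed

section \<open>The space of graphs\<close>

lemma finite_letter: "finite (UNIV :: letter set)"
proof -
  have "(UNIV :: letter set) = {L0, L1, Lc, La, Lb}" using letter.exhaust by auto
  then show ?thesis by (metis finite.simps)
qed

lemma countable_QK: "countable QK"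
proof -
  let ?f = "\<lambda>(s, e) k. if k < length s then s ! k else e :: letter"
  have "x \<in> range ?f" if "x \<in> QK" for x
  proof -
    obtain l e where "\<forall>k\<ge>l. x k = e" using \<open>x \<in> QK\<close> unfolding QK_def by blast
    then have "x = ?f (prefix l x, e)" by (auto simp: fun_eq_iff subsequence_def)
    then show ?thesis by blast
  qed
  moreover have "countable (UNIV :: (letter list \<times> letter) set)"
  proof -
    have "countable (lists (UNIV :: letter set) \<times> (UNIV :: letter set))"
      by (intro countable_SIGMA countable_lists countable_finite finite_letter)
    then show ?thesis by simp
  qed
  ultimately show ?thesis by (meson countable_image countable_subset subsetI)
qed

lemma countable_Q_iota: "countable (Q_iota \<iota>)"
  unfolding Q_iota_def using countable_QK by simp

text \<open>
  Two-colourings of \<open>K\<close> are traces of clopen sets of Cantor space, so that having none is a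
  countable conjunction of conditions, each open in \<open>R\<close>.
\<close>
lemma Sg_iff:
  "(K, R) \<in> Sg \<iota> \<longleftrightarrow> closedin cantor_space K \<and> R \<subseteq> Q_iota \<iota> \<times> Q_iota \<iota> \<and> R \<subseteq> K \<times> K - Id_on K \<and>
     (\<forall>w. \<exists>(x, y) \<in> R. x \<in> clopen_of w \<longleftrightarrow> y \<in> clopen_of w)"
proof -
  have "cont_colourable (subtopology cantor_space K) R 2 \<longleftrightarrow>
      (\<exists>w. \<forall>(x, y) \<in> R. \<not> (x \<in> clopen_of w \<longleftrightarrow> y \<in> clopen_of w))"
    (is "?L \<longleftrightarrow> ?R") if K: "closedin cantor_space K" and R: "R \<subseteq> K \<times> K - Id_on K"
  proof -
    have R': "R \<subseteq> topspace (subtopology cantor_space K) \<times> topspace (subtopology cantor_space K)"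
      using R by auto
    show ?thesis
    proof
      assume ?L
      then obtain p where p: "locally_constant (subtopology cantor_space K) p"
          "\<forall>(x, y) \<in> R. p x \<noteq> (p y :: bool)"
        unfolding cont_colourable_2[OF R'] by (elim exE conjE) (rule that)
      obtain w where w: "\<forall>x\<in>K. x \<in> clopen_of w \<longleftrightarrow> p x" using clopen_extension[OF K p(1)] by blast
      have "\<not> (x \<in> clopen_of w \<longleftrightarrow> y \<in> clopen_of w)" if "(x, y) \<in> R" for x y
      proof -
        have "x \<in> K" "y \<in> K" "p x \<noteq> p y" using that R p(2) by auto
        then show ?thesis using w by simp
      qed
      then show ?R by (intro exI[of _ w]) auto
    next
      assume ?R
      then obtain w where w: "\<forall>(x, y) \<in> R. \<not> (x \<in> clopen_of w \<longleftrightarrow> y \<in> clopen_of w)" by blast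
      show ?L
        unfolding cont_colourable_2[OF R']
        using continuous_map_from_subtopology[OF locally_constant_clopen_of[of w]] w
        by (intro exI[of _ "\<lambda>x. x \<in> clopen_of w"]) simp
    qed
  qed
  moreover have "(\<not> (\<exists>w. \<forall>(x, y) \<in> R. \<not> (x \<in> clopen_of w \<longleftrightarrow> y \<in> clopen_of w))) \<longleftrightarrow>
      (\<forall>w. \<exists>(x, y) \<in> R. x \<in> clopen_of w \<longleftrightarrow> y \<in> clopen_of w)"
    by (simp add: case_prod_unfold)
  ultimately show ?thesis
    unfolding Sg_def cont_chromatic_ge_3 compactin_cantor_iff mem_Collect_eq case_prod_conv by metis
qed

lemma topspace_Sg_space [simp]: "topspace (Sg_space \<iota>) = Sg \<iota>"
  by (auto simp: Sg_space_def Sg_def)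

lemma continuous_map_Sg_fst: "continuous_map (Sg_space \<iota>) (vietoris cantor_space) fst"
  unfolding Sg_space_def by (rule continuous_map_from_subtopology[OF continuous_map_fst])

lemma continuous_map_Sg_snd: "continuous_map (Sg_space \<iota>) (powerset_topology (Q_iota \<iota> \<times> Q_iota \<iota>)) snd"
  unfolding Sg_space_def by (rule continuous_map_from_subtopology[OF continuous_map_snd])

lemma locally_constant_meets_cyl:
  assumes "continuous_map X (vietoris cantor_space) K"
  shows "locally_constant X (\<lambda>z. K z \<inter> cyl s \<noteq> {})"
  using locally_constant_pullback[OF assms locally_constant_vietoris_meets[OF openin_cyl closedin_cyl]] .

lemma locally_constant_edge:
  assumes "continuous_map X (powerset_topology A) R"
  shows "locally_constant X (\<lambda>z. p \<in> R z)"
proof (cases "p \<in> A")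
  case True
  then show ?thesis using locally_constant_pullback[OF assms locally_constant_powerset] by blast
next
  case False
  have "R z \<subseteq> A" if "z \<in> topspace X" for z
    using assms that by (auto simp: continuous_map_def)
  then have "(p \<in> R z) = False" if "z \<in> topspace X" for z using False that by auto
  then show ?thesis using continuous_map_eq[OF locally_constant_const[of X False]] by simp
qed

text \<open>
  A point belongs to a closed set if and only if the set meets all cylinders around the point, and
  each of these conditions is clopen.
\<close>
lemma gdelta_in_member:
  assumes K: "continuous_map X (vietoris cantor_space) K"
  shows "gdelta_in X {z \<in> topspace X. x \<in> K z}"
proof -
  have "x \<in> K z \<longleftrightarrow> (\<forall>n. K z \<inter> cyl (prefix n x) \<noteq> {})" if "z \<in> topspace X" for z
  proof -
    have "closedin cantor_space (K z)"
      using K that by (auto simp: continuous_map_def compactin_cantor_iff)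
    then show ?thesis using branches_tree_of unfolding branches_def tree_of_def by blast
  qed
  then have "{z \<in> topspace X. x \<in> K z} = {z \<in> topspace X. \<forall>n. K z \<inter> cyl (prefix n x) \<noteq> {}}" by auto
  then show ?thesis
    using gdelta_in_countable_All[OF open_imp_gdelta_in[OF locally_constant_open[OF locally_constant_meets_cyl[OF K]]]]
    by simp
qed

lemma polish_space_Sg_space: "polish_space (Sg_space \<iota>)"
proof -
  let ?Q = "Q_iota \<iota> \<times> Q_iota \<iota>"
  let ?X = "prod_topology (vietoris cantor_space) (powerset_topology ?Q)"
  have Q: "countable ?Q" using countable_Q_iota by simp
  have K: "continuous_map ?X (vietoris cantor_space) fst" by (rule continuous_map_fst)
  have R: "locally_constant ?X (\<lambda>G. p \<in> snd G)" for p
    by (rule locally_constant_edge[OF continuous_map_snd])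
  let ?A = "\<lambda>G p. p \<in> snd G \<longrightarrow> fst p \<in> fst G \<and> snd p \<in> fst G \<and> fst p \<noteq> snd p"
  let ?B = "\<lambda>G w. \<exists>p. p \<in> snd G \<and> (fst p \<in> clopen_of w \<longleftrightarrow> snd p \<in> clopen_of w)"
  have "gdelta_in ?X {G \<in> topspace ?X. \<forall>p\<in>?Q. ?A G p}"
    by (intro gdelta_in_countable_Ball[OF Q] gdelta_in_imp R gdelta_in_conj gdelta_in_member K
        open_imp_gdelta_in locally_constant_open locally_constant_const)
  moreover have "gdelta_in ?X {G \<in> topspace ?X. \<forall>w. ?B G w}"
    by (intro gdelta_in_countable_All open_imp_gdelta_in openin_Ex locally_constant_open
        locally_constant_comp2[where h = "(\<and>)"] R locally_constant_const)
  ultimately have "gdelta_in ?X {G \<in> topspace ?X. (\<forall>p\<in>?Q. ?A G p) \<and> (\<forall>w. ?B G w)}"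
    by (rule gdelta_in_conj)
  moreover have "{G \<in> topspace ?X. (\<forall>p\<in>?Q. ?A G p) \<and> (\<forall>w. ?B G w)} = Sg \<iota>" (is "?S = _")
  proof (rule set_eqI)
    fix G :: cgraph
    obtain K R where G: "G = (K, R)" by (cases G)
    have "G \<in> ?S \<longleftrightarrow> closedin cantor_space K \<and> R \<subseteq> ?Q \<and> (\<forall>p\<in>?Q. ?A G p) \<and> (\<forall>w. ?B G w)"
      by (simp add: G compactin_cantor_iff conj_assoc)
    also have "\<dots> \<longleftrightarrow> closedin cantor_space K \<and> R \<subseteq> ?Q \<and> R \<subseteq> K \<times> K - Id_on K \<and> (\<forall>w. ?B G w)"
      unfolding G by fastforce
    also have "\<dots> \<longleftrightarrow> G \<in> Sg \<iota>"
      unfolding G Sg_iff by (simp add: Bex_def)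
    finally show "G \<in> ?S \<longleftrightarrow> G \<in> Sg \<iota>" .
  qed
  ultimately have "gdelta_in ?X (Sg \<iota>)" by simp
  then show ?thesis
    unfolding Sg_space_def
    by (intro polish_space_gdelta polish_space_prod polish_space_vietoris_cantor polish_space_powerset Q)
qed

lemma inj_cont_le_refl: "snd G \<subseteq> fst G \<times> fst G \<Longrightarrow> inj_cont_le G G"
  unfolding inj_cont_le_def by (intro exI[of _ "\<lambda>x. x"]) auto

lemma inj_cont_le_trans:
  assumes "inj_cont_le G H" "inj_cont_le H I" shows "inj_cont_le G I"
proof -
  obtain f where f: "continuous_map (subtopology cantor_space (fst G)) (subtopology cantor_space (fst H)) f"
    "inj_on f (fst G)" "snd G \<subseteq> {(x, y) \<in> fst G \<times> fst G. (f x, f y) \<in> snd H}"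
    using assms(1) unfolding inj_cont_le_def by blast
  obtain g where g: "continuous_map (subtopology cantor_space (fst H)) (subtopology cantor_space (fst I)) g"
    "inj_on g (fst H)" "snd H \<subseteq> {(x, y) \<in> fst H \<times> fst H. (g x, g y) \<in> snd I}"
    using assms(2) unfolding inj_cont_le_def by blast
  have im: "f ` fst G \<subseteq> fst H" using f(1) by (auto simp: continuous_map_def)
  show ?thesis
    unfolding inj_cont_le_def
  proof (intro exI[of _ "g \<circ> f"] conjI)
    show "continuous_map (subtopology cantor_space (fst G)) (subtopology cantor_space (fst I)) (g \<circ> f)"
      using continuous_map_compose[OF f(1) g(1)] .
    show "inj_on (g \<circ> f) (fst G)" using f(2) g(2) im by (meson comp_inj_on inj_on_subset)
    show "snd G \<subseteq> {(x, y) \<in> fst G \<times> fst G. ((g \<circ> f) x, (g \<circ> f) y) \<in> snd I}"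
      using f(3) g(3) by auto
  qed
qed

lemma equiv_inj_cont_equiv: "equiv (Sg \<iota>) (inj_cont_equiv \<iota>)"
proof (rule equivI)
  show "refl_on (Sg \<iota>) (inj_cont_equiv \<iota>)"
    unfolding refl_on_def inj_cont_equiv_def Sg_def by (auto intro!: inj_cont_le_refl)
  show "sym (inj_cont_equiv \<iota>)" unfolding inj_cont_equiv_def by (rule symI) auto
  show "trans (inj_cont_equiv \<iota>)"
    unfolding inj_cont_equiv_def by (rule transI) (auto intro: inj_cont_le_trans)
qed (auto simp: inj_cont_equiv_def)

section \<open>Analyticity\<close>

text \<open>
  A sequence of clopen sets describes a continuous map: the \<open>n\<close>-th set consists of the points whose
  image has \<open>n\<close>-th coordinate \<open>1\<close>. The domain does not enter the code.
\<close>
definition decode :: "(nat \<Rightarrow> bool list list) \<Rightarrow> cantor \<Rightarrow> cantor" where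
  "decode s x = (\<lambda>n. x \<in> clopen_of (s n))"

definition hits :: "cantor set \<Rightarrow> (nat \<Rightarrow> bool list list) \<Rightarrow> bool list \<Rightarrow> bool list \<Rightarrow> bool" where
  "hits K s t r \<longleftrightarrow> (\<exists>x\<in>K. x \<in> cyl t \<and> decode s x \<in> cyl r)"

text \<open>
  The witnesses for comparability of two graphs. The three clauses say that the decoded map sends
  the first compact set into the second, is injective on it, and is a homomorphism. The first two
  refer to the map through the words that it hits, which depend on finitely much of the code.
  Membership of the image of an edge in the second graph would be an \<open>F\<^sub>\<sigma>\<close> condition on the map alone;
  the additional witness \<open>v\<close>, which guesses the images of the points of \<open>Q\<close>, makes it closed.
\<close>
definition codes :: "cantor set \<Rightarrow> (nat \<Rightarrow> bool list list) \<Rightarrow> (cantor \<Rightarrow> cantor) \<Rightarrow>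
    cgraph \<Rightarrow> cgraph \<Rightarrow> bool" where
  "codes Q s v G G' \<longleftrightarrow>
     (\<forall>r. hits (fst G) s [] r \<longrightarrow> fst G' \<inter> cyl r \<noteq> {}) \<and>
     (\<forall>m. \<exists>n. \<forall>t\<in>{t. length t = m}. \<forall>t'\<in>{t. length t = m}. \<forall>r\<in>{r. length r = n}.
        hits (fst G) s t r \<and> hits (fst G) s t' r \<longrightarrow> t = t') \<and>
     (\<forall>p\<in>Q \<times> Q. p \<in> snd G \<longrightarrow> (v (fst p), v (snd p)) \<in> snd G' \<and>
        (\<forall>n. decode s (fst p) n = v (fst p) n \<and> decode s (snd p) n = v (snd p) n))"

lemma continuous_map_decode: "continuous_map cantor_space cantor_space (decode s)"
  unfolding continuous_map_into_seq_space decode_def by (simp add: locally_constant_clopen_of)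

text \<open>
  By compactness the inverse of the injection is continuous, and its first \<open>m\<close> coordinates are
  locally constant on the compact image.
\<close>
lemma injective_uniformly:
  assumes K: "compactin cantor_space K"
    and f: "continuous_map (subtopology cantor_space K) cantor_space f" "inj_on f K"
  obtains n where "\<And>x y. x \<in> K \<Longrightarrow> y \<in> K \<Longrightarrow> agree n (f x) (f y) \<Longrightarrow> agree m x y"
proof -
  let ?K = "subtopology cantor_space K" and ?L = "subtopology cantor_space (f ` K)"
  have "homeomorphic_map ?K ?L f"
  proof (rule continuous_imp_homeomorphic_map)
    show "continuous_map ?K ?L f" using f(1) by (simp add: continuous_map_in_subtopology)
    show "compact_space ?K" using K by (simp add: compact_space_subtopology)
    show "Hausdorff_space ?L" by (simp add: Hausdorff_seq_space Hausdorff_space_subtopology)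
  qed (use f(2) in auto)
  then obtain g where g: "homeomorphic_maps ?K ?L f g" unfolding homeomorphic_map_maps by blast
  then have "continuous_map ?L cantor_space g"
    by (simp add: homeomorphic_maps_def continuous_map_in_subtopology)
  then have "locally_constant ?L (\<lambda>y. prefix m (g y))"
    by (rule locally_constant_pullback[OF _ locally_constant_prefix])
  moreover have "compactin cantor_space (f ` K)"
    using image_compactin[OF _ f(1)] K by (simp add: compactin_subtopology)
  ultimately obtain n where n: "\<And>x y. x \<in> f ` K \<Longrightarrow> y \<in> f ` K \<Longrightarrow> agree n x y \<Longrightarrow> prefix m (g x) = prefix m (g y)"
    using uniformly_locally_constant by metis
  have gf: "g (f x) = x" if "x \<in> K" for x
    using g that by (simp add: homeomorphic_maps_def)
  show ?thesis
  proof (rule that[of n])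
    fix x y assume xy: "x \<in> K" "y \<in> K" "agree n (f x) (f y)"
    then have "prefix m (g (f x)) = prefix m (g (f y))" by (intro n) auto
    then show "agree m x y" using gf xy prefix_eq_iff_agree by metis
  qed
qed

lemma inj_cont_le_iff_codes:
  assumes G: "G \<in> Sg \<iota>" and G': "G' \<in> Sg \<iota>"
  defines "Q \<equiv> Q_iota \<iota>"
  shows "inj_cont_le G G' \<longleftrightarrow> (\<exists>s. \<exists>v\<in>Q \<rightarrow>\<^sub>E Q. codes Q s v G G')"
proof -
  obtain K R where KR: "G = (K, R)" by (cases G)
  obtain K' R' where KR': "G' = (K', R')" by (cases G')
  have K: "closedin cantor_space K" and R: "R \<subseteq> Q \<times> Q" "R \<subseteq> K \<times> K"
    using G unfolding KR Sg_iff Q_def by auto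
  have K': "closedin cantor_space K'" and R': "R' \<subseteq> Q \<times> Q"
    using G' unfolding KR' Sg_iff Q_def by auto
  show ?thesis
  proof
    assume "inj_cont_le G G'"
    then obtain f where f: "continuous_map (subtopology cantor_space K) (subtopology cantor_space K') f"
      "inj_on f K" and fR: "R \<subseteq> {(x, y) \<in> K \<times> K. (f x, f y) \<in> R'}"
      unfolding inj_cont_le_def KR KR' by auto
    have fc: "continuous_map (subtopology cantor_space K) cantor_space f" and fim: "f ` K \<subseteq> K'"
      using f(1) by (auto simp: continuous_map_in_subtopology)
    have "\<exists>w. \<forall>x\<in>K. x \<in> clopen_of w \<longleftrightarrow> f x n" for n
      using clopen_extension[OF K] fc[unfolded continuous_map_into_seq_space] by blast
    then obtain s where s: "\<And>n x. x \<in> K \<Longrightarrow> x \<in> clopen_of (s n) \<longleftrightarrow> f x n" by metis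
    have dec: "decode s x = f x" if "x \<in> K" for x
      using s that by (simp add: decode_def fun_eq_iff)
    \<comment> \<open>A point of \<open>Q\<close> that is not mapped into \<open>Q\<close> is on no edge, and any value in \<open>Q\<close> will do for it.\<close>
    define v where "v = (\<lambda>x\<in>Q. if f x \<in> Q then f x else x)"
    have v: "v \<in> Q \<rightarrow>\<^sub>E Q" by (auto simp: v_def)
    have "codes Q s v G G'"
      unfolding codes_def KR KR' fst_conv snd_conv
    proof (intro conjI allI ballI impI)
      fix r assume "hits K s [] r"
      then show "K' \<inter> cyl r \<noteq> {}" unfolding hits_def using dec fim by auto
    next
      fix m
      obtain n where n: "\<And>x y. x \<in> K \<Longrightarrow> y \<in> K \<Longrightarrow> agree n (f x) (f y) \<Longrightarrow> agree m x y"
        using injective_uniformly[OF _ fc f(2)] K compactin_cantor_iff by metis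
      have "t = t'" if len: "length t = m" "length t' = m" "length r = n"
          and hit: "hits K s t r" "hits K s t' r" for t t' r
      proof -
        obtain x where x: "x \<in> K" "prefix m x = t" "prefix n (f x) = r"
          using len hit dec unfolding hits_def cyl_def by auto
        obtain y where y: "y \<in> K" "prefix m y = t'" "prefix n (f y) = r"
          using len hit dec unfolding hits_def cyl_def by auto
        show ?thesis using n x y by (metis prefix_eq_iff_agree)
      qed
      then show "\<exists>n. \<forall>t\<in>{t. length t = m}. \<forall>t'\<in>{t. length t = m}. \<forall>r\<in>{r. length r = n}.
          hits K s t r \<and> hits K s t' r \<longrightarrow> t = t'" by auto
    next
      fix p assume "p \<in> Q \<times> Q" and p: "p \<in> R"
      have *: "fst p \<in> K" "snd p \<in> K" "(f (fst p), f (snd p)) \<in> R'" using p fR by auto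
      then have fQ: "f (fst p) \<in> Q" "f (snd p) \<in> Q" using R' by auto
      have pQ: "fst p \<in> Q" "snd p \<in> Q" using p R by auto
      have vp: "v (fst p) = f (fst p)" "v (snd p) = f (snd p)" using fQ pQ by (auto simp: v_def)
      show "(v (fst p), v (snd p)) \<in> R'" using vp * by simp
      show "decode s (fst p) n = v (fst p) n" "decode s (snd p) n = v (snd p) n" for n
        using vp dec * by simp_all
    qed
    then show "\<exists>s. \<exists>v\<in>Q \<rightarrow>\<^sub>E Q. codes Q s v G G'" using v by blast
  next
    assume "\<exists>s. \<exists>v\<in>Q \<rightarrow>\<^sub>E Q. codes Q s v G G'"
    then obtain s v where c: "codes Q s v G G'" by blast
    have c1: "hits K s [] r \<Longrightarrow> K' \<inter> cyl r \<noteq> {}" for r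
      using c unfolding codes_def KR KR' by auto
    have c2: "\<exists>n. \<forall>t\<in>{t. length t = m}. \<forall>t'\<in>{t. length t = m}. \<forall>r\<in>{r. length r = n}.
        hits K s t r \<and> hits K s t' r \<longrightarrow> t = t'" for m
      using c unfolding codes_def KR KR' by auto
    have c3: "(v (fst p), v (snd p)) \<in> R' \<and> decode s (fst p) = v (fst p) \<and> decode s (snd p) = v (snd p)"
      if "p \<in> R" for p
    proof -
      have "p \<in> Q \<times> Q" using that R by auto
      then show ?thesis using that c unfolding codes_def KR KR' fun_eq_iff by auto
    qed
    have im: "decode s x \<in> K'" if x: "x \<in> K" for x
    proof -
      have "\<exists>y\<in>K'. agree n (decode s x) y" for n
      proof -
        have "hits K s [] (prefix n (decode s x))" 
          unfolding hits_def by (intro bexI[OF _ x] conjI) simp_all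
        then show ?thesis using c1 in_cyl_prefix_iff by blast
      qed
      then show ?thesis using K' unfolding closedin_seq_space by blast
    qed
    have "inj_on (decode s) K"
    proof (rule inj_onI, rule eq_if_agree)
      fix x y m assume xy: "x \<in> K" "y \<in> K" "decode s x = decode s y"
      obtain n where n: "\<And>t t' r. length t = m \<Longrightarrow> length t' = m \<Longrightarrow> length r = n \<Longrightarrow>
          hits K s t r \<Longrightarrow> hits K s t' r \<Longrightarrow> t = t'"
        using c2[of m] by auto
      have "prefix m x = prefix m y"
      proof (rule n)
        show "hits K s (prefix m x) (prefix n (decode s x))" "hits K s (prefix m y) (prefix n (decode s x))"
          unfolding hits_def using xy in_cyl_prefix by metis+
      qed auto
      then show "agree m x y" by (simp add: prefix_eq_iff_agree)
    qed
    moreover have "continuous_map (subtopology cantor_space K) (subtopology cantor_space K') (decode s)"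
      unfolding continuous_map_in_subtopology
      using continuous_map_from_subtopology[OF continuous_map_decode] im by auto
    moreover have "R \<subseteq> {(x, y) \<in> K \<times> K. (decode s x, decode s y) \<in> R'}"
      using c3 R(2) by force
    ultimately show "inj_cont_le G G'"
      unfolding inj_cont_le_def KR KR' fst_conv snd_conv by (intro exI[of _ "decode s"] conjI)
  qed
qed

lemma locally_constant_hits:
  assumes K: "continuous_map X (vietoris cantor_space) K" and s: "continuous_map X seq_space s"
  shows "locally_constant X (\<lambda>z. hits (K z) (s z) t r)"
proof -
  define D where "D w = {x \<in> cyl t. \<forall>k\<in>{..<length r}. (x \<in> clopen_of (w ! k)) = r ! k}" for w :: "bool list list list"
  have "locally_constant cantor_space (\<lambda>x. x \<in> D w)" for w
    unfolding D_def mem_Collect_eq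
    by (intro locally_constant_comp2[where h = "(\<and>)"] locally_constant_cyl locally_constant_Ball
        locally_constant_comp[OF locally_constant_clopen_of]) auto
  note D = clopen_locally_constant[OF this]
  have "locally_constant X (\<lambda>z. K z \<inter> D (prefix (length r) (s z)) \<noteq> {})"
    by (intro locally_constant_family[of X "\<lambda>z. prefix (length r) (s z)" "\<lambda>w z. K z \<inter> D w \<noteq> {}"]
        locally_constant_pullback[OF s locally_constant_prefix]
        locally_constant_pullback[OF K locally_constant_vietoris_meets[OF D]])
  moreover have "hits (K z) (s z) t r \<longleftrightarrow> K z \<inter> D (prefix (length r) (s z)) \<noteq> {}" for z
  proof -
    have "decode (s z) x \<in> cyl r \<longleftrightarrow>
        (\<forall>k\<in>{..<length r}. (x \<in> clopen_of (prefix (length r) (s z) ! k)) = r ! k)" for x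
    proof -
      have 1: "decode (s z) x \<in> cyl r \<longleftrightarrow> (\<forall>k<length r. decode (s z) x k = r ! k)"
        unfolding cyl_def mem_Collect_eq by (subst list_eq_iff_nth_eq) (simp add: subsequence_def)
      have 2: "prefix (length r) (s z) ! k = s z k" if "k < length r" for k
        using that by (simp add: subsequence_def)
      show ?thesis unfolding 1 by (simp add: 2 decode_def Ball_def)
    qed
    then show ?thesis unfolding hits_def D_def by blast
  qed
  ultimately show ?thesis by simp
qed

lemma gdelta_in_codes:
  assumes Q: "countable Q"
    and K: "continuous_map X (vietoris cantor_space) (\<lambda>z. fst (G z))"
    and K': "continuous_map X (vietoris cantor_space) (\<lambda>z. fst (G' z))"
    and R: "continuous_map X (powerset_topology (Q \<times> Q)) (\<lambda>z. snd (G z))"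
    and R': "continuous_map X (powerset_topology (Q \<times> Q)) (\<lambda>z. snd (G' z))"
    and s: "continuous_map X seq_space s"
    and v: "continuous_map X (product_topology (\<lambda>_. discrete_topology Q) Q) v"
  shows "gdelta_in X {z \<in> topspace X. codes Q (s z) (v z) (G z) (G' z)}"
proof -
  have hit: "locally_constant X (\<lambda>z. hits (fst (G z)) (s z) t r)" for t r
    by (rule locally_constant_hits[OF K s])
  have vx: "locally_constant X (\<lambda>z. v z x)" if "x \<in> Q" for x
  proof (rule continuous_map_discrete_superset)
    show "continuous_map X (discrete_topology Q) (\<lambda>z. v z x)"
      using continuous_map_compose[OF v continuous_map_product_projection[OF that]] by (simp add: o_def)
  qed simp
  have sn: "locally_constant X (\<lambda>z. s z n)" for n
    using s unfolding continuous_map_into_seq_space by blast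
  have edge: "locally_constant X (\<lambda>z. (v z (fst p), v z (snd p)) \<in> snd (G' z))" if "p \<in> Q \<times> Q" for p
  proof -
    have "locally_constant X (\<lambda>z. (v z (fst p), v z (snd p)))"
      by (intro locally_constant_pair vx) (use that in auto)
    then show ?thesis
      by (rule locally_constant_family[where P = "\<lambda>q z. q \<in> snd (G' z)"]) (rule locally_constant_edge[OF R'])
  qed
  have dec: "locally_constant X (\<lambda>z. decode (s z) x n = v z x n)" if "x \<in> Q" for x n
    unfolding decode_def
    using locally_constant_comp2[OF sn[of n] vx[OF that], of "\<lambda>w y. (x \<in> clopen_of w) = y n"] .
  show ?thesis
    unfolding codes_def
  proof (intro gdelta_in_conj gdelta_in_countable_All gdelta_in_countable_Ball gdelta_in_imp)
    show "countable (Q \<times> Q)" using Q by simp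
    show "locally_constant X (\<lambda>z. hits (fst (G z)) (s z) [] r)" for r by (rule hit)
    show "gdelta_in X {z \<in> topspace X. fst (G' z) \<inter> cyl r \<noteq> {}}" for r
      by (intro open_imp_gdelta_in locally_constant_open locally_constant_meets_cyl K')
    show "gdelta_in X {z \<in> topspace X. \<exists>n. \<forall>t\<in>{t. length t = m}. \<forall>t'\<in>{t. length t = m}. \<forall>r\<in>{r. length r = n}.
        hits (fst (G z)) (s z) t r \<and> hits (fst (G z)) (s z) t' r \<longrightarrow> t = t'}" for m
      by (intro open_imp_gdelta_in openin_Ex locally_constant_open locally_constant_Ball finite_words
          locally_constant_comp2[OF hit hit, where h = "\<lambda>a b. a \<and> b \<longrightarrow> t = t'" for t t'])
    fix p assume p: "p \<in> Q \<times> Q"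
    then have p': "fst p \<in> Q" "snd p \<in> Q" by auto
    show "locally_constant X (\<lambda>z. p \<in> snd (G z))" by (rule locally_constant_edge[OF R])
    show "gdelta_in X {z \<in> topspace X. (v z (fst p), v z (snd p)) \<in> snd (G' z)}"
      by (intro open_imp_gdelta_in locally_constant_open edge p)
    show "gdelta_in X {z \<in> topspace X. decode (s z) (fst p) n = v z (fst p) n}"
         "gdelta_in X {z \<in> topspace X. decode (s z) (snd p) n = v z (snd p) n}" for n
      by (intro open_imp_gdelta_in locally_constant_open dec p')+
  qed
qed

text \<open>
  The equivalence relation is the projection of the set of pairs of graphs together with codes for
  comparisons in both directions.
\<close>
lemma analytic_inj_cont_equiv:
  "analytic_in (prod_topology (Sg_space \<iota>) (Sg_space \<iota>)) (inj_cont_equiv \<iota>)"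
proof -
  let ?Q = "Q_iota \<iota>"
  let ?V = "product_topology (\<lambda>_. discrete_topology ?Q) ?Q"
  let ?SS = "prod_topology (Sg_space \<iota>) (Sg_space \<iota>)"
  let ?C = "prod_topology (seq_space :: (nat \<Rightarrow> bool list list) topology) ?V"
  let ?X = "prod_topology ?SS (prod_topology ?C ?C)"
  have S: "polish_space (seq_space :: (nat \<Rightarrow> bool list list) topology)"
    unfolding seq_space_def by (rule polish_space_discrete_product) auto
  have X: "polish_space ?X"
    by (intro polish_space_prod polish_space_Sg_space S polish_space_discrete_product countable_Q_iota)
  let ?c1 = "\<lambda>z. codes ?Q (fst (fst (snd z))) (snd (fst (snd z))) (fst (fst z)) (snd (fst z))"
  let ?c2 = "\<lambda>z. codes ?Q (fst (snd (snd z))) (snd (snd (snd z))) (snd (fst z)) (fst (fst z))"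
  let ?Z = "{z \<in> topspace ?X. ?c1 z \<and> ?c2 z}"
  have p1: "continuous_map ?X (Sg_space \<iota>) (\<lambda>z. fst (fst z))"
    and p2: "continuous_map ?X (Sg_space \<iota>) (\<lambda>z. snd (fst z))"
    and p3: "continuous_map ?X ?C (\<lambda>z. fst (snd z))"
    and p4: "continuous_map ?X ?C (\<lambda>z. snd (snd z))"
    using continuous_map_compose[OF continuous_map_fst continuous_map_fst]
      continuous_map_compose[OF continuous_map_fst continuous_map_snd]
      continuous_map_compose[OF continuous_map_snd continuous_map_fst]
      continuous_map_compose[OF continuous_map_snd continuous_map_snd]
    by (simp_all add: o_def)
  have "gdelta_in ?X ?Z"
    by (intro gdelta_in_conj gdelta_in_codes countable_Q_iota)
      (rule continuous_map_compose[OF p1 continuous_map_Sg_fst, unfolded o_def]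
        continuous_map_compose[OF p2 continuous_map_Sg_fst, unfolded o_def]
        continuous_map_compose[OF p1 continuous_map_Sg_snd, unfolded o_def]
        continuous_map_compose[OF p2 continuous_map_Sg_snd, unfolded o_def]
        continuous_map_compose[OF p3 continuous_map_fst, unfolded o_def]
        continuous_map_compose[OF p3 continuous_map_snd, unfolded o_def]
        continuous_map_compose[OF p4 continuous_map_fst, unfolded o_def]
        continuous_map_compose[OF p4 continuous_map_snd, unfolded o_def])+
  then have Z: "polish_space (subtopology ?X ?Z)" by (rule polish_space_gdelta[OF X])
  have "analytic_in ?SS (fst ` topspace (subtopology ?X ?Z))"
    by (rule analytic_in_continuous_image[OF Z]) (rule continuous_map_from_subtopology[OF continuous_map_fst])
  moreover have "fst ` topspace (subtopology ?X ?Z) = inj_cont_equiv \<iota>"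
  proof (intro equalityI subsetI)
    fix g assume "g \<in> fst ` topspace (subtopology ?X ?Z)"
    then obtain z where z: "z \<in> topspace ?X" "?c1 z" "?c2 z" "g = fst z" by auto
    obtain G G' s v s' v' where "z = ((G, G'), ((s, v), (s', v')))" by (metis surj_pair)
    then have g: "g = (G, G')" "G \<in> Sg \<iota>" "G' \<in> Sg \<iota>" "v \<in> ?Q \<rightarrow>\<^sub>E ?Q" "v' \<in> ?Q \<rightarrow>\<^sub>E ?Q"
      "codes ?Q s v G G'" "codes ?Q s' v' G' G" using z by auto
    then show "g \<in> inj_cont_equiv \<iota>"
      unfolding inj_cont_equiv_def using inj_cont_le_iff_codes by auto
  next
    fix g assume "g \<in> inj_cont_equiv \<iota>"
    then obtain G G' where g: "g = (G, G')" "G \<in> Sg \<iota>" "G' \<in> Sg \<iota>" "inj_cont_le G G'" "inj_cont_le G' G"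
      unfolding inj_cont_equiv_def by auto
    obtain s v where 1: "v \<in> ?Q \<rightarrow>\<^sub>E ?Q" "codes ?Q s v G G'"
      using g inj_cont_le_iff_codes[OF g(2,3)] by blast
    obtain s' v' where 2: "v' \<in> ?Q \<rightarrow>\<^sub>E ?Q" "codes ?Q s' v' G' G"
      using g inj_cont_le_iff_codes[OF g(3,2)] by blast
    have "((G, G'), ((s, v), (s', v'))) \<in> topspace (subtopology ?X ?Z)"
      using g 1 2 by simp
    from imageI[OF this, of fst] show "g \<in> fst ` topspace (subtopology ?X ?Z)" using g(1) by simp
  qed
  ultimately show ?thesis by simp
qed

section \<open>Homeomorphisms of Cantor space and their orbits\<close>

lemma homeos_bij: "f \<in> homeos \<Longrightarrow> bij f"
  by (auto simp: homeos_def bij_def homeomorphic_eq_everything_map)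

lemma homeos_continuous: "f \<in> homeos \<Longrightarrow> continuous_map cantor_space cantor_space f"
  by (simp add: homeos_def homeomorphic_imp_continuous_map)

lemma homeos_continuous_inv:
  assumes "f \<in> homeos" shows "continuous_map cantor_space cantor_space (inv f)"
proof -
  obtain g where g: "homeomorphic_maps cantor_space cantor_space f g"
    using assms unfolding homeos_def homeomorphic_map_maps by blast
  then have "inv f = g"
    by (intro inv_unique_comp) (auto simp: homeomorphic_maps_def fun_eq_iff)
  then show ?thesis using g by (simp add: homeomorphic_maps_def)
qed

lemma homeosI:
  assumes "continuous_map cantor_space cantor_space f" "bij f" shows "f \<in> homeos"
  unfolding homeos_def using assms
  by (auto simp: bij_def intro!: continuous_imp_homeomorphic_map compact_cantor_space Hausdorff_seq_space)

lemma inv_homeos: "f \<in> homeos \<Longrightarrow> inv f \<in> homeos"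
  by (simp add: homeosI homeos_continuous_inv homeos_bij bij_imp_bij_inv)

lemma minimal_homeos_homeos: "f \<in> minimal_homeos \<Longrightarrow> f \<in> homeos"
  by (simp add: minimal_homeos_def)

lemma iterate_0 [simp]: "iterate f 0 x = x"
  by (simp add: iterate_def)

lemma iterate_succ:
  assumes "bij f" shows "iterate f (i + 1) x = f (iterate f i x)"
proof (cases "0 \<le> i")
  case True
  then have "nat (i + 1) = Suc (nat i)" by simp
  then show ?thesis using True by (simp add: iterate_def)
next
  case False
  then have i: "nat (- i) = Suc (nat (- (i + 1)))" by simp
  have "f (iterate f i x) = (inv f ^^ nat (- (i + 1))) x"
    using False surj_f_inv_f[OF bij_is_surj[OF assms]] unfolding iterate_def i by simp
  then show ?thesis using False by (auto simp: iterate_def)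
qed

text \<open>
  Such a set contains the orbit of each of its points.
\<close>
lemma minimal_invariant:
  assumes f: "f \<in> minimal_homeos" and S: "closedin cantor_space S" "x \<in> S" "\<And>y. y \<in> S \<longleftrightarrow> f y \<in> S"
  shows "S = UNIV"
proof -
  have bij: "bij f" using f homeos_bij minimal_homeos_homeos by blast
  have "iterate f i x \<in> S" for i
  proof (induction i rule: int_induct[where k = 0])
    case (step1 i) then show ?case using S(3) iterate_succ[OF bij] by metis
  next
    case (step2 i)
    then show ?case using S(3) iterate_succ[OF bij, of "i - 1" x] by simp
  qed (simp add: S(2))
  then have "cantor_space closure_of range (\<lambda>i. iterate f i x) \<subseteq> S"
    by (intro closure_of_minimal S(1)) auto
  then show ?thesis using f unfolding minimal_homeos_def by blast
qed

lemma minimal_dense: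
  assumes "f \<in> minimal_homeos" shows "\<exists>i. agree n x (iterate f i y)"
proof -
  have "x \<in> cantor_space closure_of range (\<lambda>i. iterate f i y)"
    using assms unfolding minimal_homeos_def by blast
  then show ?thesis unfolding in_closure_of_seq_space by blast
qed

lemma infinite_cantor: "infinite (UNIV :: cantor set)"
proof
  assume fin: "finite (UNIV :: cantor set)"
  have "inj (\<lambda>n k. k = (n :: nat))" by (rule injI) (metis (full_types))
  then show False using fin finite_imageD[of "\<lambda>n k. k = (n :: nat)" UNIV] finite_subset[OF subset_UNIV fin] by simp
qed

text \<open>
  Otherwise \<open>{x, f x}\<close> would be a finite, hence closed and proper, invariant set.
\<close>
lemma minimal_no_period_2:
  assumes f: "f \<in> minimal_homeos" shows "f (f x) \<noteq> x"
proof
  assume per: "f (f x) = x"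
  have inj: "inj f" using f homeos_bij minimal_homeos_homeos bij_is_inj by blast
  have "{x, f x} = UNIV"
  proof (rule minimal_invariant[OF f, of _ x])
    show "closedin cantor_space {x, f x}"
      using closedin_Hausdorff_finite[OF Hausdorff_seq_space, of "{x, f x}"] by simp
    show "y \<in> {x, f x} \<longleftrightarrow> f y \<in> {x, f x}" for y
      using per inj_eq[OF inj] by (metis insert_iff singleton_iff)
  qed simp
  then show False using infinite_cantor by (metis finite.emptyI finite_insert)
qed

lemma topspace_homeo_space [simp]: "topspace homeo_space = homeos"
  unfolding homeo_space_def topology_generated_by_topspace
proof (rule equalityI)
  show "homeos \<subseteq> \<Union> {{f \<in> homeos. \<forall>(U, V)\<in>P. f ` U = V} |P. finite P \<and> (\<forall>(U, V)\<in>P. clopen U \<and> clopen V)}"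
    by (rule Union_upper) (auto intro!: exI[of _ "{}"])
qed auto

lemma openin_homeo_space: "clopen U \<Longrightarrow> clopen V \<Longrightarrow> openin homeo_space {f \<in> homeos. f ` U = V}"
  unfolding homeo_space_def
  by (rule topology_generated_by_Basis) (auto intro!: exI[of _ "{(U, V)}"])

lemma clopen_image: "f \<in> homeos \<Longrightarrow> clopen U \<Longrightarrow> clopen (f ` U)"
  unfolding homeos_def clopen_def
  by (metis closed_map_def homeomorphic_imp_closed_map homeomorphic_imp_open_map mem_Collect_eq open_map_def)

lemma clopen_preimage: "f \<in> homeos \<Longrightarrow> clopen U \<Longrightarrow> clopen (f -` U)"
  using clopen_image[OF inv_homeos] bij_vimage_eq_inv_image[OF homeos_bij] by simp

text \<open>
  That \<open>f\<^sup>n\<close> carries a point into a clopen set is witnessed by finitely many clopen sets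
  \<open>W\<close> together with their images under \<open>f\<close>, hence is an open condition on \<open>f\<close>.
\<close>
lemma openin_iterate:
  assumes "clopen C"
  shows "openin homeo_space {f \<in> homeos. iterate f i x \<in> C}"
  using assms
proof (induction i arbitrary: C rule: int_induct[where k = 0])
  case base
  then show ?case using openin_topspace[of homeo_space] by (cases "x \<in> C") simp_all
next
  case (step1 i)
  have "{f \<in> homeos. iterate f (i + 1) x \<in> C} =
      (\<Union>W\<in>{W. clopen W}. {f \<in> homeos. f ` W = C} \<inter> {f \<in> homeos. iterate f i x \<in> W})"
  proof (intro equalityI subsetI)
    fix f assume "f \<in> {f \<in> homeos. iterate f (i + 1) x \<in> C}"
    then have f: "f \<in> homeos" "f (iterate f i x) \<in> C" using iterate_succ[OF homeos_bij] by auto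
    moreover have "f ` (f -` C) = C" using surj_image_vimage_eq[OF bij_is_surj[OF homeos_bij[OF f(1)]]] .
    ultimately show "f \<in> (\<Union>W\<in>{W. clopen W}. {f \<in> homeos. f ` W = C} \<inter> {f \<in> homeos. iterate f i x \<in> W})"
      using clopen_preimage[OF f(1) step1.prems] by (intro UN_I[of "f -` C"]) auto
  qed (auto simp: iterate_succ homeos_bij)
  moreover have "openin homeo_space \<dots>"
    by (rule openin_Union) (use step1 openin_homeo_space in \<open>auto intro!: openin_Int\<close>)
  ultimately show ?case by simp
next
  case (step2 i)
  have "{f \<in> homeos. iterate f (i - 1) x \<in> C} =
      (\<Union>W\<in>{W. clopen W}. {f \<in> homeos. f ` C = W} \<inter> {f \<in> homeos. iterate f i x \<in> W})"
  proof (intro equalityI subsetI)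
    fix f assume "f \<in> {f \<in> homeos. iterate f (i - 1) x \<in> C}"
    then have f: "f \<in> homeos" "iterate f (i - 1) x \<in> C" by auto
    then have "iterate f i x \<in> f ` C"
      using iterate_succ[OF homeos_bij[OF f(1)], of "i - 1" x] by simp
    then show "f \<in> (\<Union>W\<in>{W. clopen W}. {f \<in> homeos. f ` C = W} \<inter> {f \<in> homeos. iterate f i x \<in> W})"
      using f clopen_image[OF f(1) step2.prems] by auto
  next
    fix f assume "f \<in> (\<Union>W\<in>{W. clopen W}. {f \<in> homeos. f ` C = W} \<inter> {f \<in> homeos. iterate f i x \<in> W})"
    then have f: "f \<in> homeos" "iterate f i x \<in> f ` C" by auto
    then have "f (iterate f (i - 1) x) \<in> f ` C"
      using iterate_succ[OF homeos_bij[OF f(1)], of "i - 1" x] by simp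
    then show "f \<in> {f \<in> homeos. iterate f (i - 1) x \<in> C}"
      using f(1) inj_image_mem_iff[OF bij_is_inj[OF homeos_bij[OF f(1)]]] by simp
  qed
  moreover have "openin homeo_space \<dots>"
    by (rule openin_Union) (use step2 openin_homeo_space in \<open>auto intro!: openin_Int\<close>)
  ultimately show ?case by simp
qed

lemma topspace_minimal_space [simp]: "topspace minimal_space = minimal_homeos"
  unfolding minimal_space_def using minimal_homeos_homeos by auto

lemma continuous_map_iterate: "continuous_map minimal_space cantor_space (\<lambda>f. iterate f i x)"
proof -
  have "continuous_map homeo_space cantor_space (\<lambda>f. iterate f i x)"
    unfolding continuous_map_into_seq_space
  proof
    fix k
    have *: "clopen {x. x k = b}" for b
    proof -
      have "locally_constant cantor_space (\<lambda>x. x \<in> {x. x k = b})"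
        using locally_constant_comp[OF continuous_map_coordinate[of k], of "\<lambda>c. c = b"] by simp
      then show ?thesis using clopen_locally_constant unfolding clopen_def by blast
    qed
    show "locally_constant homeo_space (\<lambda>f. iterate f i x k)"
      unfolding locally_constant_iff using openin_iterate[OF *, of i x] by simp
  qed
  then show ?thesis unfolding minimal_space_def by (rule continuous_map_from_subtopology)
qed

section \<open>The vertices of the graphs\<close>

abbreviation zero :: cantor where
  "zero \<equiv> (\<lambda>_. False)"

definition emb :: "cantor \<Rightarrow> nat \<Rightarrow> letter" where
  "emb x = (\<lambda>k. digit (x k))"

definition cinf :: "nat \<Rightarrow> letter" where
  "cinf = (\<lambda>_. Lc)"

text \<open>
  The limit points of the vertices, which are the same for all minimal homeomorphisms: a copy of
  Cantor space and the point \<open>c\<^sup>\<infinity>\<close>.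
\<close>
definition limit_set :: "(nat \<Rightarrow> letter) set" where
  "limit_set = insert cinf (range emb)"

text \<open>
  The first \<open>l + 1\<close> letters of \<open>u\<close>, followed by a block of length \<open>n\<close> of one of the letters
  \<open>a\<close> and a-bar, and from then on by the other one; \<open>d\<close> selects the letter of the block.
\<close>
definition spike :: "(nat \<Rightarrow> letter) \<Rightarrow> nat \<Rightarrow> nat \<Rightarrow> bool \<Rightarrow> nat \<Rightarrow> letter" where
  "spike u l n d = (\<lambda>j. if j \<le> l then u j else if (j \<le> l + n) = d then La else Lb)"

context
  fixes Ls :: "nat \<Rightarrow> int"
begin

text \<open>
  Every vertex is a spike over a limit point. The \<open>2l + 3\<close> edges of level \<open>l\<close> are numbered by
  \<open>k \<le> 2l + 2\<close> in their order along the path from \<open>c\<^sup>\<infinity>\<close> through the orbit segment with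
  indices \<open>L\<^sub>l, \<dots>, R\<^sub>l\<close> and back to \<open>c\<^sup>\<infinity>\<close>; since \<open>R\<^sub>l = L\<^sub>l + 2l + 1\<close>, the left end \<open>L\<^sub>l\<close>
  determines the segment. The direction \<open>d\<close> distinguishes the first end of the \<open>k\<close>-th edge from its second end, which
  lies over the same limit point as the first end of the next edge.
\<close>
definition base :: "(cantor \<Rightarrow> cantor) \<Rightarrow> bool \<Rightarrow> nat \<Rightarrow> nat \<Rightarrow> nat \<Rightarrow> letter" where
  "base f d l k =
     (if d then (if k = 0 then cinf else emb (iterate f (Ls l + int k - 1) zero))
      else (if k = 2 * l + 2 then cinf else emb (iterate f (Ls l + int k) zero)))"

definition spike_length :: "bool \<Rightarrow> nat \<Rightarrow> nat \<Rightarrow> nat" where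
  "spike_length d l k = (if d then max 1 k else if k = 2 * l + 2 then 1 else Suc k)"

definition vertex :: "(cantor \<Rightarrow> cantor) \<Rightarrow> bool \<Rightarrow> nat \<Rightarrow> nat \<Rightarrow> nat \<Rightarrow> letter" where
  "vertex f d l k = spike (base f d l k) l (spike_length d l k) d"

definition vertices :: "(cantor \<Rightarrow> cantor) \<Rightarrow> (nat \<Rightarrow> letter) set" where
  "vertices f = {vertex f d l k | d l k. k \<le> 2 * l + 2}"

definition edges :: "(cantor \<Rightarrow> cantor) \<Rightarrow> ((nat \<Rightarrow> letter) \<times> (nat \<Rightarrow> letter)) set" where
  "edges f = {(vertex f d l k, vertex f (\<not> d) l k) | d l k. k \<le> 2 * l + 2}"

end

lemma conc_eq_spike:
  assumes "length w = l + 1" "\<And>j. j \<le> l \<Longrightarrow> w ! j = u j"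
  shows "(w @ replicate n La) \<frown> [Lb]\<^sup>\<omega> = spike u l n True"
    and "(w @ replicate n Lb) \<frown> [La]\<^sup>\<omega> = spike u l n False"
proof -
  have "((w @ replicate n e) \<frown> [e']\<^sup>\<omega>) j = (if j \<le> l then u j else if j \<le> l + n then e else e')" for e e' j
    using assms by (auto simp: conc_def nth_append)
  then show "(w @ replicate n La) \<frown> [Lb]\<^sup>\<omega> = spike u l n True"
    and "(w @ replicate n Lb) \<frown> [La]\<^sup>\<omega> = spike u l n False"
    by (auto simp: spike_def fun_eq_iff)
qed

lemma orbit_word_nth: "j \<le> l \<Longrightarrow> orbit_word f l i ! j = emb (iterate f i zero) j"
  unfolding orbit_word_def emb_def by (subst nth_map) (simp_all del: upt_Suc)

lemma length_orbit_word: "length (orbit_word f l i) = l + 1"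
  by (simp add: orbit_word_def)

lemma replicate_Lc_nth: "j \<le> l \<Longrightarrow> replicate (l + 1) Lc ! j = cinf j"
  by (simp add: cinf_def del: replicate.simps replicate_Suc)

lemma GG_graph_eq_edges:
  assumes LR: "\<And>l. Rs l - Ls l = 2 * int l + 1"
  shows "GG_graph Ls Rs f = edges Ls f"
proof -
  have c: "(replicate (l + 1) Lc @ [La]) \<frown> [Lb]\<^sup>\<omega> = spike cinf l 1 True"
    "(replicate (l + 1) Lc @ [Lb]) \<frown> [La]\<^sup>\<omega> = spike cinf l 1 False" for l
    using conc_eq_spike[of "replicate (l + 1) Lc" l cinf 1] replicate_Lc_nth[of _ l] by simp_all
  have o: "(orbit_word f l i @ replicate n La) \<frown> [Lb]\<^sup>\<omega> = spike (emb (iterate f i zero)) l n True"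
    "(orbit_word f l i @ replicate n Lb) \<frown> [La]\<^sup>\<omega> = spike (emb (iterate f i zero)) l n False" for l i n
    using conc_eq_spike[of "orbit_word f l i" l "emb (iterate f i zero)" n] orbit_word_nth length_orbit_word by simp_all
  have o1: "(orbit_word f l i @ [Lb]) \<frown> [La]\<^sup>\<omega> = spike (emb (iterate f i zero)) l 1 False" for l i
    using o(2)[of l i 1] by simp
  have Rl: "Rs l = Ls l + int (2 * l + 2) - 1" for l
    using LR[of l] by simp
  let ?e = "\<lambda>l k. (vertex Ls f True l k, vertex Ls f False l k)"
  have e0: "((replicate (l + 1) Lc @ [La]) \<frown> [Lb]\<^sup>\<omega>, (orbit_word f l (Ls l) @ [Lb]) \<frown> [La]\<^sup>\<omega>) = ?e l 0" for l
    unfolding c o1 by (simp add: vertex_def base_def spike_length_def)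
  have e1: "((orbit_word f l (Ls l + int i) @ replicate (i + 1) La) \<frown> [Lb]\<^sup>\<omega>,
       (orbit_word f l (Ls l + int i + 1) @ replicate (i + 2) Lb) \<frown> [La]\<^sup>\<omega>) = ?e l (Suc i)" if "i \<le> 2 * l" for l i
    unfolding o using that by (simp add: vertex_def base_def spike_length_def algebra_simps)
  have e2: "((orbit_word f l (Rs l) @ replicate (2 * l + 2) La) \<frown> [Lb]\<^sup>\<omega>,
       (replicate (l + 1) Lc @ [Lb]) \<frown> [La]\<^sup>\<omega>) = ?e l (2 * l + 2)" for l
    unfolding c o Rl by (simp add: vertex_def base_def spike_length_def)
  have OO: "OO_graph Ls Rs f = {?e l k | l k. k \<le> 2 * l + 2}" (is "_ = ?E")
  proof -
    have "OO_graph Ls Rs f = {?e l 0 | l. True} \<union> {?e l (Suc i) | l i. i \<le> 2 * l} \<union> {?e l (2 * l + 2) | l. True}"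
      (is "_ = ?A \<union> ?B \<union> ?C")
      unfolding OO_graph_def using e0 e1 e2 by (intro arg_cong2[where f = "(\<union>)"] Collect_cong) metis+
    also have "\<dots> = ?E"
    proof (intro equalityI subsetI)
      fix p assume "p \<in> ?A \<union> ?B \<union> ?C"
      then consider l where "p = ?e l 0" | l i where "i \<le> 2 * l" "p = ?e l (Suc i)" | l where "p = ?e l (2 * l + 2)"
        by blast
      then show "p \<in> ?E"
      proof cases
        case 1 then show ?thesis by blast
      next
        case (2 l i)
        then have "p = ?e l (Suc i) \<and> Suc i \<le> 2 * l + 2" by simp
        then show ?thesis by blast
      next
        case 3 then show ?thesis by blast
      qed
    next
      fix p assume "p \<in> ?E"
      then obtain l k where p: "p = ?e l k" "k \<le> 2 * l + 2" by blast
      consider "k = 0" | i where "k = Suc i" "i \<le> 2 * l" | "k = 2 * l + 2"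
        using p(2) by (cases k) fastforce+
      then show "p \<in> ?A \<union> ?B \<union> ?C"
      proof cases
        case 1
        then have "p \<in> ?A" using p(1) by blast
        then show ?thesis by (intro UnI1)
      next
        case (2 i)
        then have "p \<in> ?B" using p(1) by blast
        then show ?thesis by (rule UnI1[OF UnI2])
      next
        case 3
        then have "p \<in> ?C" using p(1) by blast
        then show ?thesis by (intro UnI2)
      qed
    qed
    finally show ?thesis .
  qed
  show ?thesis
    unfolding GG_graph_def OO edges_def
  proof (intro equalityI subsetI)
    fix p assume "p \<in> ?E \<union> ?E\<inverse>"
    then obtain l k where k: "k \<le> 2 * l + 2"
      and "p = ?e l k \<or> p = (vertex Ls f False l k, vertex Ls f True l k)" by blast
    then have "p = (vertex Ls f True l k, vertex Ls f (\<not> True) l k) \<or>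
        p = (vertex Ls f False l k, vertex Ls f (\<not> False) l k)" by simp
    then show "p \<in> {(vertex Ls f d l k, vertex Ls f (\<not> d) l k) | d l k. k \<le> 2 * l + 2}"
      using k by blast
  next
    fix p assume "p \<in> {(vertex Ls f d l k, vertex Ls f (\<not> d) l k) | d l k. k \<le> 2 * l + 2}"
    then obtain d l k where "k \<le> 2 * l + 2" "p = (vertex Ls f d l k, vertex Ls f (\<not> d) l k)" by blast
    then show "p \<in> ?E \<union> ?E\<inverse>" by (cases d) auto
  qed
qed

lemma emb_ab: "emb x j \<noteq> La" "emb x j \<noteq> Lb" "emb x j \<noteq> Lc"
  by (auto simp: emb_def digit_def)

lemma emb_eq_iff: "emb x j = emb y j \<longleftrightarrow> x j = y j"
  by (auto simp: emb_def digit_def)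

lemma agree_emb [simp]: "agree n (emb x) (emb y) \<longleftrightarrow> agree n x y"
  by (simp add: agree_def emb_eq_iff)

lemma inj_emb: "inj emb"
  by (auto simp: inj_def fun_eq_iff emb_eq_iff)

lemma limit_set_ab: "u \<in> limit_set \<Longrightarrow> u j \<noteq> La" "u \<in> limit_set \<Longrightarrow> u j \<noteq> Lb"
  by (auto simp: limit_set_def cinf_def emb_ab)

lemma base_limit_set: "base Ls f d l k \<in> limit_set"
  by (auto simp: base_def limit_set_def)

lemma spike_length_pos: "1 \<le> spike_length d l k"
  by (auto simp: spike_length_def)

lemma agree_vertex_base: "agree (Suc l) (vertex Ls f d l k) (base Ls f d l k)"
  by (auto simp: vertex_def spike_def agree_def)

lemma vertex_after_base: "vertex Ls f d l k (Suc l) = La \<or> vertex Ls f d l k (Suc l) = Lb"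
  by (auto simp: vertex_def spike_def)

lemma agree_limit_vertex:
  assumes "u \<in> limit_set" "agree (Suc n) u (vertex Ls f d l k)"
  shows "n \<le> l"
proof (rule ccontr)
  assume "\<not> n \<le> l"
  then have "u (Suc l) = vertex Ls f d l k (Suc l)" using assms(2) by (auto simp: agree_def)
  then show False using vertex_after_base[of Ls f d l k] limit_set_ab[OF assms(1)] by metis
qed

text \<open>
  A spike is determined by its letters up to the first letter after the block of length \<open>n\<close>:
  the first letter outside \<open>0, 1, c\<close> gives \<open>l\<close> and the direction, and the first change gives \<open>n\<close>.
\<close>
lemma spike_rigid:
  assumes u: "u \<in> limit_set" and u': "u' \<in> limit_set" and n: "1 \<le> n" "1 \<le> n'"
    and agr: "agree (l + n + 2) (spike u l n d) (spike u' l' n' d')"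
  shows "l = l' \<and> n = n' \<and> d = d'"
proof -
  have eq: "spike u l n d j = spike u' l' n' d' j" if "j < l + n + 2" for j
    using agr that by (simp add: agree_def)
  have "l = l'"
  proof (rule linorder_cases[of l l'])
    assume "l < l'"
    then show ?thesis
      using eq[of "Suc l"] limit_set_ab[OF u', of "Suc l"] by (auto simp: spike_def split: if_splits)
  next
    assume "l' < l"
    then show ?thesis
      using eq[of "Suc l'"] limit_set_ab[OF u, of "Suc l'"] by (auto simp: spike_def split: if_splits)
  qed simp
  moreover have d: "d = d'"
    using eq[of "Suc l"] n \<open>l = l'\<close> by (auto simp: spike_def split: if_splits)
  moreover have "n = n'"
  proof (rule linorder_cases[of n n'])
    assume "n < n'"
    then show ?thesis using eq[of "l + n + 1"] \<open>l = l'\<close> d by (auto simp: spike_def split: if_splits)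
  next
    assume "n' < n"
    then show ?thesis using eq[of "l + n' + 1"] \<open>l = l'\<close> d by (auto simp: spike_def split: if_splits)
  qed simp
  ultimately show ?thesis by blast
qed

text \<open>
  Among the vertices of a given level and direction, spikes of length \<open>1\<close> occur twice. One of them lies
  over \<open>c\<^sup>\<infinity>\<close> and the other over Cantor space, so the first letter tells them apart.
\<close>
lemma vertex_rigid:
  assumes "agree (l + spike_length d l k + 2) (vertex Ls f d l k) (vertex Ls g d' l' k')"
    and k: "k \<le> 2 * l + 2" "k' \<le> 2 * l' + 2"
  shows "l' = l \<and> d' = d \<and> k' = k"
proof -
  have *: "l = l'" "d = d'" "spike_length d l k = spike_length d l k'"
    using spike_rigid[OF base_limit_set base_limit_set spike_length_pos spike_length_pos assms(1)[unfolded vertex_def]]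
    by auto
  have "vertex Ls f d l k 0 = vertex Ls g d l k' 0"
    using assms(1) * by (auto simp: agree_def)
  then have b: "base Ls f d l k 0 = base Ls g d l k' 0"
    by (simp add: vertex_def spike_def)
  have "k' = k"
    using b *(3) k unfolding *(1)[symmetric]
    by (cases d) (auto simp: spike_length_def base_def cinf_def emb_ab emb_ab[symmetric] max_def split: if_splits)
  with * show ?thesis by simp
qed

lemma vertex_inj:
  assumes "vertex Ls f d l k = vertex Ls g d' l' k'" "k \<le> 2 * l + 2" "k' \<le> 2 * l' + 2"
  shows "l' = l \<and> d' = d \<and> k' = k"
  using vertex_rigid[of l d k Ls f g d' l' k'] assms by simp

lemma vertex_isolated:
  assumes "k \<le> 2 * l + 2" "y \<in> vertices Ls f \<union> limit_set"
    "agree (l + spike_length d l k + 2) (vertex Ls f d l k) y"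
  shows "y = vertex Ls f d l k"
proof (cases "y \<in> limit_set")
  case True
  have "agree (Suc (Suc l)) y (vertex Ls f d l k)"
    using agree_mono[OF assms(3), of "Suc (Suc l)"] agree_sym by force
  then show ?thesis using agree_limit_vertex[OF True] by fastforce
next
  case False
  then obtain d' l' k' where "k' \<le> 2 * l' + 2" "y = vertex Ls f d' l' k'"
    using assms(2) unfolding vertices_def by blast
  then show ?thesis using vertex_rigid[OF assms(3)[unfolded \<open>y = _\<close>] assms(1)] by simp
qed

lemma vertices_limit_set_disjoint: "vertex Ls f d l k \<notin> limit_set"
  using vertex_after_base[of Ls f d l k] limit_set_ab by metis

lemma edge_unique:
  assumes "(x, y) \<in> edges Ls f" "(x, z) \<in> edges Ls f" shows "y = z"
  using assms vertex_inj unfolding edges_def by blast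

lemma edges_vertices: "(x, y) \<in> edges Ls f \<Longrightarrow> x \<in> vertices Ls f \<and> y \<in> vertices Ls f"
  unfolding edges_def vertices_def by blast

lemma fst_edges: "fst ` edges Ls f = vertices Ls f"
  unfolding edges_def vertices_def by force

lemma edges_sym:
  assumes "(x, y) \<in> edges Ls f" shows "(y, x) \<in> edges Ls f"
proof -
  obtain d l k where "(y, x) = (vertex Ls f (\<not> d) l k, vertex Ls f (\<not> \<not> d) l k)" "k \<le> 2 * l + 2"
    using assms unfolding edges_def by auto
  then show ?thesis unfolding edges_def by blast
qed

lemma edges_irrefl: "(x, x) \<notin> edges Ls f"
  unfolding edges_def using vertex_inj by blast

lemma vertices_QK: "vertices Ls f \<subseteq> QK"
proof
  fix x assume "x \<in> vertices Ls f"
  then obtain d l k where x: "x = vertex Ls f d l k" unfolding vertices_def by blast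
  have "\<forall>j \<ge> l + spike_length d l k + 1. x j = (if d then Lb else La)"
    by (auto simp: x vertex_def spike_def)
  then show "x \<in> QK"
    unfolding QK_def by (intro CollectI exI bexI) (assumption, simp)
qed

lemma compact_K_space: "compact_space K_space"
  by (rule compact_seq_space[OF finite_letter])

lemma closedin_limit_set: "closedin K_space limit_set"
  unfolding closedin_seq_space
proof (intro allI impI)
  fix x assume x: "\<forall>n. \<exists>y\<in>limit_set. agree n x y"
  have letters: "x 0 = Lc \<and> x k = Lc \<or> x 0 \<noteq> Lc \<and> (x k = L0 \<or> x k = L1)" for k
  proof -
    obtain y where y: "y \<in> limit_set" "agree (Suc k) x y" using x by blast
    then have "x 0 = y 0" "x k = y k" by (auto simp: agree_def)
    then show ?thesis using y(1) by (auto simp: limit_set_def cinf_def emb_def digit_def split: if_splits)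
  qed
  show "x \<in> limit_set"
  proof (cases "x 0 = Lc")
    case True
    then have "x = cinf" using letters by (auto simp: cinf_def)
    then show ?thesis by (simp add: limit_set_def)
  next
    case False
    then have "x = emb (\<lambda>k. x k = L1)" using letters by (auto simp: emb_def digit_def fun_eq_iff)
    then show ?thesis unfolding limit_set_def by blast
  qed
qed

lemma compactin_limit_set: "compactin K_space limit_set"
  using closedin_compact_space[OF compact_K_space closedin_limit_set] .

text \<open>
  A point off the limit set is at positive distance from it, hence also from the vertices of large
  level, and only finitely many vertices are left.
\<close>
lemma closedin_vertices_limit_set: "closedin K_space (vertices Ls f \<union> limit_set)"
  unfolding closedin_seq_space
proof (intro allI impI, rule ccontr)
  fix x assume x: "\<forall>n. \<exists>y\<in>vertices Ls f \<union> limit_set. agree n x y" and "x \<notin> vertices Ls f \<union> limit_set"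
  then have notin: "x \<notin> vertices Ls f" "x \<notin> limit_set" by auto
  then obtain n where n: "\<And>y. y \<in> limit_set \<Longrightarrow> \<not> agree n x y"
    using closedin_limit_set unfolding closedin_seq_space by blast
  let ?F = "(\<lambda>(d, l, k). vertex Ls f d l k) ` (SIGMA d : UNIV. SIGMA l : {..<n}. {..2 * l + 2})"
  have "finite ?F" by auto
  then have "closedin K_space ?F" by (intro closedin_Hausdorff_finite Hausdorff_seq_space) auto
  moreover have "x \<notin> ?F" using notin(1) unfolding vertices_def by auto
  ultimately obtain m where m: "\<And>y. y \<in> ?F \<Longrightarrow> \<not> agree m x y"
    unfolding closedin_seq_space by blast
  obtain y where y: "y \<in> vertices Ls f \<union> limit_set" "agree (max m n) x y" using x by blast
  then have agr: "agree m x y" "agree n x y" by (auto intro: agree_mono)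
  then have "y \<in> vertices Ls f" using y(1) n by blast
  then obtain d l k where v: "y = vertex Ls f d l k" "k \<le> 2 * l + 2" unfolding vertices_def by blast
  have "\<not> l < n"
  proof
    assume "l < n"
    then have "y \<in> ?F" using v by (auto intro!: image_eqI[of _ _ "(d, l, k)"])
    then show False using m agr(1) by blast
  qed
  then have "agree n y (base Ls f d l k)"
    using agree_vertex_base agree_mono unfolding v(1) by (metis le_SucI not_less)
  then show False using n[OF base_limit_set] agr(2) agree_trans by blast
qed

text \<open>
  Minimality makes the orbit of \<open>0\<^sup>\<infinity>\<close> dense, and each of its points is approached by
  vertices of arbitrarily large level because \<open>Ls\<close> takes each value cofinally.
\<close>
lemma closure_of_vertices:
  assumes f: "f \<in> minimal_homeos" and Ls: "\<And>z n. \<exists>l\<ge>n. Ls l = z"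
  shows "K_space closure_of vertices Ls f = vertices Ls f \<union> limit_set"
proof (intro equalityI subsetI)
  fix x assume "x \<in> K_space closure_of vertices Ls f"
  then show "x \<in> vertices Ls f \<union> limit_set"
    using closure_of_minimal[OF Un_upper1 closedin_vertices_limit_set] by blast
next
  fix x assume "x \<in> vertices Ls f \<union> limit_set"
  then consider "x \<in> vertices Ls f" | "x = cinf" | z where "x = emb z" unfolding limit_set_def by blast
  then show "x \<in> K_space closure_of vertices Ls f"
  proof cases
    case 1
    then show ?thesis unfolding in_closure_of_seq_space by (metis agree_refl)
  next
    case 2
    have "vertex Ls f True n 0 \<in> vertices Ls f \<and> agree n x (vertex Ls f True n 0)" for n
    proof
      show "agree n x (vertex Ls f True n 0)"
        using agree_mono[OF agree_vertex_base[of n Ls f True 0], of n] 2 agree_sym by (fastforce simp: base_def)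
    qed (auto simp: vertices_def)
    then show ?thesis unfolding in_closure_of_seq_space by blast
  next
    case (3 z)
    have "\<exists>y\<in>vertices Ls f. agree n x y" for n
    proof -
      obtain i where i: "agree n z (iterate f i zero)" using minimal_dense[OF f] by blast
      obtain l where l: "n \<le> l" "Ls l = i" using Ls by blast
      have "agree n (vertex Ls f False l 0) (emb (iterate f i zero))"
        using agree_mono[OF agree_vertex_base[of l Ls f False 0], of n] l by (simp add: base_def)
      then have "agree n x (vertex Ls f False l 0)"
        using i 3 by (metis agree_emb agree_sym agree_trans)
      moreover have "vertex Ls f False l 0 \<in> vertices Ls f" by (auto simp: vertices_def)
      ultimately show ?thesis by blast
    qed
    then show ?thesis unfolding in_closure_of_seq_space by blast
  qed
qed

section \<open>The map into the space of graphs\<close>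

text \<open>
  The \<open>2l + 3\<close> edges of level \<open>l\<close> form an odd cycle as soon as vertices that agree on the first
  \<open>l + 1\<close> letters are identified, so no continuous two-colouring exists.
\<close>
lemma no_two_colouring:
  assumes p: "locally_constant K_space (p :: _ \<Rightarrow> bool)"
  shows "\<exists>(x, y) \<in> edges Ls f. p x = p y"
proof (rule ccontr)
  assume no: "\<not> ?thesis"
  obtain n where n: "\<And>x y. agree n x y \<Longrightarrow> p x = p y"
    using uniformly_locally_constant[of UNIV UNIV p] compact_K_space p
    by (auto simp: compact_space_def)
  have pb: "p (vertex Ls f d n k) = p (base Ls f d n k)" for d k
    by (rule n) (rule agree_mono[OF agree_vertex_base], simp)
  have step: "p (base Ls f True n k) \<noteq> p (base Ls f False n k)" if "k \<le> 2 * n + 2" for k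
  proof -
    have "(vertex Ls f True n k, vertex Ls f (\<not> True) n k) \<in> edges Ls f"
      using that unfolding edges_def by blast
    then have "p (vertex Ls f True n k) \<noteq> p (vertex Ls f False n k)" using no by auto
    then show ?thesis by (simp add: pb)
  qed
  have alt: "p (base Ls f True n k) = (p cinf = even k)" if "k \<le> 2 * n + 2" for k
    using that
  proof (induction k)
    case 0 then show ?case by (simp add: base_def)
  next
    case (Suc k)
    have "base Ls f False n k = base Ls f True n (Suc k)" using Suc.prems by (simp add: base_def)
    then show ?case using step[of k] Suc by auto
  qed
  have "base Ls f False n (2 * n + 2) = cinf" by (simp add: base_def)
  then show False using step[of "2 * n + 2"] alt[of "2 * n + 2"] by simp
qed

context
  fixes \<iota> :: "(nat \<Rightarrow> letter) \<Rightarrow> cantor" and Ls Rs :: "nat \<Rightarrow> int"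
  assumes iota: "homeomorphic_map K_space cantor_space \<iota>"
    and cofinal: "\<And>z n. \<exists>l\<ge>n. Ls l = z"
    and LR: "\<And>l. Rs l - Ls l = 2 * int l + 1"
begin

lemma iota_continuous: "continuous_map K_space cantor_space \<iota>"
  using iota by (rule homeomorphic_imp_continuous_map)

lemma iota_inj: "inj \<iota>"
  using homeomorphic_imp_injective_map[OF iota] by simp

lemma graph_of_eq:
  assumes "f \<in> minimal_homeos"
  shows "graph_of \<iota> Ls Rs f = (\<iota> ` (vertices Ls f \<union> limit_set), map_prod \<iota> \<iota> ` edges Ls f)"
proof -
  have "fst ` map_prod \<iota> \<iota> ` edges Ls f = \<iota> ` fst ` edges Ls f" by (simp add: image_image)
  then have "cantor_space closure_of fst ` map_prod \<iota> \<iota> ` edges Ls f = \<iota> ` (vertices Ls f \<union> limit_set)"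
    using homeomorphic_map_closure_of[OF iota, of "vertices Ls f"] closure_of_vertices[OF assms cofinal]
    by (simp add: fst_edges)
  then show ?thesis
    unfolding graph_of_def GG_graph_eq_edges[OF LR] Let_def by simp
qed

lemma compactin_graph_of:
  "compactin cantor_space (\<iota> ` (vertices Ls f \<union> limit_set))"
  using image_compactin[OF closedin_compact_space[OF compact_K_space closedin_vertices_limit_set] iota_continuous] .

lemma edges_Q_iota: "map_prod \<iota> \<iota> ` edges Ls f \<subseteq> Q_iota \<iota> \<times> Q_iota \<iota>"
  unfolding Q_iota_def using vertices_QK edges_vertices by fastforce

lemma graph_of_Sg:
  assumes f: "f \<in> minimal_homeos" shows "graph_of \<iota> Ls Rs f \<in> Sg \<iota>"
  unfolding graph_of_eq[OF f] Sg_iff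
proof (intro conjI allI)
  show "closedin cantor_space (\<iota> ` (vertices Ls f \<union> limit_set))"
    using compactin_graph_of compactin_cantor_iff by blast
  show "map_prod \<iota> \<iota> ` edges Ls f \<subseteq> Q_iota \<iota> \<times> Q_iota \<iota>" by (rule edges_Q_iota)
  show "map_prod \<iota> \<iota> ` edges Ls f \<subseteq> \<iota> ` (vertices Ls f \<union> limit_set) \<times> \<iota> ` (vertices Ls f \<union> limit_set) - Id_on (\<iota> ` (vertices Ls f \<union> limit_set))"
  proof
    fix p assume "p \<in> map_prod \<iota> \<iota> ` edges Ls f"
    then obtain x y where p: "(x, y) \<in> edges Ls f" "p = (\<iota> x, \<iota> y)" by auto
    then have "x \<noteq> y" using edges_irrefl by blast
    then show "p \<in> \<iota> ` (vertices Ls f \<union> limit_set) \<times> \<iota> ` (vertices Ls f \<union> limit_set) - Id_on (\<iota> ` (vertices Ls f \<union> limit_set))"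
      using edges_vertices[OF p(1)] p(2) iota_inj by (auto simp: inj_eq)
  qed
  fix w
  have "locally_constant K_space (\<lambda>x. \<iota> x \<in> clopen_of w)"
    by (rule locally_constant_pullback[OF iota_continuous locally_constant_clopen_of])
  from no_two_colouring[OF this, of Ls f]
  show "\<exists>(x, y)\<in>map_prod \<iota> \<iota> ` edges Ls f. (x \<in> clopen_of w) = (y \<in> clopen_of w)" by force
qed

lemma graph_of_degree:
  assumes f: "f \<in> minimal_homeos"
  shows "finite (neighbours (snd (graph_of \<iota> Ls Rs f)) x) \<and> card (neighbours (snd (graph_of \<iota> Ls Rs f)) x) \<le> 1"
proof -
  have "y = z" if "y \<in> neighbours (snd (graph_of \<iota> Ls Rs f)) x" "z \<in> neighbours (snd (graph_of \<iota> Ls Rs f)) x" for y z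
  proof -
    from that obtain a b a' b' where "(a, b) \<in> edges Ls f" "x = \<iota> a" "y = \<iota> b" "(a', b') \<in> edges Ls f" "x = \<iota> a'" "z = \<iota> b'"
      unfolding neighbours_def graph_of_eq[OF f] by auto
    then show ?thesis using edge_unique iota_inj by (metis injD)
  qed
  then obtain y where "neighbours (snd (graph_of \<iota> Ls Rs f)) x \<subseteq> {y}" by blast
  then show ?thesis
    using finite_subset card_mono[of "{y}"] by fastforce
qed

text \<open>
  A vertex of level \<open>l\<close> depends on \<open>f\<close> only through the first \<open>l + 1\<close> coordinates of one point of
  the orbit.
\<close>
lemma locally_constant_vertex: "locally_constant minimal_space (\<lambda>f. vertex Ls f d l k)"
proof -
  have orbit: "locally_constant minimal_space (\<lambda>f. prefix (Suc l) (iterate f i zero))" for i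
    by (rule locally_constant_pullback[OF continuous_map_iterate locally_constant_prefix])
  have spike_cong: "spike u l n d = spike (\<lambda>j. prefix (Suc l) u ! j) l n d" for u n
    by (auto simp: spike_def fun_eq_iff subsequence_def simp del: upt_Suc)
  have pre: "prefix (Suc l) (emb z) = map digit (prefix (Suc l) z)" for z
    by (simp add: subsequence_def emb_def del: upt_Suc)
  have "locally_constant minimal_space (\<lambda>f. prefix (Suc l) (emb (iterate f i zero)))" for i
    unfolding pre by (rule locally_constant_comp[OF orbit])
  then have "locally_constant minimal_space (\<lambda>f. prefix (Suc l) (base Ls f d l k))"
    by (cases d; cases "k = 0"; cases "k = 2 * l + 2") (simp_all add: base_def)
  from locally_constant_comp[OF this, of "\<lambda>s. spike (\<lambda>j. s ! j) l (spike_length d l k) d"]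
  show ?thesis unfolding vertex_def spike_cong[symmetric] .
qed

text \<open>
  The limit set does not depend on \<open>f\<close>, so a neighbourhood of it contains all vertices of
  large level, and finitely many vertices remain to be tested.
\<close>
lemma continuous_map_graph_of: "continuous_map minimal_space (Sg_space \<iota>) (graph_of \<iota> Ls Rs)"
proof -
  let ?V = "\<lambda>f. \<iota> ` (vertices Ls f \<union> limit_set)" and ?E = "\<lambda>f. map_prod \<iota> \<iota> ` edges Ls f"
  have "continuous_map minimal_space (vietoris cantor_space) ?V"
  proof (rule continuous_map_into_vietoris)
    show "compactin cantor_space (?V f)" for f by (rule compactin_graph_of)
  next
    fix U assume "openin cantor_space U"
    from openin_continuous_map_preimage[OF iota_continuous this]
    have U: "openin K_space (\<iota> -` U)" by (simp add: vimage_def)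
    show "openin minimal_space {f \<in> topspace minimal_space. ?V f \<subseteq> U}"
    proof (cases "limit_set \<subseteq> \<iota> -` U")
      case True
      obtain n where n: "\<And>x y. x \<in> limit_set \<Longrightarrow> agree n x y \<Longrightarrow> \<iota> y \<in> U"
        using compactin_uniform_neighbourhood[OF compactin_limit_set U True] by auto
      have large: "\<iota> (vertex Ls f d l k) \<in> U" if "n \<le> l" for f d l k
        by (rule n[OF base_limit_set[of Ls f d l k]]) (use agree_mono[OF agree_vertex_base, of n l] agree_sym that in fastforce)
      let ?F = "SIGMA d : UNIV. SIGMA l : {..<n}. {..2 * l + 2}"
      have "?V f \<subseteq> U \<longleftrightarrow> (\<forall>q\<in>?F. \<iota> (vertex Ls f (fst q) (fst (snd q)) (snd (snd q))) \<in> U)" for f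
      proof -
        have "?V f \<subseteq> U \<longleftrightarrow> (\<forall>x\<in>vertices Ls f. \<iota> x \<in> U)"
          using True by auto
        also have "\<dots> \<longleftrightarrow> (\<forall>d l k. k \<le> 2 * l + 2 \<longrightarrow> \<iota> (vertex Ls f d l k) \<in> U)"
          unfolding vertices_def by blast
        also have "\<dots> \<longleftrightarrow> (\<forall>d l k. l < n \<and> k \<le> 2 * l + 2 \<longrightarrow> \<iota> (vertex Ls f d l k) \<in> U)"
          using large not_le by blast
        finally show ?thesis by auto
      qed
      moreover have "openin minimal_space {f \<in> topspace minimal_space.
          \<forall>q\<in>?F. \<iota> (vertex Ls f (fst q) (fst (snd q)) (snd (snd q))) \<in> U}"
        by (intro locally_constant_open locally_constant_Ball locally_constant_comp[OF locally_constant_vertex]) auto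
      ultimately show ?thesis by simp
    next
      case False
      then have "{f \<in> topspace minimal_space. ?V f \<subseteq> U} = {}" by auto
      then show ?thesis by (simp only: openin_empty)
    qed
  next
    fix U assume U: "openin cantor_space U"
    have "?V f \<inter> U \<noteq> {} \<longleftrightarrow> (\<exists>d l k. (k \<le> 2 * l + 2 \<and> \<iota> (vertex Ls f d l k) \<in> U) \<or> \<iota> ` limit_set \<inter> U \<noteq> {})" for f
    proof -
      have "?V f \<inter> U \<noteq> {} \<longleftrightarrow> (\<exists>x\<in>vertices Ls f. \<iota> x \<in> U) \<or> \<iota> ` limit_set \<inter> U \<noteq> {}" by auto
      then show ?thesis unfolding vertices_def by blast
    qed
    moreover have "openin minimal_space {f \<in> topspace minimal_space.
        \<exists>d l k. (k \<le> 2 * l + 2 \<and> \<iota> (vertex Ls f d l k) \<in> U) \<or> \<iota> ` limit_set \<inter> U \<noteq> {}}"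
      by (intro openin_Ex locally_constant_open) (rule locally_constant_comp[OF locally_constant_vertex])
    ultimately show "openin minimal_space {f \<in> topspace minimal_space. ?V f \<inter> U \<noteq> {}}" by simp
  qed
  moreover have "continuous_map minimal_space (powerset_topology (Q_iota \<iota> \<times> Q_iota \<iota>)) ?E"
  proof (rule continuous_map_into_powerset)
    show "?E f \<subseteq> Q_iota \<iota> \<times> Q_iota \<iota>" for f by (rule edges_Q_iota)
    fix p
    show "locally_constant minimal_space (\<lambda>f. p \<in> ?E f)"
    proof (cases "\<exists>g d l k. k \<le> 2 * l + 2 \<and> fst p = \<iota> (vertex Ls g d l k)")
      case False
      then have "(p \<in> ?E f) = False" for f unfolding edges_def by fastforce
      then show ?thesis by simp
    next
      case True
      then obtain g d l k where g: "k \<le> 2 * l + 2" "fst p = \<iota> (vertex Ls g d l k)" by blast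
      \<comment> \<open>The first end of an edge determines the position of the edge, whatever the homeomorphism.\<close>
      have "p \<in> ?E f \<longleftrightarrow> \<iota> (vertex Ls f d l k) = fst p \<and> \<iota> (vertex Ls f (\<not> d) l k) = snd p" for f
      proof
        assume "p \<in> ?E f"
        then obtain d' l' k' where p: "k' \<le> 2 * l' + 2" "p = (\<iota> (vertex Ls f d' l' k'), \<iota> (vertex Ls f (\<not> d') l' k'))"
          unfolding edges_def by auto
        then have "vertex Ls g d l k = vertex Ls f d' l' k'" using g iota_inj by (simp add: inj_eq)
        from vertex_inj[OF this g(1) p(1)]
        show "\<iota> (vertex Ls f d l k) = fst p \<and> \<iota> (vertex Ls f (\<not> d) l k) = snd p" using p by simp
      next
        assume "\<iota> (vertex Ls f d l k) = fst p \<and> \<iota> (vertex Ls f (\<not> d) l k) = snd p"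
        then have "p = map_prod \<iota> \<iota> (vertex Ls f d l k, vertex Ls f (\<not> d) l k)" by (simp add: prod_eq_iff)
        then show "p \<in> ?E f" using g(1) unfolding edges_def by blast
      qed
      then show ?thesis
        by (simp only:) (intro locally_constant_comp2[where h = "(\<and>)"] locally_constant_comp[OF locally_constant_vertex])
    qed
  qed
  ultimately have "continuous_map minimal_space (prod_topology (vietoris cantor_space) (powerset_topology (Q_iota \<iota> \<times> Q_iota \<iota>))) (\<lambda>f. (?V f, ?E f))"
    by (rule continuous_map_pairedI)
  then have "continuous_map minimal_space (prod_topology (vietoris cantor_space) (powerset_topology (Q_iota \<iota> \<times> Q_iota \<iota>))) (graph_of \<iota> Ls Rs)"
    by (rule continuous_map_eq) (simp add: graph_of_eq)
  then show ?thesis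
    unfolding Sg_space_def continuous_map_in_subtopology using graph_of_Sg by auto
qed

end

lemma measurable_borel_of:
  assumes f: "continuous_map X Y f" shows "f \<in> measurable (borel_of X) (borel_of Y)"
proof -
  have X: "{U. openin X U} \<subseteq> Pow (topspace X)" and Y: "{U. openin Y U} \<subseteq> Pow (topspace Y)"
    using openin_subset by auto
  show ?thesis
    unfolding borel_of_def
  proof (rule measurable_sigma_sets)
    show "sets (sigma (topspace Y) {U. openin Y U}) = sigma_sets (topspace Y) {U. openin Y U}"
      using Y by (simp add: sets_measure_of)
    show "f \<in> space (sigma (topspace X) {U. openin X U}) \<rightarrow> topspace Y"
      using f X by (auto simp: continuous_map_def space_measure_of)
    fix U assume "U \<in> {U. openin Y U}"
    then have "openin X {x \<in> topspace X. f x \<in> U}" using openin_continuous_map_preimage[OF f] by simp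
    moreover have "f -` U \<inter> space (sigma (topspace X) {U. openin X U}) = {x \<in> topspace X. f x \<in> U}"
      using X by (auto simp: space_measure_of)
    ultimately show "f -` U \<inter> space (sigma (topspace X) {U. openin X U}) \<in> sets (sigma (topspace X) {U. openin X U})"
      using X by (simp add: sets_measure_of sigma_sets.Basic)
  qed (rule Y)
qed

section \<open>Limits of edges\<close>

text \<open>
  The closure of the edge relation. Between limit points it is a closed graph that remembers the
  homeomorphism up to inversion, and it is preserved by continuous homomorphisms.
\<close>
definition limit_edge :: "(nat \<Rightarrow> int) \<Rightarrow> (cantor \<Rightarrow> cantor) \<Rightarrow> (nat \<Rightarrow> letter) \<Rightarrow> (nat \<Rightarrow> letter) \<Rightarrow> bool" where
  "limit_edge Ls f x y \<longleftrightarrow> (\<forall>m. \<exists>(u, v)\<in>edges Ls f. agree m x u \<and> agree m y v)"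

lemma limit_edge_sym: "limit_edge Ls f x y \<Longrightarrow> limit_edge Ls f y x"
  unfolding limit_edge_def using edges_sym by fastforce

text \<open>
  Edges with one end close to a limit point have large level, so a limit edge is approximated
  by edges of arbitrarily large level.
\<close>
lemma limit_edge_far:
  assumes "limit_edge Ls f x y" "x \<in> limit_set"
  obtains d l k where "N \<le> l" "k \<le> 2 * l + 2" "agree n x (vertex Ls f d l k)" "agree n y (vertex Ls f (\<not> d) l k)"
proof -
  obtain u v where uv: "(u, v) \<in> edges Ls f" "agree (Suc (max N n)) x u" "agree (Suc (max N n)) y v"
    using assms(1) unfolding limit_edge_def by blast
  then obtain d l k where e: "u = vertex Ls f d l k" "v = vertex Ls f (\<not> d) l k" "k \<le> 2 * l + 2"
    unfolding edges_def by blast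
  have "max N n \<le> l" using agree_limit_vertex[OF assms(2)] uv(2) e(1) by blast
  then show ?thesis
    using that[of l k d] e agree_mono[OF uv(2), of n] agree_mono[OF uv(3), of n] by simp
qed

lemma agree_vertexI: "agree n x (base Ls f d l k) \<Longrightarrow> n \<le> Suc l \<Longrightarrow> agree n x (vertex Ls f d l k)"
  by (rule agree_trans[OF _ agree_sym[OF agree_mono[OF agree_vertex_base]]])

lemma agree_baseI: "agree n x (vertex Ls f d l k) \<Longrightarrow> n \<le> Suc l \<Longrightarrow> agree n x (base Ls f d l k)"
  by (rule agree_trans[OF _ agree_mono[OF agree_vertex_base]])

lemma edgeI: "k \<le> 2 * l + 2 \<Longrightarrow> (vertex Ls f d l k, vertex Ls f (\<not> d) l k) \<in> edges Ls f"
  unfolding edges_def by blast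

lemma cinf_not_emb: "cinf \<noteq> emb x"
  by (metis cinf_def emb_ab(3))

lemma limit_edge_orbit:
  assumes f: "f \<in> minimal_homeos" and Ls: "\<And>z n. \<exists>l\<ge>n. Ls l = z"
  shows "limit_edge Ls f (emb x) (emb (f x))"
  unfolding limit_edge_def
proof
  fix m
  have hom: "f \<in> homeos" using f by (rule minimal_homeos_homeos)
  obtain m' where m': "\<And>y. agree m' x y \<Longrightarrow> agree m (f x) (f y)"
    using continuous_agree[OF homeos_continuous[OF hom]] by blast
  obtain i where i: "agree (max m m') x (iterate f i zero)" using minimal_dense[OF f] by blast
  obtain l where l: "m \<le> l" "Ls l = i" using Ls by blast
  have b: "base Ls f True l 1 = emb (iterate f i zero)" "base Ls f False l 1 = emb (f (iterate f i zero))"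
    using l(2) iterate_succ[OF homeos_bij[OF hom], of i] by (simp_all add: base_def)
  have "agree m (emb x) (vertex Ls f True l 1)"
    by (rule agree_vertexI) (use agree_mono[OF i, of m] l(1) b(1) in simp_all)
  moreover have "agree m (emb (f x)) (vertex Ls f False l 1)"
    by (rule agree_vertexI) (use m' agree_mono[OF i, of m'] l(1) b(2) in simp_all)
  ultimately show "\<exists>(u, v)\<in>edges Ls f. agree m (emb x) u \<and> agree m (emb (f x)) v"
    using edgeI[of 1 l Ls f True] by auto
qed

text \<open>
  The first edges of the levels join \<open>c\<^sup>\<infinity>\<close> to the points with indices \<open>L\<^sub>l\<close>, which exhaust
  the dense orbit.
\<close>
lemma limit_edge_cinf:
  assumes f: "f \<in> minimal_homeos" and Ls: "\<And>z n. \<exists>l\<ge>n. Ls l = z"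
  shows "limit_edge Ls f cinf (emb x)"
  unfolding limit_edge_def
proof
  fix m
  obtain i where i: "agree m x (iterate f i zero)" using minimal_dense[OF f] by blast
  obtain l where l: "m \<le> l" "Ls l = i" using Ls by blast
  have b: "base Ls f True l 0 = cinf" "base Ls f False l 0 = emb (iterate f i zero)"
    using l(2) by (simp_all add: base_def)
  have "agree m cinf (vertex Ls f True l 0)"
    by (rule agree_vertexI) (use l(1) b(1) in simp_all)
  moreover have "agree m (emb x) (vertex Ls f False l 0)"
    by (rule agree_vertexI) (use i l(1) b(2) in simp_all)
  ultimately show "\<exists>(u, v)\<in>edges Ls f. agree m cinf u \<and> agree m (emb x) v"
    using edgeI[of 0 l Ls f True] by auto
qed

text \<open>
  Between points of Cantor space there are no limit edges besides those on the graph of the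
  homeomorphism, because close to such points an edge joins consecutive points of one orbit.
\<close>
lemma limit_edge_emb:
  assumes f: "f \<in> homeos" and xy: "limit_edge Ls f (emb x) (emb y)"
  shows "y = f x \<or> x = f y"
proof (rule ccontr)
  assume no: "\<not> ?thesis"
  then obtain n1 n2 where n: "\<not> agree n1 y (f x)" "\<not> agree n2 x (f y)" using eq_if_agree by metis
  obtain m1 where m1: "\<And>z. agree m1 x z \<Longrightarrow> agree n1 (f x) (f z)"
    using continuous_agree[OF homeos_continuous[OF f]] by blast
  obtain m2 where m2: "\<And>z. agree m2 y z \<Longrightarrow> agree n2 (f y) (f z)"
    using continuous_agree[OF homeos_continuous[OF f]] by blast
  define M where "M = Suc (n1 + n2 + m1 + m2)"
  obtain d l k where e: "M \<le> l" "k \<le> 2 * l + 2" "agree M (emb x) (vertex Ls f d l k)"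
    "agree M (emb y) (vertex Ls f (\<not> d) l k)"
    by (rule limit_edge_far[OF xy, of M M]) (simp add: limit_set_def)
  have bx: "agree M (emb x) (base Ls f d l k)"
    by (rule agree_baseI[OF e(3)]) (use e(1) in simp)
  have bv: "agree M (emb y) (base Ls f (\<not> d) l k)"
    by (rule agree_baseI[OF e(4)]) (use e(1) in simp)
  have no_cinf: "\<not> agree M (emb z) cinf" for z
    using emb_ab(3)[of z 0] by (auto simp: agree_def M_def cinf_def)
  define o1 where "o1 = iterate f (Ls l + int k - 1) zero"
  define o2 where "o2 = iterate f (Ls l + int k) zero"
  have o: "o2 = f o1"
    unfolding o1_def o2_def using iterate_succ[OF homeos_bij[OF f], of "Ls l + int k - 1" zero] by simp
  have T: "base Ls f True l k = cinf \<or> base Ls f True l k = emb o1"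
    and F: "base Ls f False l k = cinf \<or> base Ls f False l k = emb o2"
    by (simp_all add: base_def o1_def o2_def)
  show False
  proof (cases d)
    case True
    then have "agree M x o1" "agree M y o2" using bx bv T F no_cinf by (metis agree_emb)+
    then have "agree m1 x o1" "agree n1 y (f o1)" using o by (auto simp: M_def elim!: agree_mono)
    then show False using m1 n(1) agree_trans agree_sym by blast
  next
    case False
    then have "agree M x o2" "agree M y o1" using bx bv T F no_cinf by (metis agree_emb)+
    then have "agree m2 y o1" "agree n2 x (f o1)" using o by (auto simp: M_def elim!: agree_mono)
    then show False using m2 n(2) agree_trans agree_sym by blast
  qed
qed

section \<open>From flip-conjugacy to an injective continuous homomorphism\<close>

abbreviation vertex_hull :: "(nat \<Rightarrow> int) \<Rightarrow> (cantor \<Rightarrow> cantor) \<Rightarrow> (nat \<Rightarrow> letter) set" where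
  "vertex_hull Ls f \<equiv> vertices Ls f \<union> limit_set"

text \<open>
  The extension of a self-map of Cantor space to the limit set that fixes \<open>c\<^sup>\<infinity>\<close>.
\<close>
definition extend :: "(cantor \<Rightarrow> cantor) \<Rightarrow> (nat \<Rightarrow> letter) \<Rightarrow> nat \<Rightarrow> letter" where
  "extend \<phi> u = (if u = cinf then cinf else emb (\<phi> (inv emb u)))"

lemma extend_cinf [simp]: "extend \<phi> cinf = cinf"
  by (simp add: extend_def)

lemma extend_emb [simp]: "extend \<phi> (emb x) = emb (\<phi> x)"
  using cinf_not_emb[of x] by (simp add: extend_def inv_f_f[OF inj_emb])

lemma extend_limit_set: "u \<in> limit_set \<Longrightarrow> extend \<phi> u \<in> limit_set"
  by (auto simp: limit_set_def)

lemma extend_inj: "inj \<phi> \<Longrightarrow> inj_on (extend \<phi>) limit_set"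
  by (auto simp: inj_on_def limit_set_def inj_eq[OF inj_emb] cinf_not_emb cinf_not_emb[symmetric])

lemma extend_continuous:
  assumes \<phi>: "continuous_map cantor_space cantor_space \<phi>" and u: "u \<in> limit_set"
  shows "\<exists>m. \<forall>v\<in>limit_set. agree m u v \<longrightarrow> agree n (extend \<phi> u) (extend \<phi> v)"
proof (cases "u = cinf")
  case True
  have "v = cinf" if "v \<in> limit_set" "agree 1 u v" for v
    using that True by (auto simp: limit_set_def agree_def cinf_def emb_ab emb_ab[symmetric])
  then show ?thesis by (metis agree_refl True)
next
  case False
  then obtain z where z: "u = emb z" using u unfolding limit_set_def by blast
  obtain m where m: "\<And>y. agree m z y \<Longrightarrow> agree n (\<phi> z) (\<phi> y)" using continuous_agree[OF \<phi>] by blast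
  have "agree n (extend \<phi> u) (extend \<phi> v)" if v: "v \<in> limit_set" "agree (Suc m) u v" for v
  proof -
    have "v \<noteq> cinf" using v(2) emb_ab(3)[of z 0] by (auto simp: z agree_def cinf_def)
    then obtain y where y: "v = emb y" using v(1) unfolding limit_set_def by blast
    have "agree m z y" using agree_mono[OF v(2), of m] by (simp add: z y)
    then show ?thesis using m by (simp add: z y)
  qed
  then show ?thesis by blast
qed

text \<open>
  Edges of \<open>f\<close> are sent injectively to edges of \<open>g\<close> that approximate the image, under the
  conjugating map, of the pair of limit points that they approximate themselves. The
  approximation improves with the level, which makes the map continuous at limit points; all other
  points are isolated.
\<close>
lemma homomorphism_if_conjugate:
  assumes f: "f \<in> minimal_homeos" and g: "g \<in> minimal_homeos" and Ls: "\<And>z n. \<exists>l\<ge>n. Ls l = z"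
    and \<phi>: "\<phi> \<in> homeos" and conj: "\<phi> \<circ> f = g \<circ> \<phi> \<or> \<phi> \<circ> f = inv g \<circ> \<phi>"
  obtains \<psi> where "continuous_map (subtopology K_space (vertex_hull Ls f)) (subtopology K_space (vertex_hull Ls g)) \<psi>"
    "inj_on \<psi> (vertex_hull Ls f)" "\<And>x y. (x, y) \<in> edges Ls f \<Longrightarrow> (\<psi> x, \<psi> y) \<in> edges Ls g"
proof -
  let ?\<sigma> = "extend \<phi>"
  have fh: "f \<in> homeos" and gh: "g \<in> homeos" using f g minimal_homeos_homeos by auto
  have orbit: "limit_edge Ls g (emb (\<phi> x)) (emb (\<phi> (f x)))" for x
    using conj
  proof
    assume "\<phi> \<circ> f = g \<circ> \<phi>"
    then have "\<phi> (f x) = g (\<phi> x)" by (metis comp_apply)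
    then show ?thesis using limit_edge_orbit[OF g Ls] by simp
  next
    assume "\<phi> \<circ> f = inv g \<circ> \<phi>"
    then have "\<phi> x = g (\<phi> (f x))"
      using surj_f_inv_f[OF bij_is_surj[OF homeos_bij[OF gh]]] by (metis comp_apply)
    then show ?thesis using limit_edge_sym[OF limit_edge_orbit[OF g Ls]] by metis
  qed
  have target: "limit_edge Ls g (?\<sigma> (base Ls f True l k)) (?\<sigma> (base Ls f False l k))" for l k
  proof -
    have "limit_edge Ls g (emb (\<phi> (iterate f (Ls l + int k - 1) zero))) (emb (\<phi> (iterate f (Ls l + int k) zero)))"
      using orbit iterate_succ[OF homeos_bij[OF fh], of "Ls l + int k - 1" zero] by simp
    then show ?thesis
      using limit_edge_cinf[OF g Ls] limit_edge_sym[OF limit_edge_cinf[OF g Ls]] by (simp add: base_def)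
  qed
  \<comment> \<open>The pair \<open>(l, k)\<close> coded by \<open>i\<close> stands for the \<open>k\<close>-th edge of level \<open>l\<close>, and \<open>q\<close> for an edge of the
    second graph with the direction in which it is to be traversed. The condition can also be met
    when \<open>k > 2l + 2\<close> and there is no such edge, so that all \<open>i\<close> can be treated alike.\<close>
  define near where "near i q \<longleftrightarrow> (case prod_decode i of (l, k) \<Rightarrow> case q of (d', l', k') \<Rightarrow>
      k' \<le> 2 * l' + 2 \<and> agree l (?\<sigma> (base Ls f True l k)) (vertex Ls g d' l' k')
      \<and> agree l (?\<sigma> (base Ls f False l k)) (vertex Ls g (\<not> d') l' k'))" for i and q :: "bool \<times> nat \<times> nat"
  have near_ex: "\<exists>q. near i q \<and> N \<le> fst (snd q)" for i N
  proof -
    obtain l k where lk: "prod_decode i = (l, k)" by fastforce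
    obtain d' l' k' where "N \<le> l'" "k' \<le> 2 * l' + 2" "agree l (?\<sigma> (base Ls f True l k)) (vertex Ls g d' l' k')"
      "agree l (?\<sigma> (base Ls f False l k)) (vertex Ls g (\<not> d') l' k')"
      using limit_edge_far[OF target extend_limit_set[OF base_limit_set]] by metis
    then show ?thesis by (intro exI[of _ "(d', l', k')"]) (simp add: near_def lk)
  qed
  \<comment> \<open>Strictly increasing levels make the choice injective.\<close>
  have "\<exists>t. \<forall>i. near i (t i) \<and> fst (snd (t i)) < fst (snd (t (Suc i)))"
  proof (rule dependent_nat_choice)
    show "\<exists>q. near 0 q" using near_ex by blast
    show "\<exists>q'. near (Suc i) q' \<and> fst (snd q) < fst (snd q')" for i q
      using near_ex[of "Suc i" "Suc (fst (snd q))"] by (simp add: Suc_le_eq)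
  qed
  then obtain t where t: "\<And>i. near i (t i)" "\<And>i. fst (snd (t i)) < fst (snd (t (Suc i)))" by blast
  have mono: "strict_mono (\<lambda>i. fst (snd (t i)))" using t(2) by (simp add: strict_mono_Suc_iff)
  define \<Psi> where "\<Psi> d l k = (case t (prod_encode (l, k)) of (d', l', k') \<Rightarrow> vertex Ls g (d = d') l' k')" for d l k
  have \<Psi>_near: "agree l (?\<sigma> (base Ls f d l k)) (\<Psi> d l k)" for d l k
    using t(1)[of "prod_encode (l, k)"] by (cases d) (auto simp: near_def \<Psi>_def split: prod.splits)
  have \<Psi>_edge: "(\<Psi> d l k, \<Psi> (\<not> d) l k) \<in> edges Ls g" for d l k
  proof -
    obtain d' l' k' where q: "t (prod_encode (l, k)) = (d', l', k')" by (metis prod_cases3)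
    have "k' \<le> 2 * l' + 2" using t(1)[of "prod_encode (l, k)"] by (simp add: near_def q)
    then have "(vertex Ls g (d = d') l' k', vertex Ls g (\<not> (d = d')) l' k') \<in> edges Ls g" by (rule edgeI)
    moreover have "((\<not> d) = d') = (\<not> (d = d'))" by auto
    ultimately show ?thesis by (simp add: \<Psi>_def q)
  qed
  have \<Psi>_inj: "d1 = d2 \<and> l1 = l2 \<and> k1 = k2" if eq: "\<Psi> d1 l1 k1 = \<Psi> d2 l2 k2" for d1 l1 k1 d2 l2 k2
  proof -
    obtain a1 b1 c1 where q1: "t (prod_encode (l1, k1)) = (a1, b1, c1)" by (metis prod_cases3)
    obtain a2 b2 c2 where q2: "t (prod_encode (l2, k2)) = (a2, b2, c2)" by (metis prod_cases3)
    have k: "c1 \<le> 2 * b1 + 2" "c2 \<le> 2 * b2 + 2"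
      using t(1)[of "prod_encode (l1, k1)"] t(1)[of "prod_encode (l2, k2)"] by (simp_all add: near_def q1 q2)
    have *: "b2 = b1 \<and> (d2 = a2) = (d1 = a1) \<and> c2 = c1"
      by (rule vertex_inj[OF _ k]) (use eq in \<open>simp add: \<Psi>_def q1 q2\<close>)
    then have "prod_encode (l1, k1) = prod_encode (l2, k2)"
      using strict_mono_eq[OF mono] q1 q2 by (metis fst_conv snd_conv)
    then have "l1 = l2" "k1 = k2" by simp_all
    then show ?thesis using * q1 q2 by auto
  qed
  define pos where "pos x = (SOME q. case q of (d, l, k) \<Rightarrow> k \<le> 2 * l + 2 \<and> x = vertex Ls f d l k)" for x
  have pos: "pos (vertex Ls f d l k) = (d, l, k)" if "k \<le> 2 * l + 2" for d l k
    unfolding pos_def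
  proof (rule some_equality)
    show "case (d, l, k) of (da, la, ka) \<Rightarrow> ka \<le> 2 * la + 2 \<and> vertex Ls f d l k = vertex Ls f da la ka"
      using that by simp
    show "q = (d, l, k)" if "case q of (da, la, ka) \<Rightarrow> ka \<le> 2 * la + 2 \<and> vertex Ls f d l k = vertex Ls f da la ka" for q
    proof -
      obtain da la ka where q: "q = (da, la, ka)" by (metis prod_cases3)
      then have "vertex Ls f d l k = vertex Ls f da la ka" "ka \<le> 2 * la + 2" using that by auto
      from vertex_inj[OF this(1) \<open>k \<le> 2 * l + 2\<close> this(2)] show ?thesis using q by simp
    qed
  qed
  define \<psi> where "\<psi> x = (if x \<in> limit_set then ?\<sigma> x else case pos x of (d, l, k) \<Rightarrow> \<Psi> d l k)" for x
  have \<psi>_vertex: "\<psi> (vertex Ls f d l k) = \<Psi> d l k" if "k \<le> 2 * l + 2" for d l k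
    using that vertices_limit_set_disjoint by (simp add: \<psi>_def pos)
  have \<psi>_limit: "\<psi> x = ?\<sigma> x" if "x \<in> limit_set" for x using that by (simp add: \<psi>_def)
  have \<Psi>_vertices: "\<Psi> d l k \<in> vertices Ls g" for d l k using \<Psi>_edge edges_vertices by blast
  have cont: "continuous_map (subtopology K_space (vertex_hull Ls f)) (subtopology K_space (vertex_hull Ls g)) \<psi>"
    unfolding continuous_map_seq_space
  proof (intro conjI ballI allI)
    show "\<psi> ` vertex_hull Ls f \<subseteq> vertex_hull Ls g"
    proof safe
      fix x assume "x \<in> vertices Ls f" "\<psi> x \<notin> limit_set"
      then show "\<psi> x \<in> vertices Ls g" using \<psi>_vertex \<Psi>_vertices unfolding vertices_def by fastforce
    next
      fix x assume "x \<in> limit_set" "\<psi> x \<notin> limit_set"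
      then show "\<psi> x \<in> vertices Ls g" using \<psi>_limit extend_limit_set by metis
    qed
    fix x n assume "x \<in> vertex_hull Ls f"
    then show "\<exists>m. \<forall>y\<in>vertex_hull Ls f. agree m x y \<longrightarrow> agree n (\<psi> x) (\<psi> y)"
    proof
      assume "x \<in> vertices Ls f"
      then obtain d l k where x: "x = vertex Ls f d l k" "k \<le> 2 * l + 2" unfolding vertices_def by blast
      then have "y = x" if "y \<in> vertex_hull Ls f" "agree (l + spike_length d l k + 2) x y" for y
        using vertex_isolated[OF x(2) that(1)] that(2) by blast
      then show ?thesis by (metis agree_refl)
    next
      assume x: "x \<in> limit_set"
      obtain m where m: "\<And>y. y \<in> limit_set \<Longrightarrow> agree m x y \<Longrightarrow> agree n (?\<sigma> x) (?\<sigma> y)"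
        using extend_continuous[OF homeos_continuous[OF \<phi>] x] by blast
      have "agree n (\<psi> x) (\<psi> y)" if y: "y \<in> vertex_hull Ls f" and xy: "agree (Suc (max m n)) x y" for y
        using y
      proof
        assume "y \<in> limit_set"
        then show ?thesis using m x \<psi>_limit agree_mono[OF xy, of m] by simp
      next
        assume "y \<in> vertices Ls f"
        then obtain d l k where v: "y = vertex Ls f d l k" "k \<le> 2 * l + 2" unfolding vertices_def by blast
        have l: "max m n \<le> l" using agree_limit_vertex[OF x] xy v(1) by blast
        have "agree m x (base Ls f d l k)"
          using agree_mono[OF xy, of m] l unfolding v(1) by (intro agree_baseI) simp_all
        then have "agree n (?\<sigma> x) (?\<sigma> (base Ls f d l k))" by (rule m[OF base_limit_set])
        moreover have "agree n (?\<sigma> (base Ls f d l k)) (\<Psi> d l k)" using agree_mono[OF \<Psi>_near] l by simp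
        ultimately show ?thesis using \<psi>_limit[OF x] \<psi>_vertex[OF v(2)] v(1) agree_trans by metis
      qed
      then show ?thesis by blast
    qed
  qed
  moreover have "inj_on \<psi> (vertex_hull Ls f)"
  proof (rule inj_onI)
    have disj: "\<psi> x \<noteq> \<psi> y" if "x \<in> vertices Ls f" "y \<in> limit_set" for x y
    proof -
      have "\<psi> x \<in> vertices Ls g" using that(1) \<psi>_vertex \<Psi>_vertices unfolding vertices_def by fastforce
      moreover have "\<psi> y \<in> limit_set" using that(2) \<psi>_limit extend_limit_set by metis
      ultimately show ?thesis using vertices_limit_set_disjoint unfolding vertices_def by force
    qed
    fix x y assume xy: "x \<in> vertex_hull Ls f" "y \<in> vertex_hull Ls f" and eq: "\<psi> x = \<psi> y"
    from xy disj eq consider "x \<in> vertices Ls f" "y \<in> vertices Ls f" | "x \<in> limit_set" "y \<in> limit_set" by fastforce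
    then show "x = y"
    proof cases
      case 1
      then obtain d l k d' l' k' where v: "x = vertex Ls f d l k" "k \<le> 2 * l + 2"
          "y = vertex Ls f d' l' k'" "k' \<le> 2 * l' + 2"
        unfolding vertices_def by blast
      then have "\<Psi> d l k = \<Psi> d' l' k'" using eq by (simp only: \<psi>_vertex)
      from \<Psi>_inj[OF this] show ?thesis using v by simp
    next
      case 2
      then show ?thesis
        using eq \<psi>_limit inj_onD[OF extend_inj[OF bij_is_inj[OF homeos_bij[OF \<phi>]]]] by metis
    qed
  qed
  moreover have "(\<psi> x, \<psi> y) \<in> edges Ls g" if "(x, y) \<in> edges Ls f" for x y
    using that \<Psi>_edge \<psi>_vertex unfolding edges_def[of Ls f] by auto
  ultimately show ?thesis using that by blast
qed

section \<open>From a homomorphism back to flip-conjugacy\<close>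

text \<open>
  Limit points go to limit points because they are not isolated and the map is injective; limit
  edges go to limit edges by continuity. The point \<open>c\<^sup>\<infinity>\<close> is the only limit point on
  infinitely many limit edges, so it is fixed, and Cantor space is mapped into itself in such a
  way that \<open>f\<close>-consecutive points become \<open>g\<close>-consecutive, in one order or the other. The points
  where a given order occurs form a closed invariant set, and minimality of \<open>f\<close> makes the order
  constant; minimality of \<open>g\<close> makes the map surjective.
\<close>
lemma conjugate_if_homomorphism:
  assumes f: "f \<in> minimal_homeos" and g: "g \<in> minimal_homeos" and Ls: "\<And>z n. \<exists>l\<ge>n. Ls l = z"
    and cont: "continuous_map (subtopology K_space (vertex_hull Ls f)) (subtopology K_space (vertex_hull Ls g)) \<psi>"
    and inj: "inj_on \<psi> (vertex_hull Ls f)"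
    and hom: "\<And>x y. (x, y) \<in> edges Ls f \<Longrightarrow> (\<psi> x, \<psi> y) \<in> edges Ls g"
  shows "\<exists>\<phi>\<in>homeos. \<phi> \<circ> f = g \<circ> \<phi> \<or> \<phi> \<circ> f = inv g \<circ> \<phi>"
proof -
  have fh: "f \<in> homeos" and gh: "g \<in> homeos" using f g minimal_homeos_homeos by auto
  have ginj: "inj g" and gsurj: "surj g" and fsurj: "surj f"
    using homeos_bij[OF gh] homeos_bij[OF fh] by (auto simp: bij_def)
  have im: "\<psi> x \<in> vertex_hull Ls g" if "x \<in> vertex_hull Ls f" for x
    using cont that by (auto simp: continuous_map_seq_space)
  have mod: "\<exists>m. \<forall>y\<in>vertex_hull Ls f. agree m x y \<longrightarrow> agree n (\<psi> x) (\<psi> y)" if "x \<in> vertex_hull Ls f" for x n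
    using cont that unfolding continuous_map_seq_space by blast
  have emb_limit: "emb x \<in> limit_set" and cinf_limit: "cinf \<in> limit_set" for x
    by (auto simp: limit_set_def)
  have limit_limit_edge: "\<exists>y. limit_edge Ls f x y" if "x \<in> limit_set" for x
    using that limit_edge_cinf[OF f Ls] limit_edge_sym unfolding limit_set_def by blast
  have limit: "\<psi> x \<in> limit_set" if x: "x \<in> limit_set" for x
  proof (rule ccontr)
    assume "\<psi> x \<notin> limit_set"
    then obtain d l k where v: "\<psi> x = vertex Ls g d l k" "k \<le> 2 * l + 2"
      using im[of x] x unfolding vertices_def by blast
    obtain m where m: "\<And>y. y \<in> vertex_hull Ls f \<Longrightarrow> agree m x y \<Longrightarrow> agree (l + spike_length d l k + 2) (\<psi> x) (\<psi> y)"
      using mod[of x] x by blast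
    obtain y where "limit_edge Ls f x y" using limit_limit_edge[OF x] by blast
    then obtain u w where u: "(u, w) \<in> edges Ls f" "agree m x u" unfolding limit_edge_def by blast
    then have uV: "u \<in> vertices Ls f" using edges_vertices by blast
    have "\<psi> u = \<psi> x"
      using vertex_isolated[OF v(2), of "\<psi> u" Ls g d] m[of u] im[of u] uV u(2) v(1) by simp
    then have "u = x" using inj_onD[OF inj] uV x by blast
    then show False using uV x vertices_limit_set_disjoint unfolding vertices_def by blast
  qed
  have limit_edge: "limit_edge Ls g (\<psi> x) (\<psi> y)"
    if xy: "limit_edge Ls f x y" and x: "x \<in> limit_set" and y: "y \<in> limit_set" for x y
    unfolding limit_edge_def
  proof
    fix n
    obtain m1 where m1: "\<And>z. z \<in> vertex_hull Ls f \<Longrightarrow> agree m1 x z \<Longrightarrow> agree n (\<psi> x) (\<psi> z)"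
      using mod[of x] x by blast
    obtain m2 where m2: "\<And>z. z \<in> vertex_hull Ls f \<Longrightarrow> agree m2 y z \<Longrightarrow> agree n (\<psi> y) (\<psi> z)"
      using mod[of y] y by blast
    obtain u v where uv: "(u, v) \<in> edges Ls f" "agree (max m1 m2) x u" "agree (max m1 m2) y v"
      using xy unfolding limit_edge_def by blast
    have "agree n (\<psi> x) (\<psi> u)" "agree n (\<psi> y) (\<psi> v)"
      using m1[of u] m2[of v] edges_vertices[OF uv(1)] agree_mono[OF uv(2), of m1] agree_mono[OF uv(3), of m2] by simp_all
    then show "\<exists>(u, v)\<in>edges Ls g. agree n (\<psi> x) u \<and> agree n (\<psi> y) v" using hom[OF uv(1)] by blast
  qed
  have \<psi>_cinf: "\<psi> cinf = cinf"
  proof (rule ccontr)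
    assume "\<psi> cinf \<noteq> cinf"
    then obtain z where z: "\<psi> cinf = emb z" using limit[OF cinf_limit] unfolding limit_set_def by blast
    have "\<psi> (emb x) \<in> {cinf, emb (g z), emb (inv g z)}" for x
    proof (cases "\<psi> (emb x) = cinf")
      case False
      then obtain y where y: "\<psi> (emb x) = emb y" using limit[OF emb_limit] unfolding limit_set_def by blast
      have "limit_edge Ls g (emb z) (emb y)"
        using limit_edge[OF limit_edge_cinf[OF f Ls] cinf_limit emb_limit, of x] by (simp add: z y)
      then have "y = g z \<or> z = g y" by (rule limit_edge_emb[OF gh])
      then show ?thesis using inv_f_f[OF ginj] y by auto
    qed simp
    then have "range (\<lambda>x. \<psi> (emb x)) \<subseteq> {cinf, emb (g z), emb (inv g z)}" by (rule image_subsetI)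
    then have "finite (range (\<lambda>x. \<psi> (emb x)))" by (rule finite_subset) simp
    moreover have "inj (\<lambda>x. \<psi> (emb x))"
    proof (rule injI)
      fix x y assume eq: "\<psi> (emb x) = \<psi> (emb y)"
      have "emb x = emb y" by (rule inj_onD[OF inj, OF eq]) (simp_all add: emb_limit)
      then show "x = y" by (rule injD[OF inj_emb])
    qed
    ultimately show False using infinite_cantor finite_imageD[of "\<lambda>x. \<psi> (emb x)" UNIV] by simp
  qed
  have range_emb: "\<psi> (emb x) \<in> range emb" for x
  proof -
    have "emb x \<noteq> cinf" using cinf_not_emb[of x] by simp
    then have "\<psi> (emb x) \<noteq> cinf"
      using inj_on_eq_iff[OF inj, of "emb x" cinf] by (simp add: \<psi>_cinf emb_limit cinf_limit)
    then show ?thesis using limit[OF emb_limit, of x] unfolding limit_set_def by blast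
  qed
  define \<theta> where "\<theta> x = inv emb (\<psi> (emb x))" for x
  have \<theta>: "\<psi> (emb x) = emb (\<theta> x)" for x
    using f_inv_into_f[OF range_emb] by (simp add: \<theta>_def)
  have \<theta>_inj: "inj \<theta>"
  proof (rule injI)
    fix x y assume "\<theta> x = \<theta> y"
    then have "emb x = emb y" using inj_onD[OF inj, of "emb x" "emb y"] emb_limit \<theta> by simp
    then show "x = y" by (rule injD[OF inj_emb])
  qed
  have \<theta>_cont: "continuous_map cantor_space cantor_space \<theta>"
  proof -
    have "\<exists>m. \<forall>y. agree m x y \<longrightarrow> agree n (\<theta> x) (\<theta> y)" for x n
    proof -
      obtain m where "\<forall>y\<in>vertex_hull Ls f. agree m (emb x) y \<longrightarrow> agree n (\<psi> (emb x)) (\<psi> y)"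
        using mod[of "emb x" n] emb_limit by auto
      then have "agree n (\<theta> x) (\<theta> y)" if "agree m x y" for y
        using that emb_limit[of y] \<theta> by (metis UnI2 agree_emb)
      then show ?thesis by blast
    qed
    then have "continuous_map (subtopology cantor_space UNIV) (subtopology cantor_space UNIV) \<theta>"
      unfolding continuous_map_seq_space by simp
    then show ?thesis by simp
  qed
  have step: "\<theta> (f x) = g (\<theta> x) \<or> \<theta> x = g (\<theta> (f x))" for x
    using limit_edge[OF limit_edge_orbit[OF f Ls] emb_limit emb_limit, of x] limit_edge_emb[OF gh] by (simp add: \<theta>)
  \<comment> \<open>A point of both sets would be mapped to a point of period two of \<open>g\<close>; a point of one set with
    image under \<open>f\<close> in the other would itself have period two under \<open>f\<close>.\<close>
  define A where "A = {x. \<theta> (f x) = g (\<theta> x)}"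
  define B where "B = {x. \<theta> x = g (\<theta> (f x))}"
  have cf: "continuous_map cantor_space cantor_space (\<lambda>x. \<theta> (f x))"
    using continuous_map_compose[OF homeos_continuous[OF fh] \<theta>_cont] by (simp add: o_def)
  have cg: "continuous_map cantor_space cantor_space (\<lambda>x. g (h x))" if "continuous_map cantor_space cantor_space h" for h
    using continuous_map_compose[OF that homeos_continuous[OF gh]] by (simp add: o_def)
  have closed: "closedin cantor_space A" "closedin cantor_space B"
    using closedin_continuous_maps_eq[OF Hausdorff_seq_space cf cg[OF \<theta>_cont]]
      closedin_continuous_maps_eq[OF Hausdorff_seq_space \<theta>_cont cg[OF cf]]
    by (simp_all add: A_def B_def)
  have disj: "\<not> (x \<in> A \<and> x \<in> B)" for x
    using minimal_no_period_2[OF g, of "\<theta> x"] by (auto simp: A_def B_def)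
  have AB: "x \<in> A \<or> x \<in> B" for x using step by (simp add: A_def B_def)
  have sep: "\<not> (x \<in> A \<and> f x \<in> B)" "\<not> (x \<in> B \<and> f x \<in> A)" for x
    using minimal_no_period_2[OF f, of x] injD[OF ginj, of "\<theta> x" "\<theta> (f (f x))"] injD[OF \<theta>_inj, of x "f (f x)"]
    by (auto simp: A_def B_def)
  have inv: "x \<in> A \<longleftrightarrow> f x \<in> A" "x \<in> B \<longleftrightarrow> f x \<in> B" for x
    using AB[of x] AB[of "f x"] sep[of x] by blast+
  have AB_UNIV: "A = UNIV \<or> B = UNIV"
    using AB[of zero] minimal_invariant[OF f closed(1) _ inv(1)] minimal_invariant[OF f closed(2) _ inv(2)] by blast
  have conj: "\<theta> \<circ> f = g \<circ> \<theta> \<or> \<theta> \<circ> f = inv g \<circ> \<theta>"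
  proof -
    have "\<theta> \<circ> f = g \<circ> \<theta>" if "A = UNIV" using that unfolding A_def by (auto simp: fun_eq_iff)
    moreover have "\<theta> \<circ> f = inv g \<circ> \<theta>" if "B = UNIV"
    proof
      fix x
      have "\<theta> x = g (\<theta> (f x))" using that unfolding B_def by blast
      then show "(\<theta> \<circ> f) x = (inv g \<circ> \<theta>) x" using inv_f_f[OF ginj] by simp
    qed
    ultimately show ?thesis using AB_UNIV by blast
  qed
  have "range \<theta> = UNIV"
  proof (rule minimal_invariant[OF g, of _ "\<theta> zero"])
    show "closedin cantor_space (range \<theta>)"
      using image_compactin[OF _ \<theta>_cont, of UNIV] compact_cantor_space compactin_cantor_iff
      by (simp add: compact_space_def)
    have shift: "range (\<lambda>x. \<theta> (f x)) = range \<theta>"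
      using fsurj image_image[of \<theta> f UNIV] by simp
    have "range (\<lambda>x. g (\<theta> x)) = range \<theta>"
      using AB_UNIV
    proof
      assume "A = UNIV"
      then have "x \<in> A" for x by simp
      then have eq: "(\<lambda>x. \<theta> (f x)) = (\<lambda>x. g (\<theta> x))" by (simp add: A_def)
      show ?thesis using shift unfolding eq .
    next
      assume "B = UNIV"
      then have "x \<in> B" for x by simp
      then have "\<theta> x = g (\<theta> (f x))" for x unfolding B_def mem_Collect_eq .
      then have "\<theta> = (\<lambda>x. g (\<theta> (f x)))" by (rule ext)
      then have "range \<theta> = range (\<lambda>x. g (\<theta> (f x)))" by (rule arg_cong)
      also have "\<dots> = g ` range (\<lambda>x. \<theta> (f x))" by (simp only: image_image)
      also have "\<dots> = range (\<lambda>x. g (\<theta> x))" unfolding shift by (simp only: image_image)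
      finally show ?thesis ..
    qed
    then have "g ` range \<theta> = range \<theta>" by (simp only: image_image)
    then show "y \<in> range \<theta> \<longleftrightarrow> g y \<in> range \<theta>" for y
      using inj_image_mem_iff[OF ginj, of y "range \<theta>"] by simp
  qed simp
  then have "\<theta> \<in> homeos" using homeosI[OF \<theta>_cont] \<theta>_inj by (simp add: bij_def)
  then show ?thesis using conj by blast
qed

lemma FCO_sym:
  assumes "\<phi> \<in> homeos" "\<phi> \<circ> f = g \<circ> \<phi> \<or> \<phi> \<circ> f = inv g \<circ> \<phi>" "f \<in> homeos" "g \<in> homeos"
  shows "\<exists>\<theta>\<in>homeos. \<theta> \<circ> g = f \<circ> \<theta> \<or> \<theta> \<circ> g = inv f \<circ> \<theta>"
proof (intro bexI[of _ "inv \<phi>"])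
  have b: "bij \<phi>" "bij f" "bij g" using assms homeos_bij by auto
  have \<phi>: "inv \<phi> (\<phi> x) = x" "\<phi> (inv \<phi> x) = x" for x
    using b(1) by (simp_all add: bij_is_inj bij_is_surj inv_f_f surj_f_inv_f)
  have f: "inv f (f x) = x" for x using b(2) by (simp add: bij_is_inj inv_f_f)
  have g: "g (inv g x) = x" for x using b(3) by (simp add: bij_is_surj surj_f_inv_f)
  show "inv \<phi> \<circ> g = f \<circ> inv \<phi> \<or> inv \<phi> \<circ> g = inv f \<circ> inv \<phi>"
    using assms(2)
  proof
    assume "\<phi> \<circ> f = g \<circ> \<phi>"
    then have "\<phi> (f x) = g (\<phi> x)" for x by (metis comp_apply)
    then have "inv \<phi> (g x) = f (inv \<phi> x)" for x using \<phi> by metis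
    then show ?thesis by (simp add: fun_eq_iff)
  next
    assume "\<phi> \<circ> f = inv g \<circ> \<phi>"
    then have "\<phi> (f x) = inv g (\<phi> x)" for x by (metis comp_apply)
    then have "g (\<phi> (f x)) = \<phi> x" for x using g by metis
    then have "inv \<phi> (g x) = inv f (inv \<phi> x)" for x
      using \<phi> f surj_f_inv_f[OF bij_is_surj[OF b(2)]] by metis
    then show ?thesis by (simp add: fun_eq_iff)
  qed
  show "inv \<phi> \<in> homeos" using assms(1) by (rule inv_homeos)
qed

section \<open>The reduction\<close>

context
  fixes \<iota> :: "(nat \<Rightarrow> letter) \<Rightarrow> cantor" and Ls Rs :: "nat \<Rightarrow> int"
  assumes iota: "homeomorphic_map K_space cantor_space \<iota>"
    and cofinal: "\<And>z n. \<exists>l\<ge>n. Ls l = z"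
    and LR: "\<And>l. Rs l - Ls l = 2 * int l + 1"
begin

lemma inj_cont_le_graph_of_iff:
  assumes f: "f \<in> minimal_homeos" and g: "g \<in> minimal_homeos"
  shows "inj_cont_le (graph_of \<iota> Ls Rs f) (graph_of \<iota> Ls Rs g) \<longleftrightarrow>
    (\<exists>\<psi>. continuous_map (subtopology K_space (vertex_hull Ls f)) (subtopology K_space (vertex_hull Ls g)) \<psi> \<and>
       inj_on \<psi> (vertex_hull Ls f) \<and> (\<forall>x y. (x, y) \<in> edges Ls f \<longrightarrow> (\<psi> x, \<psi> y) \<in> edges Ls g))"
    (is "?L \<longleftrightarrow> (\<exists>\<psi>. continuous_map ?X ?Y \<psi> \<and> _ \<psi> \<and> _ \<psi>)")
proof -
  let ?A = "vertex_hull Ls f" and ?B = "vertex_hull Ls g"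
  note eq = graph_of_eq[OF iota cofinal LR]
  obtain \<kappa> where "homeomorphic_maps K_space cantor_space \<iota> \<kappa>"
    using iota unfolding homeomorphic_map_maps by blast
  then have ik: "continuous_map K_space cantor_space \<iota>" "continuous_map cantor_space K_space \<kappa>"
    and \<kappa>[simp]: "\<kappa> (\<iota> x) = x" for x
    by (auto simp: homeomorphic_maps_def)
  have up: "continuous_map (subtopology K_space S) (subtopology cantor_space (\<iota> ` S)) \<iota>" for S
    unfolding continuous_map_in_subtopology using continuous_map_from_subtopology[OF ik(1)] by auto
  have down: "continuous_map (subtopology cantor_space (\<iota> ` S)) (subtopology K_space S) \<kappa>" for S
    unfolding continuous_map_in_subtopology using continuous_map_from_subtopology[OF ik(2)] by auto
  have i_inj: "inj \<iota>" by (metis \<kappa> injI)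
  show ?thesis
  proof
    assume ?L
    then obtain \<phi> where \<phi>: "continuous_map (subtopology cantor_space (\<iota> ` ?A)) (subtopology cantor_space (\<iota> ` ?B)) \<phi>"
      "inj_on \<phi> (\<iota> ` ?A)"
      "map_prod \<iota> \<iota> ` edges Ls f \<subseteq> {(x, y) \<in> \<iota> ` ?A \<times> \<iota> ` ?A. (\<phi> x, \<phi> y) \<in> map_prod \<iota> \<iota> ` edges Ls g}"
      unfolding inj_cont_le_def eq[OF f] eq[OF g] fst_conv snd_conv by (elim exE conjE) (rule that)
    have im: "\<phi> (\<iota> x) \<in> \<iota> ` ?B" if "x \<in> ?A" for x using \<phi>(1) that by (auto simp: continuous_map_in_subtopology)
    then have ikp: "\<iota> (\<kappa> (\<phi> (\<iota> x))) = \<phi> (\<iota> x)" if "x \<in> ?A" for x using that by force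
    show "\<exists>\<psi>. continuous_map ?X ?Y \<psi> \<and> inj_on \<psi> ?A \<and> (\<forall>x y. (x, y) \<in> edges Ls f \<longrightarrow> (\<psi> x, \<psi> y) \<in> edges Ls g)"
    proof (intro exI[of _ "\<kappa> \<circ> \<phi> \<circ> \<iota>"] conjI allI impI)
      show "continuous_map ?X ?Y (\<kappa> \<circ> \<phi> \<circ> \<iota>)"
        using continuous_map_compose[OF up continuous_map_compose[OF \<phi>(1) down]] .
      show "inj_on (\<kappa> \<circ> \<phi> \<circ> \<iota>) ?A"
      proof (rule inj_onI)
        fix x y assume xy: "x \<in> ?A" "y \<in> ?A" "(\<kappa> \<circ> \<phi> \<circ> \<iota>) x = (\<kappa> \<circ> \<phi> \<circ> \<iota>) y"
        then have "\<phi> (\<iota> x) = \<phi> (\<iota> y)" using ikp by (metis comp_apply)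
        then have "\<iota> x = \<iota> y" using inj_onD[OF \<phi>(2)] xy by blast
        then show "x = y" using i_inj by (rule injD[rotated])
      qed
      fix x y assume "(x, y) \<in> edges Ls f"
      then have "(\<iota> x, \<iota> y) \<in> map_prod \<iota> \<iota> ` edges Ls f" by force
      from subsetD[OF \<phi>(3) this]
      have "(\<phi> (\<iota> x), \<phi> (\<iota> y)) \<in> map_prod \<iota> \<iota> ` edges Ls g" by simp
      then show "((\<kappa> \<circ> \<phi> \<circ> \<iota>) x, (\<kappa> \<circ> \<phi> \<circ> \<iota>) y) \<in> edges Ls g" by auto
    qed
  next
    assume "\<exists>\<psi>. continuous_map ?X ?Y \<psi> \<and> inj_on \<psi> ?A \<and> (\<forall>x y. (x, y) \<in> edges Ls f \<longrightarrow> (\<psi> x, \<psi> y) \<in> edges Ls g)"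
    then obtain \<psi> where \<psi>: "continuous_map ?X ?Y \<psi>" "inj_on \<psi> ?A" "\<And>x y. (x, y) \<in> edges Ls f \<Longrightarrow> (\<psi> x, \<psi> y) \<in> edges Ls g"
      by blast
    show ?L
      unfolding inj_cont_le_def eq[OF f] eq[OF g] fst_conv snd_conv
    proof (intro exI[of _ "\<iota> \<circ> \<psi> \<circ> \<kappa>"] conjI)
      show "continuous_map (subtopology cantor_space (\<iota> ` ?A)) (subtopology cantor_space (\<iota> ` ?B)) (\<iota> \<circ> \<psi> \<circ> \<kappa>)"
        using continuous_map_compose[OF down continuous_map_compose[OF \<psi>(1) up]] .
      show "inj_on (\<iota> \<circ> \<psi> \<circ> \<kappa>) (\<iota> ` ?A)"
        using \<psi>(2) i_inj by (auto simp: inj_on_def)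
      show "map_prod \<iota> \<iota> ` edges Ls f \<subseteq> {(x, y) \<in> \<iota> ` ?A \<times> \<iota> ` ?A. ((\<iota> \<circ> \<psi> \<circ> \<kappa>) x, (\<iota> \<circ> \<psi> \<circ> \<kappa>) y) \<in> map_prod \<iota> \<iota> ` edges Ls g}"
      proof
        fix p assume "p \<in> map_prod \<iota> \<iota> ` edges Ls f"
        then obtain x y where p: "(x, y) \<in> edges Ls f" "p = (\<iota> x, \<iota> y)" by auto
        have "(\<iota> (\<psi> x), \<iota> (\<psi> y)) \<in> map_prod \<iota> \<iota> ` edges Ls g" using \<psi>(3)[OF p(1)] by force
        then show "p \<in> {(x, y) \<in> \<iota> ` ?A \<times> \<iota> ` ?A. ((\<iota> \<circ> \<psi> \<circ> \<kappa>) x, (\<iota> \<circ> \<psi> \<circ> \<kappa>) y) \<in> map_prod \<iota> \<iota> ` edges Ls g}"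
          using edges_vertices[OF p(1)] p(2) by simp
      qed
    qed
  qed
qed

lemma inj_cont_le_iff_conjugate:
  assumes f: "f \<in> minimal_homeos" and g: "g \<in> minimal_homeos"
  shows "inj_cont_le (graph_of \<iota> Ls Rs f) (graph_of \<iota> Ls Rs g) \<longleftrightarrow>
    (\<exists>\<phi>\<in>homeos. \<phi> \<circ> f = g \<circ> \<phi> \<or> \<phi> \<circ> f = inv g \<circ> \<phi>)"
  unfolding inj_cont_le_graph_of_iff[OF f g]
  using conjugate_if_homomorphism[OF f g cofinal] homomorphism_if_conjugate[OF f g cofinal] by metis

text \<open>
  A comparison in one direction already yields a conjugacy, and flip-conjugacy is symmetric.
\<close>
lemma FCO_iff_inj_cont_equiv:
  assumes f: "f \<in> minimal_homeos" and g: "g \<in> minimal_homeos"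
  shows "(f, g) \<in> FCO \<longleftrightarrow> (graph_of \<iota> Ls Rs f, graph_of \<iota> Ls Rs g) \<in> inj_cont_equiv \<iota>"
proof -
  have "(f, g) \<in> FCO \<longleftrightarrow> (\<exists>\<phi>\<in>homeos. \<phi> \<circ> f = g \<circ> \<phi> \<or> \<phi> \<circ> f = inv g \<circ> \<phi>)" (is "_ \<longleftrightarrow> ?C f g")
    using f g by (simp add: FCO_def)
  also have "\<dots> \<longleftrightarrow> ?C f g \<and> ?C g f"
    using FCO_sym minimal_homeos_homeos f g by blast
  also have "\<dots> \<longleftrightarrow> (graph_of \<iota> Ls Rs f, graph_of \<iota> Ls Rs g) \<in> inj_cont_equiv \<iota>"
    by (simp only: inj_cont_equiv_def mem_Collect_eq case_prod_conv simp_thms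
        graph_of_Sg[OF iota cofinal LR f] graph_of_Sg[OF iota cofinal LR g]
        inj_cont_le_iff_conjugate[OF f g] inj_cont_le_iff_conjugate[OF g f])
  finally show ?thesis .
qed

end

theorem theorem13p2:
  fixes \<iota> :: "(nat \<Rightarrow> letter) \<Rightarrow> cantor"
    and \<zeta> :: "nat \<Rightarrow> int"
    and Ls Rs :: "nat \<Rightarrow> int"
  assumes "homeomorphic_map K_space cantor_space \<iota>"
    and "\<And>z. infinite {m. \<zeta> m = z}"
    and "\<And>m. Ls (2 * m) = \<zeta> m"
    and "\<And>m. Rs (2 * m + 1) = \<zeta> m"
    and "\<And>l. Rs l - Ls l = 2 * int l + 1"
  shows "polish_space (Sg_space \<iota>)
    \<and> equiv (Sg \<iota>) (inj_cont_equiv \<iota>)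
    \<and> analytic_in (prod_topology (Sg_space \<iota>) (Sg_space \<iota>)) (inj_cont_equiv \<iota>)
    \<and> borel_reduces minimal_space FCO (Sg_space \<iota>) (inj_cont_equiv \<iota>) (graph_of \<iota> Ls Rs)
    \<and> (\<forall>f \<in> minimal_homeos. \<forall>x \<in> fst (graph_of \<iota> Ls Rs f).
         finite (neighbours (snd (graph_of \<iota> Ls Rs f)) x) \<and>
         card (neighbours (snd (graph_of \<iota> Ls Rs f)) x) \<le> 1)"
proof -
  have cofinal: "\<exists>l\<ge>n. Ls l = z" for z n
  proof -
    obtain m where "m \<ge> n" "\<zeta> m = z"
      using assms(2)[of z] unfolding infinite_nat_iff_unbounded_le by blast
    then show ?thesis using assms(3)[of m] by (intro exI[of _ "2 * m"]) simp
  qed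
  note params = assms(1) cofinal assms(5)
  have "borel_reduces minimal_space FCO (Sg_space \<iota>) (inj_cont_equiv \<iota>) (graph_of \<iota> Ls Rs)"
    unfolding borel_reduces_def
    using measurable_borel_of[OF continuous_map_graph_of[OF params]] FCO_iff_inj_cont_equiv[OF params] by simp
  then show ?thesis
    using polish_space_Sg_space equiv_inj_cont_equiv analytic_inj_cont_equiv graph_of_degree[OF params] by blast
qed

end
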